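(* Semi-sorted Enum restricted to queries from $\bigvee(\mathsf{S\text{-}RPQ}\cup\mathsf{BT\text{-}RPQ})$ can be solved with preprocessing time $O(|q|^{2}|\mathcal D|)$ and delay $O(|q|^{2}\Delta(\mathcal D))$.
   Context: $\Sigma$ is a fixed finite alphabet of constant size. A graph database over $\Sigma$ is a pair $\mathcal{D}=(V_{\mathcal D},E_{\mathcal D})$ with a finite node set and arc set $E_{\mathcal D}\subseteq V_{\mathcal D}\times\Sigma\times V_{\mathcal D}$, of size $|\mathcal D|=\max\{|V_{\mathcal D}|,|E_{\mathcal D}|\}$; it is represented by a list of nodes, whose order defines a linear order $\preceq$ on $V_{\mathcal D}$, and per node $u$ and letter $x$ a list of the $x$-successors of $u$. The degree of $u$ is the number of distinct nodes $v$ with $(u,x,v)\in E_{\mathcal D}$ for some $x$, and $\Delta(\mathcal D)$ is the maximum degree. A path from $u$ to $v$ is a sequence $u=w_0,a_1,w_1,\dots,a_k,w_k=v$ ($k\ge0$) with $(w_{i-1},a_i,w_i)\in E_{\mathcal D}$, labelled by $a_1\cdots a_k$. An RPQ $q$ is a regular expression over $\Sigma$ (built from $\varepsilon$, letters, concatenation, alternation $\mid$, Kleene plus, with $\alpha^*$ abbreviating $(\alpha^+\mid\varepsilon)$), $|q|$ its length; $q(\mathcal D)$ is the set of node pairs $(u,v)$ such that some path from $u$ to $v$ is labelled by a word in the language of $q$. $\mathsf{BT\text{-}RPQ}$ is the class of RPQs of the form $(x_1\mid\dots\mid x_k)^*$ or $(x_1\mid\dots\mid x_k)^+$, and $\mathsf{S\text{-}RPQ}$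 the class of RPQs of the form $(x_1\mid\dots\mid x_k)$ or $(x_1\mid\dots\mid x_k)(y_1\mid\dots\mid y_{k'})$, with all $x_i,y_j\in\Sigma$. For a class $Q$, $\bigvee(Q)$ is the set of RPQs $(q_1\mid\dots\mid q_m)$ with $m\ge1$, $q_i\in Q$. Model: RAM with logarithmic word size. Enumeration: preprocessing phase, then enumeration phase outputting every element of $q(\mathcal D)$ exactly once and signalling termination; delay = maximum time between start and first output, between consecutive outputs, and between last output and termination. Semi-sorted: pairs are ordered according to $\preceq$ on their first component (ties arbitrary). *)

theory Defs
  imports Complex_Main
begin

section \<open>Graph databases\<close>

type_synonym ('v, 'a) graph_db = "'v set \<times> ('v \<times> 'a \<times> 'v) set"

definition is_graph_db :: "'a set \<Rightarrow> ('v, 'a) graph_db \<Rightarrow> bool" where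
  "is_graph_db \<Sigma> D \<longleftrightarrow> finite (fst D) \<and> snd D \<subseteq> fst D \<times> \<Sigma> \<times> fst D"

definition db_size :: "('v, 'a) graph_db \<Rightarrow> nat" where
  "db_size D = max (card (fst D)) (card (snd D))"

definition degree :: "('v, 'a) graph_db \<Rightarrow> 'v \<Rightarrow> nat" where
  "degree D u = card {v. \<exists>x. (u, x, v) \<in> snd D}"

text \<open>The inserted 0 only matters for the database without nodes.\<close>

definition max_degree :: "('v, 'a) graph_db \<Rightarrow> nat" where
  "max_degree D = Max (insert 0 (degree D ` fst D))"

inductive path :: "('v, 'a) graph_db \<Rightarrow> 'v \<Rightarrow> 'a list \<Rightarrow> 'v \<Rightarrow> bool" for D where
  path_empty: "u \<in> fst D \<Longrightarrow> path D u [] u"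
| path_step: "(u, a, v) \<in> snd D \<Longrightarrow> path D v w v' \<Longrightarrow> path D u (a # w) v'"


section \<open>Regular path queries\<close>

datatype 'a rpq =
    Eps
  | Atom 'a
  | Conc "'a rpq" "'a rpq"
  | Alt "'a rpq" "'a rpq"
  | Plus "'a rpq"

abbreviation Star :: "'a rpq \<Rightarrow> 'a rpq" where
  "Star \<alpha> \<equiv> Alt (Plus \<alpha>) Eps"

primrec lang :: "'a rpq \<Rightarrow> 'a list set" where
  "lang Eps = {[]}"
| "lang (Atom x) = {[x]}"
| "lang (Conc \<alpha> \<beta>) = {u @ v | u v. u \<in> lang \<alpha> \<and> v \<in> lang \<beta>}"
| "lang (Alt \<alpha> \<beta>) = lang \<alpha> \<union> lang \<beta>"
| "lang (Plus \<alpha>) = {concat ws | ws. ws \<noteq> [] \<and> set ws \<subseteq> lang \<alpha>}"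

text \<open>Number of symbols; \<open>Star\<close> is only an abbreviation and contributes three.\<close>

primrec rpq_length :: "'a rpq \<Rightarrow> nat" where
  "rpq_length Eps = 1"
| "rpq_length (Atom x) = 1"
| "rpq_length (Conc \<alpha> \<beta>) = rpq_length \<alpha> + rpq_length \<beta> + 1"
| "rpq_length (Alt \<alpha> \<beta>) = rpq_length \<alpha> + rpq_length \<beta> + 1"
| "rpq_length (Plus \<alpha>) = rpq_length \<alpha> + 1"

definition answers :: "'a rpq \<Rightarrow> ('v, 'a) graph_db \<Rightarrow> ('v \<times> 'v) set" where
  "answers q D = {(u, v). \<exists>w \<in> lang q. path D u w v}"

text \<open>
  \<open>alternation qs r\<close> means that \<open>r\<close> is \<open>(q\<^sub>1 | \<dots> | q\<^sub>m)\<close> with \<open>qs = [q\<^sub>1, \<dots>, q\<^sub>m]\<close> and \<open>m \<ge> 1\<close>.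
  Since \<open>Alt\<close> is binary, every way of bracketing the alternation is admitted.
\<close>

inductive alternation :: "'a rpq list \<Rightarrow> 'a rpq \<Rightarrow> bool" where
  alternation_single: "alternation [q] q"
| alternation_alt: "alternation qs \<alpha> \<Longrightarrow> alternation rs \<beta> \<Longrightarrow> alternation (qs @ rs) (Alt \<alpha> \<beta>)"

definition letter_alts :: "'a set \<Rightarrow> 'a rpq set" where
  "letter_alts \<Sigma> = {\<alpha>. \<exists>xs. set xs \<subseteq> \<Sigma> \<and> alternation (map Atom xs) \<alpha>}"

definition BT_RPQ :: "'a set \<Rightarrow> 'a rpq set" where
  "BT_RPQ \<Sigma> = {Star \<alpha> | \<alpha>. \<alpha> \<in> letter_alts \<Sigma>} \<union> {Plus \<alpha> | \<alpha>. \<alpha> \<in> letter_alts \<Sigma>}"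

definition S_RPQ :: "'a set \<Rightarrow> 'a rpq set" where
  "S_RPQ \<Sigma> = letter_alts \<Sigma> \<union> {Conc \<alpha> \<beta> | \<alpha> \<beta>. \<alpha> \<in> letter_alts \<Sigma> \<and> \<beta> \<in> letter_alts \<Sigma>}"

definition alternations :: "'a rpq set \<Rightarrow> 'a rpq set" ("\<Or>'(_')") where
  "\<Or>(Q) = {r. \<exists>qs. set qs \<subseteq> Q \<and> alternation qs r}"


section \<open>RAM with logarithmic word size\<close>

text \<open>
  Registers, memory cells and addresses are words of \<open>w\<close> bits, i.e. natural numbers below \<open>2 ^ w\<close>;
  results of operations are reduced modulo \<open>2 ^ w\<close>, except that subtraction is cut off at 0.
  Every instruction costs one unit of time.
\<close>

type_synonym reg = nat

datatype binop = Add | Sub | Mul | Div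

datatype instr =
    Const reg nat
  | Op binop reg reg reg \<comment> \<open>target register first\<close>
  | Load reg reg \<comment> \<open>\<open>Load r s\<close>: \<open>r := mem[s]\<close>\<close>
  | Store reg reg \<comment> \<open>\<open>Store r s\<close>: \<open>mem[r] := s\<close>\<close>
  | Jump nat
  | JumpLess reg reg nat
  | JumpEq reg reg nat
  | EndPreprocessing
  | Output reg reg
  | Halt

record config =
  pc :: nat
  regs :: "reg \<Rightarrow> nat"
  mem :: "nat \<Rightarrow> nat"

datatype event = Preprocessed | Out nat nat | Halted

fun binop_sem :: "binop \<Rightarrow> nat \<Rightarrow> nat \<Rightarrow> nat" where
  "binop_sem Add m n = m + n"
| "binop_sem Sub m n = m - n"
| "binop_sem Mul m n = m * n"
| "binop_sem Div m n = m div n"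

definition fetch :: "instr list \<Rightarrow> config \<Rightarrow> instr" where
  "fetch P c = (if pc c < length P then P ! pc c else Halt)"

fun exec :: "nat \<Rightarrow> instr \<Rightarrow> config \<Rightarrow> config" where
  "exec w (Const r n) c = c\<lparr>pc := Suc (pc c), regs := (regs c)(r := take_bit w n)\<rparr>"
| "exec w (Op f r s t) c =
     c\<lparr>pc := Suc (pc c), regs := (regs c)(r := take_bit w (binop_sem f (regs c s) (regs c t)))\<rparr>"
| "exec w (Load r s) c = c\<lparr>pc := Suc (pc c), regs := (regs c)(r := mem c (regs c s))\<rparr>"
| "exec w (Store r s) c = c\<lparr>pc := Suc (pc c), mem := (mem c)(regs c r := regs c s)\<rparr>"
| "exec w (Jump l) c = c\<lparr>pc := l\<rparr>"
| "exec w (JumpLess r s l) c = c\<lparr>pc := (if regs c r < regs c s then l else Suc (pc c))\<rparr>"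
| "exec w (JumpEq r s l) c = c\<lparr>pc := (if regs c r = regs c s then l else Suc (pc c))\<rparr>"
| "exec w EndPreprocessing c = c\<lparr>pc := Suc (pc c)\<rparr>"
| "exec w (Output r s) c = c\<lparr>pc := Suc (pc c)\<rparr>"
| "exec w Halt c = c"

fun event_of :: "instr \<Rightarrow> config \<Rightarrow> event option" where
  "event_of EndPreprocessing c = Some Preprocessed"
| "event_of (Output r s) c = Some (Out (regs c r) (regs c s))"
| "event_of Halt c = Some Halted"
| "event_of _ c = None"

text \<open>The input occupies the initial memory cells; all other cells and all registers are 0.\<close>

definition init_config :: "nat \<Rightarrow> nat list \<Rightarrow> config" where
  "init_config w inp =
     \<lparr>pc = 0, regs = (\<lambda>_. 0), mem = (\<lambda>a. if a < length inp then take_bit w (inp ! a) else 0)\<rparr>"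

definition config_at :: "nat \<Rightarrow> instr list \<Rightarrow> nat list \<Rightarrow> nat \<Rightarrow> config" where
  "config_at w P inp t = ((\<lambda>c. exec w (fetch P c) c) ^^ t) (init_config w inp)"

definition event_at :: "nat \<Rightarrow> instr list \<Rightarrow> nat list \<Rightarrow> nat \<Rightarrow> event option" where
  "event_at w P inp t = event_of (fetch P (config_at w P inp t)) (config_at w P inp t)"

definition trace :: "nat \<Rightarrow> instr list \<Rightarrow> nat list \<Rightarrow> nat \<Rightarrow> (nat \<times> event) list" where
  "trace w P inp T = List.map_filter (\<lambda>t. map_option (Pair t) (event_at w P inp t)) [0..<Suc T]"

text \<open>
  \<open>w\<close> is \<open>k\<close> times the logarithm of the number of input cells; the constant \<open>k\<close> belongs to the
  algorithm.
\<close>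

definition word_size :: "nat \<Rightarrow> nat list \<Rightarrow> nat" where
  "word_size k inp = k * nat \<lceil>log 2 (real (length inp + 1))\<rceil>"

text \<open>
  On input \<open>inp\<close> the program ends its preprocessing within \<open>pre\<close> steps, then outputs exactly the
  list \<open>outs\<close> and halts, where the time between two consecutive events is at most \<open>del\<close>.
  The trace equation says that these are all events up to the termination time \<open>T\<close>.
\<close>

definition ram_enumerates ::
    "nat \<Rightarrow> instr list \<Rightarrow> nat list \<Rightarrow> (nat \<times> nat) list \<Rightarrow> nat \<Rightarrow> nat \<Rightarrow> bool" where
  "ram_enumerates w P inp outs pre del \<longleftrightarrow>
     (\<exists>tp ts T.
        length ts = length outs \<and>
        trace w P inp T =
          (tp, Preprocessed) # zip ts (map (\<lambda>(i, j). Out i j) outs) @ [(T, Halted)] \<and>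
        tp \<le> pre \<and>
        successively (\<lambda>s t. t - s \<le> del) (tp # ts @ [T]))"


section \<open>Representation of the input\<close>

text \<open>Letters and nodes are given to the machine as their positions in a list.\<close>

definition pos :: "'b list \<Rightarrow> 'b \<Rightarrow> nat" where
  "pos xs x = length (takeWhile (\<lambda>y. y \<noteq> x) xs)"

text \<open>
  The order of the node list \<open>ns\<close> is the linear order on the nodes, and \<open>succs u x\<close> lists the
  \<open>x\<close>-successors of \<open>u\<close>, in arbitrary order.
\<close>

definition represents ::
    "'a set \<Rightarrow> 'v list \<Rightarrow> ('v \<Rightarrow> 'a \<Rightarrow> 'v list) \<Rightarrow> ('v, 'a) graph_db \<Rightarrow> bool" where
  "represents \<Sigma> ns succs D \<longleftrightarrow>
     distinct ns \<and> set ns = fst D \<and>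
     (\<forall>u \<in> fst D. \<forall>x \<in> \<Sigma>. distinct (succs u x) \<and> set (succs u x) = {v. (u, x, v) \<in> snd D})"

text \<open>Queries are given in postfix notation, which needs no brackets.\<close>

primrec encode_rpq :: "'a list \<Rightarrow> 'a rpq \<Rightarrow> nat list" where
  "encode_rpq \<Sigma>s Eps = [0]"
| "encode_rpq \<Sigma>s (Atom x) = [4 + pos \<Sigma>s x]"
| "encode_rpq \<Sigma>s (Conc \<alpha> \<beta>) = encode_rpq \<Sigma>s \<alpha> @ encode_rpq \<Sigma>s \<beta> @ [1]"
| "encode_rpq \<Sigma>s (Alt \<alpha> \<beta>) = encode_rpq \<Sigma>s \<alpha> @ encode_rpq \<Sigma>s \<beta> @ [2]"
| "encode_rpq \<Sigma>s (Plus \<alpha>) = encode_rpq \<Sigma>s \<alpha> @ [3]"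

text \<open>
  The successor lists are stored one after the other, ordered by node and then by letter; in front
  of them there is a table with the offset of each list relative to the beginning of the first
  one, and a last entry with their total length.
\<close>

definition encode_db :: "'a list \<Rightarrow> 'v list \<Rightarrow> ('v \<Rightarrow> 'a \<Rightarrow> 'v list) \<Rightarrow> nat list" where
  "encode_db \<Sigma>s ns succs =
     (let ls = [succs u x. u \<leftarrow> ns, x \<leftarrow> \<Sigma>s]
      in map (\<lambda>j. length (concat (take j ls))) [0..<Suc (length ls)] @ map (pos ns) (concat ls))"

definition encode_input ::
    "'a list \<Rightarrow> 'v list \<Rightarrow> ('v \<Rightarrow> 'a \<Rightarrow> 'v list) \<Rightarrow> 'a rpq \<Rightarrow> nat list" where
  "encode_input \<Sigma>s ns succs q =
     [length ns, length (encode_rpq \<Sigma>s q)] @ encode_rpq \<Sigma>s q @ encode_db \<Sigma>s ns succs"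


section \<open>Semi-sorted enumeration\<close>

definition semi_sorted :: "'v list \<Rightarrow> ('v \<times> 'v) list \<Rightarrow> bool" where
  "semi_sorted ns ps \<longleftrightarrow> sorted (map (\<lambda>(u, v). pos ns u) ps)"

text \<open>
  The program \<open>P\<close>, run with word size constant \<open>k\<close>, solves semi-sorted enumeration over the alphabet
  listed by \<open>\<Sigma>s\<close> for all databases and all queries from \<open>Q\<close>, within the bounds \<open>pre q D\<close> on the
  preprocessing time and \<open>del q D\<close> on the delay.
\<close>

definition solves_semi_sorted_Enum ::
    "'a list \<Rightarrow> 'a rpq set \<Rightarrow> instr list \<Rightarrow> nat \<Rightarrow>
     ('a rpq \<Rightarrow> ('v, 'a) graph_db \<Rightarrow> nat) \<Rightarrow> ('a rpq \<Rightarrow> ('v, 'a) graph_db \<Rightarrow> nat) \<Rightarrow> bool" where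
  "solves_semi_sorted_Enum \<Sigma>s Q P k pre del \<longleftrightarrow>
     (\<forall>D ns succs. \<forall>q \<in> Q.
        is_graph_db (set \<Sigma>s) D \<longrightarrow> represents (set \<Sigma>s) ns succs D \<longrightarrow>
        (\<exists>ps. distinct ps \<and> set ps = answers q D \<and> semi_sorted ns ps \<and>
           (let inp = encode_input \<Sigma>s ns succs q
            in ram_enumerates (word_size k inp) P inp (map (\<lambda>(u, v). (pos ns u, pos ns v)) ps)
                 (pre q D) (del q D))))"

end

theory Submission
  imports Defs
begin

text \<open>
  An RPQ of the given class is an alternation of letters, pairs of letter alternations, and
  transitive closures of letter alternations. It is recognised by an automaton whose states are the
  positions of its letters and whose only non-accepting states are initial or are reached directly
  from the initial state. For every source node that has an answer at all (this is determined in
  the preprocessing phase) the product of the database and the automaton is searched breadth first.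
  The number of steps of this search is \<open>O(|q|\<^sup>2 \<Delta>)\<close> times one plus the number of answers found so far.
  The delay is therefore obtained by collecting the answers and printing one of them every
  \<open>O(|q|\<^sup>2 \<Delta>)\<close> steps. Visited nodes are marked with the number of the current source, so that
  no array has to be cleared between two sources.
\<close>

section \<open>A structured language on top of the RAM\<close>

text \<open>The obstacle is a pair such as (x | y)(x | y). Its intermediate nodes are no answers, a
  source may have n * Delta intermediate states, where n is the length of the query, and scanning n
  lists of Delta successors for each of them would cost n^2 * Delta^2. But all successors of an
  intermediate state are answers and a list has no repetitions, so each scan is also bounded by the
  number f of answers found so far. The accepting states number at most n * f and can afford n *
  Delta each. Both contributions are of order n^2 * Delta * (1 + f). This balance rests on one
  property of the queries (\<open>lab_acc\<close>): a position that may follow another one is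
  accepting. Sources without answers have to be skipped, since the time spent on them would add up
  between two outputs. The same property shows that two steps from a source decide whether it has an
  answer. Times are exact rather than asymptotic: the structured language carries the time since the
  last event in its state, and the compiled code takes precisely that many machine steps.\<close>

datatype aexp = N nat | V nat | Bin binop aexp aexp | Inp aexp | Arr nat aexp

datatype bexp = Less aexp aexp | Equal aexp aexp

datatype com =
    Skip
  | Assign nat aexp
  | Update nat aexp aexp
  | Seq com com
  | Cond bexp com com
  | While bexp com
  | Emit aexp aexp
  | Done

type_synonym env = "nat \<Rightarrow> nat"
type_synonym arrays = "nat \<Rightarrow> nat \<Rightarrow> nat"
type_synonym state = "env \<times> arrays \<times> nat \<times> event list"

text \<open>Expressions compile to straight-line code, so this is the length of the code and its
  running time at once. A variable costs 2 because a register is copied by adding 0 to it; an array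
  access spends 5 on the address.\<close>

fun acost :: "aexp \<Rightarrow> nat" where
  "acost (N c) = 1"
| "acost (V x) = 2"
| "acost (Bin f e1 e2) = acost e1 + acost e2 + 1"
| "acost (Inp e) = acost e + 1"
| "acost (Arr b e) = acost e + 6"

fun bcost :: "bexp \<Rightarrow> nat" where
  "bcost (Less e1 e2) = acost e1 + acost e2 + 1"
| "bcost (Equal e1 e2) = acost e1 + acost e2 + 1"

abbreviation (input) num_arrays :: nat where
  "num_arrays \<equiv> 16"

text \<open>\<open>I\<close> and \<open>F\<close> are the contents and the length of the input,
  \<open>B\<close> bounds every value and array index. The second assumption keeps values and
  addresses of array cells below \<open>2 ^ w\<close>, so that arithmetic never wraps
  around.\<close>

locale machine =
  fixes I :: "nat \<Rightarrow> nat" and F :: nat and B :: nat and w :: nat and pre del :: nat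
  assumes input_le: "\<And>i. I i \<le> B"
    and address_less: "F + num_arrays * B + num_arrays < 2 ^ w"
begin

fun aval :: "env \<Rightarrow> arrays \<Rightarrow> aexp \<Rightarrow> nat" where
  "aval v a (N c) = c"
| "aval v a (V x) = v x"
| "aval v a (Bin f e1 e2) = binop_sem f (aval v a e1) (aval v a e2)"
| "aval v a (Inp e) = I (aval v a e)"
| "aval v a (Arr b e) = a b (aval v a e)"

text \<open>A cut-off difference and a quotient are at most the first operand, which respects the
  bound already.\<close>

fun op_safe :: "binop \<Rightarrow> nat \<Rightarrow> nat \<Rightarrow> bool" where
  "op_safe Add x y = (x + y \<le> B)"
| "op_safe Mul x y = (x * y \<le> B)"
| "op_safe Sub x y = True"
| "op_safe Div x y = True"

fun safe :: "env \<Rightarrow> arrays \<Rightarrow> aexp \<Rightarrow> bool" where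
  "safe v a (N c) = (c \<le> B)"
| "safe v a (V x) = True"
| "safe v a (Bin f e1 e2) = (safe v a e1 \<and> safe v a e2 \<and> op_safe f (aval v a e1) (aval v a e2))"
| "safe v a (Inp e) = (safe v a e \<and> aval v a e < F)"
| "safe v a (Arr b e) = (safe v a e \<and> b < num_arrays)"

fun bval :: "env \<Rightarrow> arrays \<Rightarrow> bexp \<Rightarrow> bool" where
  "bval v a (Less e1 e2) = (aval v a e1 < aval v a e2)"
| "bval v a (Equal e1 e2) = (aval v a e1 = aval v a e2)"

fun bsafe :: "env \<Rightarrow> arrays \<Rightarrow> bexp \<Rightarrow> bool" where
  "bsafe v a (Less e1 e2) = (safe v a e1 \<and> safe v a e2)"
| "bsafe v a (Equal e1 e2) = (safe v a e1 \<and> safe v a e2)"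

text \<open>The third component of a state is the time that has passed since the last event, so that a bound
  on the delay is a precondition of every output. An operation whose result exceeds \<open>B\<close> is stuck.\<close>

inductive big :: "com \<Rightarrow> state \<Rightarrow> state \<Rightarrow> bool" where
  big_skip: "big Skip s s"
| big_assign: "safe v a e \<Longrightarrow>
    big (Assign x e) (v, a, g, h) (v(x := aval v a e), a, g + (acost e + 2), h)"
| big_update: "safe v a e1 \<Longrightarrow> safe v a e2 \<Longrightarrow> b < num_arrays \<Longrightarrow>
    big (Update b e1 e2) (v, a, g, h)
      (v, a(b := (a b)(aval v a e1 := aval v a e2)), g + (acost e1 + acost e2 + 6), h)"
| big_seq: "big c1 s s' \<Longrightarrow> big c2 s' s'' \<Longrightarrow> big (Seq c1 c2) s s''"
| big_cond_true: "bsafe v a b \<Longrightarrow> bval v a b \<Longrightarrow> big c1 (v, a, g + bcost b, h) s \<Longrightarrow>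
    big (Cond b c1 c2) (v, a, g, h) s"
| big_cond_false: "bsafe v a b \<Longrightarrow> \<not> bval v a b \<Longrightarrow> big c2 (v, a, g + bcost b, h) (v', a', g', h') \<Longrightarrow>
    big (Cond b c1 c2) (v, a, g, h) (v', a', g' + 1, h')"
| big_while_true: "bsafe v a b \<Longrightarrow> bval v a b \<Longrightarrow> big c (v, a, g + bcost b, h) (v', a', g', h') \<Longrightarrow>
    big (While b c) (v', a', g' + 1, h') s \<Longrightarrow> big (While b c) (v, a, g, h) s"
| big_while_false: "bsafe v a b \<Longrightarrow> \<not> bval v a b \<Longrightarrow>
    big (While b c) (v, a, g, h) (v, a, g + (bcost b + 1), h)"
| big_emit: "safe v a e1 \<Longrightarrow> safe v a e2 \<Longrightarrow> g + (acost e1 + acost e2) \<le> del \<Longrightarrow>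
    big (Emit e1 e2) (v, a, g, h) (v, a, 1, h @ [Out (aval v a e1) (aval v a e2)])"
| big_done: "g \<le> pre \<Longrightarrow> big Done (v, a, g, h) (v, a, 1, h @ [Preprocessed])"

text \<open>The existential form includes termination. For loop-free commands the rules below are
  equivalences, so the simplifier computes preconditions together with exact times.\<close>

definition wp :: "com \<Rightarrow> (env \<Rightarrow> arrays \<Rightarrow> nat \<Rightarrow> event list \<Rightarrow> bool) \<Rightarrow>
    env \<Rightarrow> arrays \<Rightarrow> nat \<Rightarrow> event list \<Rightarrow> bool" where
  "wp c Q v a g h \<longleftrightarrow> (\<exists>v' a' g' h'. big c (v, a, g, h) (v', a', g', h') \<and> Q v' a' g' h')"

inductive_cases big_skipE: "big Skip s t"
inductive_cases big_assignE: "big (Assign x e) (v, a, g, h) t"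
inductive_cases big_updateE: "big (Update b e1 e2) (v, a, g, h) t"
inductive_cases big_seqE: "big (Seq c1 c2) s t"
inductive_cases big_condE: "big (Cond b c1 c2) (v, a, g, h) t"
inductive_cases big_emitE: "big (Emit e1 e2) (v, a, g, h) t"
inductive_cases big_doneE: "big Done (v, a, g, h) t"

lemma wp_skip [simp]: "wp Skip Q v a g h \<longleftrightarrow> Q v a g h"
proof -
  have "big Skip s t \<longleftrightarrow> t = s" for s t by (auto intro: big_skip elim: big_skipE)
  then show ?thesis by (simp add: wp_def)
qed

lemma wp_assign [simp]:
  "wp (Assign x e) Q v a g h \<longleftrightarrow> safe v a e \<and> Q (v(x := aval v a e)) a (g + (acost e + 2)) h"
proof -
  have "big (Assign x e) (v, a, g, h) t \<longleftrightarrow>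
      safe v a e \<and> t = (v(x := aval v a e), a, g + (acost e + 2), h)" for t
    using big_assign by (auto elim!: big_assignE)
  then show ?thesis by (simp add: wp_def)
qed

lemma wp_update [simp]:
  "wp (Update b e1 e2) Q v a g h \<longleftrightarrow> safe v a e1 \<and> safe v a e2 \<and> b < num_arrays \<and>
     Q v (a(b := (a b)(aval v a e1 := aval v a e2))) (g + (acost e1 + acost e2 + 6)) h"
proof -
  have "big (Update b e1 e2) (v, a, g, h) t \<longleftrightarrow> safe v a e1 \<and> safe v a e2 \<and> b < num_arrays \<and>
      t = (v, a(b := (a b)(aval v a e1 := aval v a e2)), g + (acost e1 + acost e2 + 6), h)" for t
    using big_update by (auto elim!: big_updateE)
  then show ?thesis by (simp add: wp_def)
qed

lemma wp_seq [simp]: "wp (Seq c1 c2) Q v a g h \<longleftrightarrow> wp c1 (wp c2 Q) v a g h"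
proof -
  have "big (Seq c1 c2) s t \<longleftrightarrow> (\<exists>v a g h. big c1 s (v, a, g, h) \<and> big c2 (v, a, g, h) t)" for s t
    by (metis big_seq big_seqE prod_cases4)
  then show ?thesis by (simp add: wp_def) blast
qed

text \<open>Only the second branch pays an extra unit: its code precedes that of the first branch
  and ends with a jump over it.\<close>

lemma wp_cond [simp]:
  "wp (Cond b c1 c2) Q v a g h \<longleftrightarrow> bsafe v a b \<and>
     (if bval v a b then wp c1 Q v a (g + bcost b) h
      else wp c2 (\<lambda>v a g. Q v a (g + 1)) v a (g + bcost b) h)"
proof -
  have "big (Cond b c1 c2) (v, a, g, h) t \<longleftrightarrow> bsafe v a b \<and>
      (if bval v a b then big c1 (v, a, g + bcost b, h) t
       else \<exists>v' a' g' h'. big c2 (v, a, g + bcost b, h) (v', a', g', h') \<and> t = (v', a', g' + 1, h'))" for t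
  proof
    assume "big (Cond b c1 c2) (v, a, g, h) t"
    then show "bsafe v a b \<and> (if bval v a b then big c1 (v, a, g + bcost b, h) t
        else \<exists>v' a' g' h'. big c2 (v, a, g + bcost b, h) (v', a', g', h') \<and> t = (v', a', g' + 1, h'))"
      by (rule big_condE) auto
  qed (metis big_cond_true big_cond_false)
  then show ?thesis by (cases "bval v a b") (simp_all add: wp_def, blast+)
qed

lemma wp_emit [simp]:
  "wp (Emit e1 e2) Q v a g h \<longleftrightarrow> safe v a e1 \<and> safe v a e2 \<and> g + (acost e1 + acost e2) \<le> del \<and>
     Q v a 1 (h @ [Out (aval v a e1) (aval v a e2)])"
proof -
  have "big (Emit e1 e2) (v, a, g, h) t \<longleftrightarrow>
      safe v a e1 \<and> safe v a e2 \<and> g + (acost e1 + acost e2) \<le> del \<and>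
      t = (v, a, 1, h @ [Out (aval v a e1) (aval v a e2)])" for t
    using big_emit by (auto elim!: big_emitE)
  then show ?thesis by (simp add: wp_def)
qed

lemma wp_done [simp]: "wp Done Q v a g h \<longleftrightarrow> g \<le> pre \<and> Q v a 1 (h @ [Preprocessed])"
proof -
  have "big Done (v, a, g, h) t \<longleftrightarrow> g \<le> pre \<and> t = (v, a, 1, h @ [Preprocessed])" for t
    using big_done by (auto elim!: big_doneE)
  then show ?thesis by (simp add: wp_def)
qed

text \<open>Invariant and termination measure form a single predicate \<open>J m\<close>, to which
  every round returns with a smaller \<open>m\<close>. The unit added to the time is the jump back
  to the test.\<close>

lemma wp_while:
  fixes m :: nat
  assumes "J m v a g h"
    and step: "\<And>m v a g h. J m v a g h \<Longrightarrow> bsafe v a b \<and>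
      (if bval v a b then wp c (\<lambda>v a g h. \<exists>m'<m. J m' v a (g + 1) h) v a (g + bcost b) h
       else Q v a (g + (bcost b + 1)) h)"
  shows "wp (While b c) Q v a g h"
  using assms(1)
proof (induction m arbitrary: v a g h rule: less_induct)
  case (less m)
  note s = step[OF less.prems]
  show ?case
  proof (cases "bval v a b")
    case True
    then obtain v' a' g' h' m' where c: "big c (v, a, g + bcost b, h) (v', a', g', h')"
      and m': "m' < m" "J m' v' a' (g' + 1) h'"
      using s unfolding wp_def by auto
    have "wp (While b c) Q v' a' (g' + 1) h'"
      by (rule less.IH[OF m'])
    then show ?thesis
      using s c True unfolding wp_def by (blast intro: big_while_true)
  next
    case False
    then show ?thesis
      using s unfolding wp_def by (auto intro!: exI big_while_false[simplified])
  qed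
qed

end


section \<open>Compilation\<close>

text \<open>
  Register 0 holds the address behind the input, where the arrays begin; array \<open>b\<close> occupies the
  addresses congruent to \<open>b\<close> modulo the number of arrays from there. Odd registers hold the
  variables, the other even registers intermediate results.
\<close>

abbreviation var :: "nat \<Rightarrow> reg" where "var x \<equiv> 2 * x + 1"
abbreviation tmp :: "nat \<Rightarrow> reg" where "tmp t \<equiv> 2 * t + 2"

definition array_address :: "nat \<Rightarrow> nat \<Rightarrow> instr list" where
  "array_address b t =
     [Const (tmp (Suc t)) num_arrays, Op Mul (tmp t) (tmp t) (tmp (Suc t)), Const (tmp (Suc t)) b,
      Op Add (tmp t) (tmp t) (tmp (Suc t)), Op Add (tmp t) (tmp t) 0]"

fun acomp :: "aexp \<Rightarrow> nat \<Rightarrow> instr list" where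
  "acomp (N c) t = [Const (tmp t) c]"
| "acomp (V x) t = [Const (tmp t) 0, Op Add (tmp t) (var x) (tmp t)]"
| "acomp (Bin f e1 e2) t = acomp e1 t @ acomp e2 (Suc t) @ [Op f (tmp t) (tmp t) (tmp (Suc t))]"
| "acomp (Inp e) t = acomp e t @ [Load (tmp t) (tmp t)]"
| "acomp (Arr b e) t = acomp e t @ array_address b t @ [Load (tmp t) (tmp t)]"

fun bcomp :: "bexp \<Rightarrow> nat \<Rightarrow> instr list" where
  "bcomp (Less e1 e2) l = acomp e1 0 @ acomp e2 1 @ [JumpLess (tmp 0) (tmp 1) l]"
| "bcomp (Equal e1 e2) l = acomp e1 0 @ acomp e2 1 @ [JumpEq (tmp 0) (tmp 1) l]"

text \<open>Jump targets are absolute, hence the size of a command has to be known independently of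
  its address.\<close>

fun csize :: "com \<Rightarrow> nat" where
  "csize Skip = 0"
| "csize (Assign x e) = acost e + 2"
| "csize (Update b e1 e2) = acost e1 + acost e2 + 6"
| "csize (Seq c1 c2) = csize c1 + csize c2"
| "csize (Cond b c1 c2) = bcost b + csize c2 + 1 + csize c1"
| "csize (While b c) = bcost b + 1 + csize c + 1"
| "csize (Emit e1 e2) = acost e1 + acost e2 + 1"
| "csize Done = 1"

text \<open>A comparison jumps if it succeeds. The code for failure therefore comes first: the
  second branch of \<open>Cond\<close>, and for \<open>While\<close> a jump to the exit.\<close>

fun ccomp :: "com \<Rightarrow> nat \<Rightarrow> instr list" where
  "ccomp Skip l = []"
| "ccomp (Assign x e) l = acomp e 0 @ [Const (tmp 1) 0, Op Add (var x) (tmp 0) (tmp 1)]"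
| "ccomp (Update b e1 e2) l =
     acomp e1 0 @ array_address b 0 @ acomp e2 1 @ [Store (tmp 0) (tmp 1)]"
| "ccomp (Seq c1 c2) l = ccomp c1 l @ ccomp c2 (l + csize c1)"
| "ccomp (Cond b c1 c2) l =
     bcomp b (l + bcost b + csize c2 + 1) @ ccomp c2 (l + bcost b) @
     [Jump (l + bcost b + csize c2 + 1 + csize c1)] @ ccomp c1 (l + bcost b + csize c2 + 1)"
| "ccomp (While b c) l =
     bcomp b (l + bcost b + 1) @ [Jump (l + bcost b + 1 + csize c + 1)] @
     ccomp c (l + bcost b + 1) @ [Jump l]"
| "ccomp (Emit e1 e2) l = acomp e1 0 @ acomp e2 1 @ [Output (tmp 0) (tmp 1)]"
| "ccomp Done l = [EndPreprocessing]"

lemma length_array_address [simp]: "length (array_address b t) = 5"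
  by (simp add: array_address_def)

lemma length_acomp [simp]: "length (acomp e t) = acost e"
  by (induction e arbitrary: t) auto

lemma length_bcomp [simp]: "length (bcomp b l) = bcost b"
  by (cases b) auto

lemma length_ccomp [simp]: "length (ccomp c l) = csize c"
  by (induction c arbitrary: l) auto

definition code_at :: "instr list \<Rightarrow> nat \<Rightarrow> instr list \<Rightarrow> bool" where
  "code_at P l code \<longleftrightarrow> l + length code \<le> length P \<and> (\<forall>i<length code. P ! (l + i) = code ! i)"

lemma code_at_append [simp]:
  "code_at P l (xs @ ys) \<longleftrightarrow> code_at P l xs \<and> code_at P (l + length xs) ys"
proof -
  have "(\<forall>i<length (xs @ ys). P ! (l + i) = (xs @ ys) ! i) \<longleftrightarrow>
      (\<forall>i<length xs. P ! (l + i) = xs ! i) \<and> (\<forall>i<length ys. P ! (l + length xs + i) = ys ! i)"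
    (is "?L \<longleftrightarrow> ?R1 \<and> ?R2")
  proof (intro iffI conjI allI impI)
    fix i assume L: ?L and "i < length xs"
    then show "P ! (l + i) = xs ! i" using L[rule_format, of i] by (simp add: nth_append)
  next
    fix i assume L: ?L and "i < length ys"
    then show "P ! (l + length xs + i) = ys ! i"
      using L[rule_format, of "length xs + i"] by (simp add: add.assoc)
  next
    fix i assume R: "?R1 \<and> ?R2" and i: "i < length (xs @ ys)"
    show "P ! (l + i) = (xs @ ys) ! i"
    proof (cases "i < length xs")
      case True
      then show ?thesis using R by (simp add: nth_append)
    next
      case False
      then show ?thesis using R[THEN conjunct2, rule_format, of "i - length xs"] i
        by (simp add: nth_append)
    qed
  qed
  then show ?thesis by (auto simp: code_at_def)
qed

lemma fetch_code_at: "code_at P (pc s) [i] \<Longrightarrow> fetch P s = i"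
  unfolding code_at_def fetch_def by auto

lemma odd_neq_even [simp]: "2 * x \<noteq> Suc (2 * y)" "Suc (2 * y) \<noteq> 2 * x" "2 * x \<noteq> (3 :: nat)"
  by (presburger, presburger, presburger)

fun straight :: "instr \<Rightarrow> bool" where
  "straight (Const _ _) = True"
| "straight (Op _ _ _ _) = True"
| "straight (Load _ _) = True"
| "straight (Store _ _) = True"
| "straight _ = False"

lemma straight_acomp: "list_all straight (acomp e t)"
  by (induction e arbitrary: t) (auto simp: array_address_def)

lemma pc_fold_exec: "list_all straight code \<Longrightarrow> pc (fold (exec w) code s) = pc s + length code"
proof (induction code arbitrary: s)
  case (Cons i code)
  then show ?case by (cases i) auto
qed simp

section \<open>Simulation of the structured language by machine steps\<close>

context machine
begin

fun limit :: "event \<Rightarrow> nat" where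
  "limit Preprocessed = pre"
| "limit _ = del"

text \<open>Configurations carry the time since the last event and the events so far. An event is
  dated at the start of its instruction, which takes one step itself; this is why the time restarts
  at 1. \<open>Halt\<close> would raise its event forever and is left to the end of the run.\<close>

inductive gstep :: "instr list \<Rightarrow> config \<times> nat \<times> event list \<Rightarrow> config \<times> nat \<times> event list \<Rightarrow> bool"
  for P where
  gstep_silent: "event_of (fetch P s) s = None \<Longrightarrow>
    gstep P (s, g, h) (exec w (fetch P s) s, g + 1, h)"
| gstep_event: "event_of (fetch P s) s = Some ev \<Longrightarrow> ev \<noteq> Halted \<Longrightarrow> g \<le> limit ev \<Longrightarrow>
    gstep P (s, g, h) (exec w (fetch P s) s, 1, h @ [ev])"

abbreviation gsteps where "gsteps P \<equiv> (gstep P)\<^sup>*\<^sup>*"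

text \<open>Register 0 is left out on purpose: the relation must hold already while the prologue
  computes the content of that register.\<close>

definition rel :: "config \<Rightarrow> env \<Rightarrow> arrays \<Rightarrow> bool" where
  "rel s v a \<longleftrightarrow>
     (\<forall>x. regs s (var x) = v x) \<and> (\<forall>x. v x \<le> B) \<and>
     (\<forall>i<F. mem s i = I i) \<and> (\<forall>b<num_arrays. \<forall>i\<le>B. mem s (F + num_arrays * i + b) = a b i) \<and>
     (\<forall>b i. a b i \<le> B)"

lemma take_bit_le: "n \<le> F + num_arrays * B + num_arrays \<Longrightarrow> take_bit w n = n"
  using address_less by (simp add: take_bit_nat_eq_self)

lemma aval_le: "rel s v a \<Longrightarrow> safe v a e \<Longrightarrow> aval v a e \<le> B"
proof (induction e)
  case (Bin f e1 e2)
  then show ?case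
    by (cases f) (auto simp: le_diff_conv trans_le_add1 intro: le_trans[OF div_le_dividend])
qed (auto simp: rel_def input_le)

lemma fold_array_address:
  assumes "regs s (tmp t) \<le> B" "b < num_arrays" "regs s 0 = F"
  defines "s' \<equiv> fold (exec w) (array_address b t) s"
  shows "mem s' = mem s" "regs s' (tmp t) = F + num_arrays * regs s (tmp t) + b"
    "x = 0 \<or> odd x \<or> x < tmp t \<Longrightarrow> regs s' x = regs s x"
proof -
  define y where "y = regs s (Suc (Suc (2 * t)))"
  have y: "y \<le> B" "regs s (Suc (Suc (2 * t))) = y" using assms by (auto simp: y_def)
  have [simp]: "take_bit w (num_arrays::nat) = num_arrays" "take_bit w b = b"
    "take_bit w (y * num_arrays) = y * num_arrays" "take_bit w (y * num_arrays + b) = y * num_arrays + b"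
    "take_bit w (y * num_arrays + b + F) = y * num_arrays + b + F"
    using assms(2,3) y(1) by (auto intro!: take_bit_le)
  have "s' = s\<lparr>pc := Suc (Suc (Suc (Suc (Suc (pc s))))),
      regs := (regs s)(tmp (Suc t) := b, tmp t := y * num_arrays + b + F)\<rparr>"
    using assms(3) y(2) unfolding s'_def array_address_def by (simp add: fun_upd_twist)
  then show "mem s' = mem s" "regs s' (tmp t) = F + num_arrays * regs s (tmp t) + b"
    "x = 0 \<or> odd x \<or> x < tmp t \<Longrightarrow> regs s' x = regs s x"
    using y(2) by auto
qed

fun array_free :: "aexp \<Rightarrow> bool" where
  "array_free (Arr _ _) = False"
| "array_free (Bin _ e1 e2) = (array_free e1 \<and> array_free e2)"
| "array_free (Inp e) = array_free e"
| "array_free _ = True"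

lemma rel_cong:
  assumes "rel s v a" "mem s' = mem s" "\<And>x. odd x \<Longrightarrow> regs s' x = regs s x"
  shows "rel s' v a"
  using assms by (simp add: rel_def)

text \<open>The temporaries form a stack: \<open>tmp t\<close> receives the value and nothing below
  it changes, so the left operand survives the evaluation of the right one. The alternative
  \<open>array_free e\<close> serves the prologue, where register 0 is not yet set.\<close>

lemma fold_acomp:
  assumes "rel s v a" "safe v a e" "regs s 0 = F \<or> array_free e"
  shows "mem (fold (exec w) (acomp e t) s) = mem s \<and>
    regs (fold (exec w) (acomp e t) s) (tmp t) = aval v a e \<and>
    (\<forall>x. x = 0 \<or> odd x \<or> x < tmp t \<longrightarrow> regs (fold (exec w) (acomp e t) s) x = regs s x)"
  using assms
proof (induction e arbitrary: t s)
  case (N c)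
  then have "take_bit w c = c" by (intro take_bit_le) auto
  then show ?case by auto
next
  case (V x)
  then have "v x \<le> B" and x: "regs s (var x) = v x" by (simp_all add: rel_def)
  then have "take_bit w (v x) = v x" by (intro take_bit_le) simp
  with x show ?case by simp
next
  case (Bin f e1 e2)
  define s1 where "s1 = fold (exec w) (acomp e1 t) s"
  define s2 where "s2 = fold (exec w) (acomp e2 (Suc t)) s1"
  have s1: "mem s1 = mem s" "regs s1 (tmp t) = aval v a e1"
    "\<And>x. x = 0 \<or> odd x \<or> x < tmp t \<Longrightarrow> regs s1 x = regs s x"
    using Bin.IH(1)[of s t] Bin.prems by (auto simp: s1_def)
  have "rel s1 v a" by (rule rel_cong[OF Bin.prems(1) s1(1)]) (simp add: s1(3))
  then have s2: "mem s2 = mem s1" "regs s2 (tmp (Suc t)) = aval v a e2"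
    "\<And>x. x = 0 \<or> odd x \<or> x < tmp (Suc t) \<Longrightarrow> regs s2 x = regs s1 x"
    using Bin.IH(2)[of s1 "Suc t"] Bin.prems s1(3)[of 0] by (auto simp: s2_def)
  have "aval v a (Bin f e1 e2) \<le> B" by (rule aval_le[OF Bin.prems(1,2)])
  then have "take_bit w (aval v a (Bin f e1 e2)) = aval v a (Bin f e1 e2)"
    by (intro take_bit_le) simp
  moreover have "regs s2 (tmp t) = aval v a e1"
    using s1(2) s2(3)[of "tmp t"] by simp
  moreover have "fold (exec w) (acomp (Bin f e1 e2) t) s =
      exec w (Op f (tmp t) (tmp t) (tmp (Suc t))) s2"
    by (simp add: s1_def s2_def)
  moreover have "x = 0 \<or> odd x \<or> x < tmp t \<Longrightarrow> regs s2 x = regs s x" for x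
    using s1(3)[of x] s2(3)[of x] by auto
  ultimately show ?case
    using s1(1) s2(1,2) by (auto simp del: acomp.simps)
next
  case (Inp e)
  define s1 where "s1 = fold (exec w) (acomp e t) s"
  have s1: "mem s1 = mem s" "regs s1 (tmp t) = aval v a e"
    "\<And>x. x = 0 \<or> odd x \<or> x < tmp t \<Longrightarrow> regs s1 x = regs s x"
    using Inp.IH[of s t] Inp.prems by (auto simp: s1_def)
  have "fold (exec w) (acomp (Inp e) t) s = exec w (Load (tmp t) (tmp t)) s1"
    by (simp add: s1_def)
  then show ?case using s1 Inp.prems by (auto simp: rel_def simp del: acomp.simps)
next
  case (Arr b e)
  define s1 where "s1 = fold (exec w) (acomp e t) s"
  define s2 where "s2 = fold (exec w) (array_address b t) s1"
  have s1: "mem s1 = mem s" "regs s1 (tmp t) = aval v a e"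
    "\<And>x. x = 0 \<or> odd x \<or> x < tmp t \<Longrightarrow> regs s1 x = regs s x"
    using Arr.IH[of s t] Arr.prems by (auto simp: s1_def)
  have le: "aval v a e \<le> B" using Arr.prems aval_le by auto
  have s2: "mem s2 = mem s1" "regs s2 (tmp t) = F + num_arrays * aval v a e + b"
    "\<And>x. x = 0 \<or> odd x \<or> x < tmp t \<Longrightarrow> regs s2 x = regs s1 x"
    using fold_array_address[of s1 t b] le Arr.prems s1(2) s1(3)[of 0] by (auto simp: s2_def)
  have "mem s (F + num_arrays * aval v a e + b) = a b (aval v a e)"
    using Arr.prems le by (simp add: rel_def)
  moreover have "fold (exec w) (acomp (Arr b e) t) s = exec w (Load (tmp t) (tmp t)) s2"
    by (simp add: s1_def s2_def)
  moreover have "x = 0 \<or> odd x \<or> x < tmp t \<Longrightarrow> regs s2 x = regs s x" for x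
    using s1(3)[of x] s2(3)[of x] by auto
  ultimately show ?case using s1(1) s2(1,2) by (auto simp del: acomp.simps)
qed


lemma gsteps_straight:
  "list_all straight code \<Longrightarrow> code_at P (pc s) code \<Longrightarrow>
    gsteps P (s, g, h) (fold (exec w) code s, g + length code, h)"
proof (induction code arbitrary: s g)
  case (Cons i code)
  have c: "code_at P (pc s) [i]" "code_at P (Suc (pc s)) code"
    using Cons.prems(2) code_at_append[of P "pc s" "[i]" code] by simp_all
  have f: "fetch P s = i" by (rule fetch_code_at[OF c(1)])
  have "event_of i s = None" "pc (exec w i s) = Suc (pc s)"
    using Cons.prems(1) by (cases i; simp)+
  then have "gstep P (s, g, h) (exec w i s, g + 1, h)"
    "gsteps P (exec w i s, g + 1, h) (fold (exec w) code (exec w i s), g + 1 + length code, h)"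
    using gstep_silent[of P s g h] Cons.IH[of "exec w i s" "g + 1"] Cons.prems(1) c(2) by (auto simp: f)
  then show ?case by (auto intro: converse_rtranclp_into_rtranclp)
qed simp

definition simulates :: "config \<Rightarrow> env \<Rightarrow> arrays \<Rightarrow> bool" where
  "simulates s v a \<longleftrightarrow> rel s v a \<and> regs s 0 = F"

lemma gsteps_acomp:
  assumes "simulates s v a" "safe v a e" "code_at P (pc s) (acomp e t)"
  obtains s' where "gsteps P (s, g, h) (s', g + acost e, h)" "simulates s' v a"
    "pc s' = pc s + acost e" "mem s' = mem s" "regs s' (tmp t) = aval v a e"
    "\<And>x. odd x \<or> x < tmp t \<Longrightarrow> regs s' x = regs s x"
proof (rule that)
  let ?s' = "fold (exec w) (acomp e t) s"
  show "gsteps P (s, g, h) (?s', g + acost e, h)"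
    using gsteps_straight[OF straight_acomp assms(3)] by simp
  show "pc ?s' = pc s + acost e"
    using pc_fold_exec[OF straight_acomp] by simp
  have "rel s v a" "regs s 0 = F" using assms(1) by (auto simp: simulates_def)
  note f = fold_acomp[OF this(1) assms(2), of t]
  show "mem ?s' = mem s" "regs ?s' (tmp t) = aval v a e"
    "\<And>x. odd x \<or> x < tmp t \<Longrightarrow> regs ?s' x = regs s x"
    using f \<open>regs s 0 = F\<close> by auto
  show "simulates ?s' v a"
    unfolding simulates_def using f \<open>regs s 0 = F\<close> rel_cong[OF \<open>rel s v a\<close>, of ?s'] by simp
qed

lemma gstep_silentI:
  "code_at P (pc s) [i] \<Longrightarrow> event_of i s = None \<Longrightarrow> s' = exec w i s \<Longrightarrow> g' = g + 1 \<Longrightarrow>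
    gstep P (s, g, h) (s', g', h)"
  using gstep_silent[of P s g h] by (simp add: fetch_code_at)

lemma gstep_eventI:
  "code_at P (pc s) [i] \<Longrightarrow> event_of i s = Some ev \<Longrightarrow> ev \<noteq> Halted \<Longrightarrow> g \<le> limit ev \<Longrightarrow>
    s' = exec w i s \<Longrightarrow> h' = h @ [ev] \<Longrightarrow> gstep P (s, g, h) (s', 1, h')"
  using gstep_event[of P s ev g h] by (simp add: fetch_code_at)

lemma gsteps_acomp2:
  assumes "simulates s v a" "safe v a e1" "safe v a e2" "code_at P (pc s) (acomp e1 0 @ acomp e2 1)"
  obtains s' where "gsteps P (s, g, h) (s', g + acost e1 + acost e2, h)" "simulates s' v a"
    "pc s' = pc s + acost e1 + acost e2" "regs s' (tmp 0) = aval v a e1" "regs s' (tmp 1) = aval v a e2"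
proof -
  have c1: "code_at P (pc s) (acomp e1 0)" and c2: "code_at P (pc s + acost e1) (acomp e2 1)"
    using assms(4) by auto
  obtain s1 where s1: "gsteps P (s, g, h) (s1, g + acost e1, h)" "simulates s1 v a"
    "pc s1 = pc s + acost e1" "regs s1 (tmp 0) = aval v a e1"
    using gsteps_acomp[OF assms(1,2) c1, of g h thesis] by blast
  obtain s2 where s2: "gsteps P (s1, g + acost e1, h) (s2, g + acost e1 + acost e2, h)"
    "simulates s2 v a" "pc s2 = pc s1 + acost e2" "regs s2 (tmp 1) = aval v a e2"
    "\<And>x. odd x \<or> x < tmp 1 \<Longrightarrow> regs s2 x = regs s1 x"
    using gsteps_acomp[OF s1(2) assms(3) c2[folded s1(3)], of "g + acost e1" h thesis] by blast
  show ?thesis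
  proof (rule that)
    show "gsteps P (s, g, h) (s2, g + acost e1 + acost e2, h)"
      using s1(1) s2(1) by (rule rtranclp_trans)
    show "regs s2 (tmp 0) = aval v a e1"
      using s2(5)[of "tmp 0"] s1(4) by simp
  qed (use s1(3) s2(2-4) in simp_all)
qed

lemma gsteps_bcomp:
  assumes "simulates s v a" "bsafe v a b" "code_at P (pc s) (bcomp b l)"
  obtains s' where "gsteps P (s, g, h) (s', g + bcost b, h)" "simulates s' v a"
    "pc s' = (if bval v a b then l else pc s + bcost b)"
proof -
  obtain e1 e2 i where b: "(b = Less e1 e2 \<and> i = JumpLess (tmp 0) (tmp 1) l) \<or>
      (b = Equal e1 e2 \<and> i = JumpEq (tmp 0) (tmp 1) l)"
    by (cases b) auto
  have safe: "safe v a e1" "safe v a e2" and cost: "bcost b = acost e1 + acost e2 + 1"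
    and c: "code_at P (pc s) (acomp e1 0 @ acomp e2 1)" "code_at P (pc s + acost e1 + acost e2) [i]"
    using b assms(2,3) by auto
  obtain s1 where s1: "gsteps P (s, g, h) (s1, g + acost e1 + acost e2, h)" "simulates s1 v a"
    "pc s1 = pc s + acost e1 + acost e2" "regs s1 (tmp 0) = aval v a e1" "regs s1 (tmp 1) = aval v a e2"
    using gsteps_acomp2[OF assms(1) safe c(1), of g h thesis] by blast
  let ?s' = "s1\<lparr>pc := if bval v a b then l else pc s + bcost b\<rparr>"
  have "gstep P (s1, g + acost e1 + acost e2, h) (?s', g + bcost b, h)"
    by (rule gstep_silentI[of P s1 i]) (use b s1 c(2) cost in auto)
  with s1(1) have "gsteps P (s, g, h) (?s', g + bcost b, h)"
    by (rule rtranclp.rtrancl_into_rtrancl)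
  moreover have "simulates ?s' v a"
    using s1(2) by (simp add: simulates_def rel_def)
  ultimately show ?thesis by (intro that[of ?s']) auto
qed

lemma gstep_jump:
  "simulates s v a \<Longrightarrow> code_at P (pc s) [Jump l] \<Longrightarrow>
    gstep P (s, g, h) (s\<lparr>pc := l\<rparr>, g + 1, h) \<and> simulates (s\<lparr>pc := l\<rparr>) v a"
  by (auto intro!: gstep_silentI simp: simulates_def rel_def)

text \<open>Division by the number of arrays recovers index and array from an address, so a store
  changes a single entry of a single array.\<close>

lemma simulates_update:
  assumes "simulates s v a" "i \<le> B" "n \<le> B" "b < num_arrays"
  shows "simulates (s\<lparr>pc := p, mem := (mem s)(F + num_arrays * i + b := n)\<rparr>) v (a(b := (a b)(i := n)))"
proof -
  have eq: "num_arrays * i' + b' = num_arrays * i + b \<longleftrightarrow> i' = i \<and> b' = b" if "b' < num_arrays" for i' b'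
  proof
    assume "num_arrays * i' + b' = num_arrays * i + b"
    then have "(num_arrays * i' + b') div num_arrays = (num_arrays * i + b) div num_arrays"
      "(num_arrays * i' + b') mod num_arrays = (num_arrays * i + b) mod num_arrays" by simp_all
    then show "i' = i \<and> b' = b" using that assms(4) by simp
  qed simp
  show ?thesis
    using assms unfolding simulates_def rel_def by (simp add: eq)
qed

lemma gsteps_update:
  assumes "simulates s v a" "safe v a e1" "safe v a e2" "b < num_arrays"
    "code_at P (pc s) (ccomp (Update b e1 e2) (pc s))"
  shows "\<exists>s'. gsteps P (s, g, h) (s', g + (acost e1 + acost e2 + 6), h) \<and>
    simulates s' v (a(b := (a b)(aval v a e1 := aval v a e2))) \<and> pc s' = pc s + (acost e1 + acost e2 + 6)"
proof -
  have c: "code_at P (pc s) (acomp e1 0)" "code_at P (pc s + acost e1) (array_address b 0)"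
    "code_at P (pc s + acost e1 + 5) (acomp e2 1)"
    "code_at P (pc s + acost e1 + 5 + acost e2) [Store (tmp 0) (tmp 1)]"
    using assms(5) by auto
  have le: "aval v a e1 \<le> B" "aval v a e2 \<le> B"
    using assms(1,2,3) aval_le by (auto simp: simulates_def)
  obtain s1 where s1: "gsteps P (s, g, h) (s1, g + acost e1, h)" "simulates s1 v a"
    "pc s1 = pc s + acost e1" "regs s1 (tmp 0) = aval v a e1"
    using gsteps_acomp[OF assms(1,2) c(1), of g h thesis] by blast
  define s2 where "s2 = fold (exec w) (array_address b 0) s1"
  have st: "list_all straight (array_address b 0)" by (simp add: array_address_def)
  have "regs s1 0 = F" "rel s1 v a" using s1(2) by (simp_all add: simulates_def)
  have s2: "mem s2 = mem s1" "regs s2 (tmp 0) = F + num_arrays * aval v a e1 + b"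
    "\<And>x. x = 0 \<or> odd x \<or> x < tmp 0 \<Longrightarrow> regs s2 x = regs s1 x"
    using fold_array_address[of s1 0 b] le(1) s1(4) assms(4) \<open>regs s1 0 = F\<close>
    by (auto simp: s2_def)
  have sim2: "simulates s2 v a"
    using \<open>regs s1 0 = F\<close> rel_cong[OF \<open>rel s1 v a\<close> s2(1)] s2(3) by (simp add: simulates_def)
  have pc2: "pc s2 = pc s + acost e1 + 5"
    using pc_fold_exec[OF st, of w s1] s1(3) by (simp add: s2_def)
  have g2: "gsteps P (s1, g + acost e1, h) (s2, g + acost e1 + 5, h)"
    using gsteps_straight[OF st, of P s1 "g + acost e1" h] c(2) s1(3) by (simp add: s2_def)
  obtain s3 where s3: "gsteps P (s2, g + acost e1 + 5, h) (s3, g + acost e1 + 5 + acost e2, h)"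
    "simulates s3 v a" "pc s3 = pc s2 + acost e2" "regs s3 (tmp 1) = aval v a e2"
    "\<And>x. odd x \<or> x < tmp 1 \<Longrightarrow> regs s3 x = regs s2 x"
    using gsteps_acomp[OF sim2 assms(3) c(3)[folded pc2], of "g + acost e1 + 5" h thesis] by blast
  define s4 where "s4 = exec w (Store (tmp 0) (tmp 1)) s3"
  have r: "regs s3 (tmp 0) = F + num_arrays * aval v a e1 + b"
    using s2(2) s3(5)[of "tmp 0"] by simp
  have "gstep P (s3, g + acost e1 + 5 + acost e2, h) (s4, g + (acost e1 + acost e2 + 6), h)"
    by (rule gstep_silentI) (use c(4) pc2 s3(3) in \<open>auto simp: s4_def\<close>)
  from rtranclp.rtrancl_into_rtrancl[OF rtranclp_trans[OF rtranclp_trans[OF s1(1) g2] s3(1)] this]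
  have "gsteps P (s, g, h) (s4, g + (acost e1 + acost e2 + 6), h)" .
  moreover have "s4 = s3\<lparr>pc := Suc (pc s3),
      mem := (mem s3)(F + num_arrays * aval v a e1 + b := aval v a e2)\<rparr>"
    using r s3(4) by (simp add: s4_def)
  ultimately show ?thesis
    using simulates_update[OF s3(2) le(1,2) assms(4)] pc2 s3(3) by (intro exI[of _ s4]) auto
qed

text \<open>The time in \<open>big\<close> counts machine steps exactly, so the induction has the
  same \<open>g\<close> and \<open>h\<close> on both sides, and the guards on outputs in
  \<open>big\<close> become those of \<open>gstep\<close>.\<close>

lemma gsteps_ccomp:
  assumes "big c (v, a, g, h) (v', a', g', h')" "simulates s v a" "code_at P (pc s) (ccomp c (pc s))"
  shows "\<exists>s'. gsteps P (s, g, h) (s', g', h') \<and> simulates s' v' a' \<and> pc s' = pc s + csize c"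
  using assms
proof (induction c "(v, a, g, h)" "(v', a', g', h')" arbitrary: v a g h v' a' g' h' s rule: big.induct)
  case (big_assign v a e x g h)
  have c: "code_at P (pc s) (acomp e 0)"
    "code_at P (pc s + acost e) [Const (tmp 1) 0, Op Add (var x) (tmp 0) (tmp 1)]"
    using big_assign.prems(2) by auto
  obtain s1 where s1: "gsteps P (s, g, h) (s1, g + acost e, h)" "simulates s1 v a"
    "pc s1 = pc s + acost e" "regs s1 (tmp 0) = aval v a e"
    using gsteps_acomp[OF big_assign.prems(1) big_assign.hyps c(1), of g h thesis] by blast
  define s2 where "s2 = fold (exec w) [Const (tmp 1) 0, Op Add (var x) (tmp 0) (tmp 1)] s1"
  have "gsteps P (s1, g + acost e, h) (s2, g + acost e + 2, h)"
    using gsteps_straight[of "[Const (tmp 1) 0, Op Add (var x) (tmp 0) (tmp 1)]" P s1 "g + acost e" h]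
      c(2) s1(3) by (simp add: s2_def)
  with s1(1) have "gsteps P (s, g, h) (s2, g + acost e + 2, h)" by (rule rtranclp_trans)
  moreover have le: "aval v a e \<le> B"
    using aval_le big_assign s1(2) by (auto simp: simulates_def)
  moreover have "take_bit w (aval v a e) = aval v a e" by (rule take_bit_le) (use le in simp)
  ultimately show ?case
    using s1(2,3,4) by (intro exI[of _ s2]) (auto simp: s2_def simulates_def rel_def)
next
  case (big_update v a e1 e2 b g h)
  then show ?case using gsteps_update by simp
next
  case (big_seq c1 s' c2)
  obtain v1 a1 g1 h1 where s': "s' = (v1, a1, g1, h1)" by (cases s')
  from big_seq.hyps(2)[OF s'] big_seq.prems obtain s1 where
    s1: "gsteps P (s, g, h) (s1, g1, h1)" "simulates s1 v1 a1" "pc s1 = pc s + csize c1"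
    by auto
  from big_seq.hyps(4)[OF s' s1(2)] big_seq.prems(2) s1(3) obtain s2 where
    "gsteps P (s1, g1, h1) (s2, g', h')" "simulates s2 v' a'" "pc s2 = pc s1 + csize c2"
    by auto
  with s1 show ?case by (intro exI[of _ s2]) auto
next
  case (big_cond_true v a b c1 g h c2)
  let ?m = "pc s + bcost b + csize c2 + 1"
  have c: "code_at P (pc s) (bcomp b ?m)" "code_at P ?m (ccomp c1 ?m)"
    using big_cond_true.prems(2)
      code_at_append[of P "pc s + bcost b + csize c2" "[Jump (?m + csize c1)]" "ccomp c1 ?m"]
    by simp_all
  obtain s1 where s1: "gsteps P (s, g, h) (s1, g + bcost b, h)" "simulates s1 v a" "pc s1 = ?m"
    using gsteps_bcomp[OF big_cond_true.prems(1) big_cond_true.hyps(1) c(1), of g h thesis]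
      big_cond_true.hyps(2) by auto
  from big_cond_true.hyps(4)[OF s1(2)] c(2) s1(3) obtain s2 where
    "gsteps P (s1, g + bcost b, h) (s2, g', h')" "simulates s2 v' a'" "pc s2 = pc s1 + csize c1"
    by auto
  with s1 show ?case by (intro exI[of _ s2]) auto
next
  case (big_cond_false v a b c2 g h v' a' g' h' c1)
  let ?m = "pc s + bcost b + csize c2 + 1"
  have c: "code_at P (pc s) (bcomp b ?m)" "code_at P (pc s + bcost b) (ccomp c2 (pc s + bcost b))"
    "code_at P (pc s + bcost b + csize c2) [Jump (?m + csize c1)]"
    using big_cond_false.prems(2)
      code_at_append[of P "pc s + bcost b + csize c2" "[Jump (?m + csize c1)]" "ccomp c1 ?m"]
    by simp_all
  obtain s1 where s1: "gsteps P (s, g, h) (s1, g + bcost b, h)" "simulates s1 v a"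
    "pc s1 = pc s + bcost b"
    using gsteps_bcomp[OF big_cond_false.prems(1) big_cond_false.hyps(1) c(1), of g h thesis]
      big_cond_false.hyps(2) by auto
  from big_cond_false.hyps(4)[OF s1(2)] c(2) s1(3) obtain s2 where
    s2: "gsteps P (s1, g + bcost b, h) (s2, g', h')" "simulates s2 v' a'" "pc s2 = pc s1 + csize c2"
    by auto
  define s3 where "s3 = s2\<lparr>pc := ?m + csize c1\<rparr>"
  have "gstep P (s2, g', h') (s3, g' + 1, h')" "simulates s3 v' a'"
    using gstep_jump[OF s2(2), of P "?m + csize c1" g' h'] c(3) s1(3) s2(3) by (auto simp: s3_def)
  moreover from s1(1) s2(1) have "gsteps P (s, g, h) (s2, g', h')" by (rule rtranclp_trans)
  ultimately have "gsteps P (s, g, h) (s3, g' + 1, h') \<and> simulates s3 v' a'"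
    by (auto elim: rtranclp.rtrancl_into_rtrancl)
  then show ?case by (intro exI[of _ s3]) (simp add: s3_def)
next
  case (big_while_true v a b c g h v' a' g' h' v'' a'' g'' h'')
  let ?l = "pc s + bcost b + 1" and ?e = "pc s + bcost b + 1 + csize c + 1"
  have c: "code_at P (pc s) (bcomp b ?l)" "code_at P ?l (ccomp c ?l)" "code_at P (?l + csize c) [Jump (pc s)]"
    using big_while_true.prems(2)
      code_at_append[of P "pc s + bcost b" "[Jump ?e]" "ccomp c ?l @ [Jump (pc s)]"] by simp_all
  obtain s1 where s1: "gsteps P (s, g, h) (s1, g + bcost b, h)" "simulates s1 v a" "pc s1 = ?l"
    using gsteps_bcomp[OF big_while_true.prems(1) big_while_true.hyps(1) c(1), of g h thesis]
      big_while_true.hyps(2) by auto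
  from big_while_true.hyps(4)[OF s1(2)] c(2) s1(3) obtain s2 where
    s2: "gsteps P (s1, g + bcost b, h) (s2, g', h')" "simulates s2 v' a'" "pc s2 = pc s1 + csize c"
    by auto
  define s3 where "s3 = s2\<lparr>pc := pc s\<rparr>"
  have s3: "gstep P (s2, g', h') (s3, g' + 1, h')" "simulates s3 v' a'" "pc s3 = pc s"
    using gstep_jump[OF s2(2), of P "pc s" g' h'] c(3) s1(3) s2(3) by (auto simp: s3_def)
  have "\<exists>s4. gsteps P (s3, g' + 1, h') (s4, g'', h'') \<and> simulates s4 v'' a'' \<and>
      pc s4 = pc s3 + csize (While b c)"
    by (rule big_while_true.hyps(6)[OF s3(2)]) (use big_while_true.prems(2) s3(3) in \<open>simp only:\<close>)
  then obtain s4 where s4: "gsteps P (s3, g' + 1, h') (s4, g'', h'')" "simulates s4 v'' a''"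
    "pc s4 = pc s + csize (While b c)"
    unfolding s3(3) by blast
  have "gsteps P (s, g, h) (s4, g'', h'')"
    using rtranclp_trans[OF rtranclp_trans[OF s1(1) s2(1)] converse_rtranclp_into_rtranclp[OF s3(1) s4(1)]] .
  with s4(2,3) show ?case by blast
next
  case (big_while_false v a b c g h)
  let ?l = "pc s + bcost b + 1" and ?e = "pc s + bcost b + 1 + csize c + 1"
  have c: "code_at P (pc s) (bcomp b ?l)" "code_at P (pc s + bcost b) [Jump ?e]"
    using big_while_false.prems(2)
      code_at_append[of P "pc s + bcost b" "[Jump ?e]" "ccomp c ?l @ [Jump (pc s)]"] by simp_all
  obtain s1 where s1: "gsteps P (s, g, h) (s1, g + bcost b, h)" "simulates s1 v a"
    "pc s1 = pc s + bcost b"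
    using gsteps_bcomp[OF big_while_false.prems(1) big_while_false.hyps(1) c(1), of g h thesis]
      big_while_false.hyps(2) by auto
  define s2 where "s2 = s1\<lparr>pc := ?e\<rparr>"
  have "gstep P (s1, g + bcost b, h) (s2, g + bcost b + 1, h)" "simulates s2 v a"
    using gstep_jump[OF s1(2), of P ?e "g + bcost b" h] c(2) s1(3) by (auto simp: s2_def)
  with s1(1) have "gsteps P (s, g, h) (s2, g + (bcost b + 1), h) \<and> simulates s2 v a"
    by (auto elim: rtranclp.rtrancl_into_rtrancl)
  then show ?case by (intro exI[of _ s2]) (simp add: s2_def)
next
  case (big_emit v a e1 e2 g h)
  have c: "code_at P (pc s) (acomp e1 0 @ acomp e2 1)"
    "code_at P (pc s + acost e1 + acost e2) [Output (tmp 0) (tmp 1)]"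
    using big_emit.prems(2) by auto
  obtain s1 where s1: "gsteps P (s, g, h) (s1, g + acost e1 + acost e2, h)" "simulates s1 v a"
    "pc s1 = pc s + acost e1 + acost e2" "regs s1 (tmp 0) = aval v a e1" "regs s1 (tmp 1) = aval v a e2"
    using gsteps_acomp2[OF big_emit.prems(1) big_emit.hyps(1,2) c(1), of g h thesis] by blast
  define s2 where "s2 = exec w (Output (tmp 0) (tmp 1)) s1"
  have "gstep P (s1, g + acost e1 + acost e2, h) (s2, 1, h @ [Out (aval v a e1) (aval v a e2)])"
    by (rule gstep_eventI) (use c(2) s1 big_emit.hyps(3) in \<open>auto simp: s2_def\<close>)
  with s1(1) have "gsteps P (s, g, h) (s2, 1, h @ [Out (aval v a e1) (aval v a e2)])"
    by (rule rtranclp.rtrancl_into_rtrancl)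
  then show ?case
    using s1(2,3) by (intro exI[of _ s2]) (auto simp: s2_def simulates_def rel_def)
next
  case (big_done g v a h)
  have "gstep P (s, g, h) (s\<lparr>pc := Suc (pc s)\<rparr>, 1, h @ [Preprocessed])"
    by (rule gstep_eventI) (use big_done in auto)
  then show ?case
    using big_done.prems(1) by (intro exI[of _ "s\<lparr>pc := Suc (pc s)\<rparr>"]) (auto simp: simulates_def rel_def)
qed auto

end

section \<open>Time stamps of the events in an actual run\<close>

definition event_log :: "nat \<Rightarrow> instr list \<Rightarrow> nat list \<Rightarrow> nat \<Rightarrow> (nat \<times> event) list" where
  "event_log w P inp t = List.map_filter (\<lambda>t. map_option (Pair t) (event_at w P inp t)) [0..<t]"

lemma event_log_Suc:
  "event_log w P inp (Suc t) = event_log w P inp t @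
     (case event_at w P inp t of None \<Rightarrow> [] | Some ev \<Rightarrow> [(t, ev)])"
  by (simp add: event_log_def List.map_filter_def split: option.split)

lemma config_at_Suc:
  "config_at w P inp (Suc t) = exec w (fetch P (config_at w P inp t)) (config_at w P inp t)"
  by (simp add: config_at_def)

text \<open>The input does not state its own length. The prologue evaluates an expression
  \<open>e\<close> for it into register 0, which the code of commands never writes.\<close>

definition program :: "aexp \<Rightarrow> com \<Rightarrow> instr list" where
  "program e c =
     (let p = acomp e 0 @ [Const (tmp 1) 0, Op Add 0 (tmp 0) (tmp 1)] in p @ ccomp c (length p))"

context machine
begin

text \<open>Turns the relative times of \<open>gstep\<close> into absolute ones. The start of the
  run acts as an event at time 0, which makes the limit on \<open>Preprocessed\<close> a bound on
  its absolute time.\<close>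

lemma gsteps_event_log:
  assumes "gsteps P (init_config w inp, 0, []) (s, g, h)"
  shows "\<exists>t ts. s = config_at w P inp t \<and> length ts = length h \<and> event_log w P inp t = zip ts h \<and>
    (\<forall>i<length ts. ts ! i - (0 # ts) ! i \<le> limit (h ! i)) \<and> t = last (0 # ts) + g"
  using assms
proof (induction "(s, g, h)" arbitrary: s g h rule: rtranclp_induct)
  case base
  show ?case
    by (intro exI[of _ 0] exI[of _ "[]"]) (simp add: config_at_def event_log_def List.map_filter_def)
next
  case (step y)
  obtain s0 g0 h0 where y: "y = (s0, g0, h0)" by (cases y)
  obtain t ts where t: "s0 = config_at w P inp t" "length ts = length h0"
    "event_log w P inp t = zip ts h0" "\<forall>i<length ts. ts ! i - (0 # ts) ! i \<le> limit (h0 ! i)"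
    "t = last (0 # ts) + g0"
    using step.hyps(3)[OF y] by blast
  from step.hyps(2)[unfolded y] show ?case
  proof cases
    case gstep_silent
    then have "s = config_at w P inp (Suc t)" "event_log w P inp (Suc t) = zip ts h"
      using t by (simp_all add: config_at_Suc event_log_Suc event_at_def)
    then show ?thesis
      using t gstep_silent by (intro exI[of _ "Suc t"] exI[of _ ts]) simp
  next
    case (gstep_event ev)
    have "event_log w P inp (Suc t) = zip (ts @ [t]) h"
      using t gstep_event by (simp add: event_log_Suc event_at_def)
    moreover have "(ts @ [t]) ! i - (0 # ts @ [t]) ! i \<le> limit (h ! i)" if "i < length (ts @ [t])" for i
    proof (cases "i < length ts")
      case True
      then have "(0 # ts @ [t]) ! i = (0 # ts) ! i" by (cases i) (auto simp: nth_append)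
      with True t(2,4) gstep_event show ?thesis by (simp add: nth_append)
    next
      case False
      then have "i = length ts" using that by simp
      moreover from this have "(0 # ts @ [t]) ! i = last (0 # ts)"
        by (cases ts rule: rev_cases) (auto simp: nth_append)
      ultimately show ?thesis using t(2,5) gstep_event by (simp add: nth_append)
    qed
    ultimately show ?thesis
      using t gstep_event by (intro exI[of _ "Suc t"] exI[of _ "ts @ [t]"]) (simp add: config_at_Suc)
  qed
qed

text \<open>The initial time \<open>acost e + 2\<close> is that of the prologue. Behind the last
  command the program counter leaves the program, where \<open>fetch\<close> yields
  \<open>Halt\<close>; the condition \<open>g \<le> del\<close> bounds the delay before that
  event.\<close>

lemma ram_enumerates_program:
  assumes F: "F = length inp" and I: "I = (\<lambda>i. if i < length inp then inp ! i else 0)"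
    and e: "array_free e" "safe (\<lambda>_. 0) (\<lambda>_ _. 0) e" "aval (\<lambda>_. 0) (\<lambda>_ _. 0) e = F"
    and c: "wp c (\<lambda>v a g h. g \<le> del \<and> h = Preprocessed # map (\<lambda>(i, j). Out i j) ps)
      (\<lambda>_. 0) (\<lambda>_ _. 0) (acost e + 2) []"
  shows "ram_enumerates w (program e c) inp ps pre del"
proof -
  define P where "P = program e c"
  let ?s0 = "init_config w inp"
  let ?p = "acomp e 0 @ [Const (tmp 1) 0, Op Add 0 (tmp 0) (tmp 1)]"
  have st: "list_all straight ?p" using straight_acomp by simp
  have "code_at P 0 (?p @ ccomp c (length ?p))"
    unfolding code_at_def P_def program_def by (simp add: Let_def)
  then have code: "code_at P (pc ?s0) ?p" "code_at P (length ?p) (ccomp c (length ?p))"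
    unfolding code_at_append by (simp_all add: init_config_def)
  have tb: "take_bit w (inp ! i) = inp ! i" if "i < length inp" for i
    by (rule take_bit_le) (use input_le[of i] that I in simp)
  have rel0: "rel ?s0 (\<lambda>_. 0) (\<lambda>_ _. 0)"
    unfolding rel_def init_config_def using tb by (simp add: F I)
  define s1 where "s1 = fold (exec w) ?p ?s0"
  have g1: "gsteps P (?s0, 0, []) (s1, acost e + 2, [])"
    using gsteps_straight[OF st code(1), of 0 "[]"] by (simp add: s1_def)
  define s1' where "s1' = fold (exec w) (acomp e 0) ?s0"
  have s1': "mem s1' = mem ?s0" "regs s1' (tmp 0) = F" "\<And>x. odd x \<Longrightarrow> regs s1' x = regs ?s0 x"
    using fold_acomp[OF rel0 e(2) disjI2[OF e(1)], of 0] e(3) by (auto simp: s1'_def)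
  have "take_bit w F = F" by (rule take_bit_le) simp
  then have s1: "mem s1 = mem ?s0" "regs s1 0 = F" "\<And>x. odd x \<Longrightarrow> regs s1 x = regs ?s0 x"
    using s1' by (auto simp: s1_def s1'_def[symmetric])
  have sim1: "simulates s1 (\<lambda>_. 0) (\<lambda>_ _. 0)"
    unfolding simulates_def using rel_cong[OF rel0 s1(1,3)] s1(2) by simp
  have pc1: "pc s1 = length ?p"
    using pc_fold_exec[OF st, of w ?s0] by (simp add: s1_def init_config_def)
  obtain v a g h where big: "big c (\<lambda>_. 0, \<lambda>_ _. 0, acost e + 2, []) (v, a, g, h)"
    and g: "g \<le> del" and h: "h = Preprocessed # map (\<lambda>(i, j). Out i j) ps"
    using c unfolding wp_def by blast
  from gsteps_ccomp[OF big sim1, of P] code(2) pc1 obtain s2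
    where s2: "gsteps P (s1, acost e + 2, []) (s2, g, h)" "pc s2 = length ?p + csize c" by auto
  from rtranclp_trans[OF g1 s2(1)] obtain t ts where t: "s2 = config_at w P inp t"
    "length ts = length h" "event_log w P inp t = zip ts h"
    "\<forall>i<length ts. ts ! i - (0 # ts) ! i \<le> limit (h ! i)" "t = last (0 # ts) + g"
    using gsteps_event_log by blast
  have "length P = length ?p + csize c" by (simp add: P_def program_def Let_def)
  then have halt: "fetch P s2 = Halt" by (simp add: fetch_def s2(2))
  obtain tp ts' where ts: "ts = tp # ts'" "length ts' = length ps"
    using t(2) h by (cases ts) auto
  have "trace w P inp t = event_log w P inp (Suc t)"
    by (simp only: trace_def event_log_def)
  also have "\<dots> = (tp, Preprocessed) # zip ts' (map (\<lambda>(i, j). Out i j) ps) @ [(t, Halted)]"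
    using t(1,3) halt ts h by (simp add: event_log_Suc event_at_def)
  finally have trace: "trace w P inp t = \<dots>" .
  have "tp \<le> pre" using t(4) ts h by force
  moreover have "successively (\<lambda>s t. t - s \<le> del) (tp # ts' @ [t])"
    unfolding successively_conv_nth
  proof (intro allI impI)
    fix i assume i: "Suc i < length (tp # ts' @ [t])"
    show "(tp # ts' @ [t]) ! Suc i - (tp # ts' @ [t]) ! i \<le> del"
    proof (cases "i < length ts'")
      case True
      then have "(tp # ts' @ [t]) ! i = ts ! i" by (cases i) (auto simp: ts nth_append)
      moreover have "limit (h ! Suc i) = del"
        using True ts(2) h by (cases "ps ! i") simp
      ultimately show ?thesis
        using True t(4)[rule_format, of "Suc i"] ts by (simp add: nth_append)
    next
      case False
      then have "i = length ts'" using i by simp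
      moreover from this have "(tp # ts' @ [t]) ! i = last ts"
        by (cases ts' rule: rev_cases) (auto simp: ts nth_append)
      ultimately show ?thesis using t(5) g ts by (simp add: nth_append)
    qed
  qed
  ultimately show ?thesis
    unfolding ram_enumerates_def P_def[symmetric] using trace ts(2) by blast
qed

end

section \<open>Labelled queries\<close>

text \<open>
  Every token of a query in postfix notation carries a label; letters may follow each other in a
  word if the outgoing number of the first equals the incoming number of the second. Outgoing
  numbers are never 1 and incoming numbers never 0.
\<close>

datatype label = Label (starting: nat) (accepting: nat) (incoming: nat) (outgoing: nat)

text \<open>The incoming number 1 means that there is no predecessor, the outgoing number 0 that
  there is no successor. The numbers \<open>g + 2\<close> avoid both; each stands for one closure or
  one pair.\<close>

definition "no_label = Label 0 0 1 0"
definition "top_label = Label 1 1 1 0"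
definition "plus_label g = Label 1 1 (g + 2) (g + 2)"
definition "fst_label g = Label 1 0 1 (g + 2)"
definition "snd_label g = Label 0 1 (g + 2) 0"

lemmas label_defs = no_label_def top_label_def plus_label_def fst_label_def snd_label_def

fun letter_labels :: "label \<Rightarrow> 'a rpq \<Rightarrow> label list" where
  "letter_labels m (Alt \<alpha> \<beta>) = letter_labels m \<alpha> @ letter_labels m \<beta> @ [no_label]"
| "letter_labels m _ = [m]"

text \<open>\<open>b\<close> is the position of the first token, and the number handed to a closure
  or a pair is the position of its operator token. Different subqueries thus get different numbers,
  and a parser that meets the operator first knows the number at once.\<close>

fun labels :: "nat \<Rightarrow> 'a rpq \<Rightarrow> label list" where
  "labels b Eps = [no_label]"
| "labels b (Atom x) = [top_label]"
| "labels b (Alt \<alpha> \<beta>) = labels b \<alpha> @ labels (b + rpq_length \<alpha>) \<beta> @ [no_label]"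
| "labels b (Plus \<alpha>) = letter_labels (plus_label (b + rpq_length \<alpha>)) \<alpha> @ [no_label]"
| "labels b (Conc \<alpha> \<beta>) =
     letter_labels (fst_label (b + rpq_length \<alpha> + rpq_length \<beta>)) \<alpha> @
     letter_labels (snd_label (b + rpq_length \<alpha> + rpq_length \<beta>)) \<beta> @ [no_label]"

fun has_eps :: "'a rpq \<Rightarrow> bool" where
  "has_eps Eps = True"
| "has_eps (Alt \<alpha> \<beta>) = (has_eps \<alpha> \<or> has_eps \<beta>)"
| "has_eps _ = False"

fun letter_alt :: "'a set \<Rightarrow> 'a rpq \<Rightarrow> bool" where
  "letter_alt \<Sigma> (Atom x) = (x \<in> \<Sigma>)"
| "letter_alt \<Sigma> (Alt \<alpha> \<beta>) = (letter_alt \<Sigma> \<alpha> \<and> letter_alt \<Sigma> \<beta>)"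
| "letter_alt \<Sigma> _ = False"

text \<open>\<open>Star\<close> is itself an alternation with \<open>Eps\<close>. Dissolving it
  turns the query into an alternation, in any bracketing, of closures, pairs, letters and
  \<epsilon>.\<close>

fun simple_query :: "'a set \<Rightarrow> 'a rpq \<Rightarrow> bool" where
  "simple_query \<Sigma> Eps = True"
| "simple_query \<Sigma> (Atom x) = (x \<in> \<Sigma>)"
| "simple_query \<Sigma> (Alt \<alpha> \<beta>) = (simple_query \<Sigma> \<alpha> \<and> simple_query \<Sigma> \<beta>)"
| "simple_query \<Sigma> (Plus \<alpha>) = letter_alt \<Sigma> \<alpha>"
| "simple_query \<Sigma> (Conc \<alpha> \<beta>) = (letter_alt \<Sigma> \<alpha> \<and> letter_alt \<Sigma> \<beta>)"

lemma letter_alt_if_letter_alts: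
  assumes "\<alpha> \<in> letter_alts \<Sigma>"
  shows "letter_alt \<Sigma> \<alpha>"
proof -
  have "alternation qs \<alpha> \<Longrightarrow> set qs \<subseteq> Atom ` \<Sigma> \<Longrightarrow> letter_alt \<Sigma> \<alpha>" for qs
    by (induction rule: alternation.induct) auto
  then show ?thesis using assms by (fastforce simp: letter_alts_def)
qed

lemma letter_alt_imp_simple_query: "letter_alt \<Sigma> q \<Longrightarrow> simple_query \<Sigma> q"
  by (induction q) auto

lemma simple_query_if_alternations:
  assumes "q \<in> \<Or>(S_RPQ \<Sigma> \<union> BT_RPQ \<Sigma>)"
  shows "simple_query \<Sigma> q"
proof -
  have s: "simple_query \<Sigma> r" if "r \<in> S_RPQ \<Sigma> \<union> BT_RPQ \<Sigma>" for r
    using that by (auto simp: S_RPQ_def BT_RPQ_def dest!: letter_alt_if_letter_alts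
      intro: letter_alt_imp_simple_query)
  have "alternation qs q \<Longrightarrow> set qs \<subseteq> S_RPQ \<Sigma> \<union> BT_RPQ \<Sigma> \<Longrightarrow> simple_query \<Sigma> q" for qs
    by (induction rule: alternation.induct) (use s in auto)
  then show ?thesis using assms by (auto simp: alternations_def)
qed

lemma length_encode_rpq [simp]: "length (encode_rpq \<Sigma>s q) = rpq_length q"
  by (induction q) auto

lemma rpq_length_pos: "0 < rpq_length q"
  by (cases q) auto

lemma length_letter_labels: "letter_alt \<Sigma> \<alpha> \<Longrightarrow> length (letter_labels m \<alpha>) = rpq_length \<alpha>"
  by (induction \<alpha>) auto

lemma length_labels: "simple_query \<Sigma> q \<Longrightarrow> length (labels b q) = rpq_length q"
  by (induction q arbitrary: b) (auto simp: length_letter_labels)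


section \<open>Parsing\<close>

text \<open>
  The tokens are read from right to left, so that every operator comes before its operands and
  the number of operands still to be read replaces a stack. The parser state consists of the label
  for the next letter, this number, whether \<open>\<epsilon>\<close> has been read, and the labels found so far.
\<close>

definition next_mode :: "label \<Rightarrow> label" where
  "next_mode m = (if starting m = 0 then Label 1 0 1 (incoming m) else top_label)"

type_synonym parser_state = "label \<times> nat \<times> bool \<times> label list"

text \<open>The number \<open>c\<close> matters inside a closure or a pair. When it runs out,
  \<open>next_mode\<close> either turns to the first factor of a pair, recognised by the value 0 of
  \<open>starting\<close> in the label of the second factor, or returns to the top level.\<close>

fun parse_step :: "nat \<Rightarrow> nat \<Rightarrow> parser_state \<Rightarrow> parser_state" where
  "parse_step i t (m, c, e, ls) =
     (if t = 0 then (m, c, True, no_label # ls)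
      else if t = 1 then (snd_label i, 1, e, no_label # ls)
      else if t = 2 then (m, c + 1, e, no_label # ls)
      else if t = 3 then (plus_label i, 1, e, no_label # ls)
      else if c \<le> 1 then (next_mode m, 1, e, m # ls)
      else (m, c - 1, e, m # ls))"

fun parse :: "nat \<Rightarrow> nat list \<Rightarrow> parser_state \<Rightarrow> parser_state" where
  "parse i [] s = s"
| "parse i (t # ts) s = parse_step i t (parse (Suc i) ts s)"

lemma parse_append: "parse i (ts @ us) s = parse i ts (parse (i + length ts) us s)"
  by (induction ts arbitrary: i) auto

text \<open>Every \<open>Alt\<close> adds one pending operand and every letter removes one, so a
  letter alternation consumes exactly one.\<close>

lemma parse_letters:
  assumes "letter_alt \<Sigma> \<alpha>" "c \<ge> 1"
  shows "parse b (encode_rpq \<Sigma>s \<alpha>) (m, c, e, ls) =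
    (if c = 1 then (next_mode m, 1, e, letter_labels m \<alpha> @ ls) else (m, c - 1, e, letter_labels m \<alpha> @ ls))"
  using assms by (induction \<alpha> arbitrary: b c ls) (auto simp: parse_append)

text \<open>At the top level \<open>next_mode\<close> keeps \<open>top_label\<close> whatever the
  count is, therefore only the existence of a count is claimed.\<close>

lemma parse_query:
  assumes "simple_query \<Sigma> q"
  shows "\<exists>c'. parse b (encode_rpq \<Sigma>s q) (top_label, c, e, ls) =
    (top_label, c', e \<or> has_eps q, labels b q @ ls)"
  using assms
proof (induction q arbitrary: b c e ls)
  case (Alt \<alpha> \<beta>)
  obtain c1 where 1: "parse (b + rpq_length \<alpha>) (encode_rpq \<Sigma>s \<beta>) (top_label, c + 1, e, no_label # ls) =
      (top_label, c1, e \<or> has_eps \<beta>, labels (b + rpq_length \<alpha>) \<beta> @ no_label # ls)"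
    using Alt.IH(2) Alt.prems by fastforce
  obtain c2 where "parse b (encode_rpq \<Sigma>s \<alpha>)
        (top_label, c1, e \<or> has_eps \<beta>, labels (b + rpq_length \<alpha>) \<beta> @ no_label # ls) =
      (top_label, c2, (e \<or> has_eps \<beta>) \<or> has_eps \<alpha>,
        labels b \<alpha> @ labels (b + rpq_length \<alpha>) \<beta> @ no_label # ls)"
    using Alt.IH(1) Alt.prems by fastforce
  with 1 show ?case by (auto simp: parse_append)
qed (auto simp: parse_append parse_letters next_mode_def label_defs)


section \<open>The language of a labelled query\<close>

text \<open>The words of a position automaton in the style of Glushkov: the conditions concern the
  first item, the last item and adjacent items only.\<close>

definition labelled_words :: "('a \<times> label) set \<Rightarrow> 'a list set" where
  "labelled_words X = {map fst zs | zs. zs \<noteq> [] \<and> set zs \<subseteq> X \<and> starting (snd (hd zs)) = 1 \<and>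
     successively (\<lambda>y z. outgoing (snd y) = incoming (snd z)) zs \<and> accepting (snd (last zs)) = 1}"

lemma labelled_words_mono: "X \<subseteq> Y \<Longrightarrow> labelled_words X \<subseteq> labelled_words Y"
  unfolding labelled_words_def by blast

text \<open>An item labelled \<open>no_label\<close> is not starting, and it cannot follow another
  item because its incoming number 1 is nobody's outgoing number.\<close>

lemma labelled_words_clean:
  assumes "\<And>z. z \<in> X \<Longrightarrow> outgoing (snd z) \<noteq> 1"
    and "Y \<subseteq> X" and "\<And>z. z \<in> X \<Longrightarrow> snd z \<noteq> no_label \<Longrightarrow> z \<in> Y"
  shows "labelled_words X = labelled_words Y"
proof (rule antisym)
  show "labelled_words Y \<subseteq> labelled_words X" by (rule labelled_words_mono[OF assms(2)])
  show "labelled_words X \<subseteq> labelled_words Y"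
  proof
    fix u assume "u \<in> labelled_words X"
    then obtain zs where zs: "u = map fst zs" "zs \<noteq> []" "set zs \<subseteq> X" "starting (snd (hd zs)) = 1"
      "successively (\<lambda>y z. outgoing (snd y) = incoming (snd z)) zs" "accepting (snd (last zs)) = 1"
      unfolding labelled_words_def by blast
    have "snd (zs ! i) \<noteq> no_label" if i: "i < length zs" for i
    proof (cases i)
      case 0
      then show ?thesis using zs(2,4) by (auto simp: hd_conv_nth no_label_def)
    next
      case (Suc j)
      then have "outgoing (snd (zs ! j)) = incoming (snd (zs ! i))" "zs ! j \<in> X"
        using zs(3,5) i by (auto simp: successively_conv_nth)
      then show ?thesis using assms(1)[of "zs ! j"] by (auto simp: no_label_def)
    qed
    then have "set zs \<subseteq> Y" using zs(3) assms(3) by (metis in_set_conv_nth subset_iff)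
    then show "u \<in> labelled_words Y" using zs unfolding labelled_words_def by blast
  qed
qed

text \<open>No item may follow an item of the other set, so a word never changes sides.\<close>

lemma labelled_words_Un:
  assumes "\<And>y z. y \<in> X \<Longrightarrow> z \<in> Y \<Longrightarrow> outgoing (snd y) \<noteq> incoming (snd z) \<and> outgoing (snd z) \<noteq> incoming (snd y)"
  shows "labelled_words (X \<union> Y) = labelled_words X \<union> labelled_words Y"
proof (rule antisym)
  show "labelled_words X \<union> labelled_words Y \<subseteq> labelled_words (X \<union> Y)"
    using labelled_words_mono[of X "X \<union> Y"] labelled_words_mono[of Y "X \<union> Y"] by blast
  have sep: "set zs \<subseteq> X \<or> set zs \<subseteq> Y" if "set zs \<subseteq> X \<union> Y"
    "successively (\<lambda>y z. outgoing (snd y) = incoming (snd z)) zs" for zs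
    using that
  proof (induction zs)
    case (Cons z zs)
    show ?case
    proof (cases zs)
      case Nil
      then show ?thesis using Cons.prems by auto
    next
      case (Cons y ys)
      then have "outgoing (snd z) = incoming (snd y)" "y \<in> set zs" "z \<in> X \<union> Y"
        and "set zs \<subseteq> X \<or> set zs \<subseteq> Y"
        using Cons.IH Cons.prems by auto
      then show ?thesis using assms[of y z] assms[of z y] by auto
    qed
  qed simp
  show "labelled_words (X \<union> Y) \<subseteq> labelled_words X \<union> labelled_words Y"
    unfolding labelled_words_def using sep by blast
qed

lemma labelled_words_top:
  "labelled_words {(x, top_label) | x. x \<in> A} = {[x] | x. x \<in> A}" (is "labelled_words ?X = _")
proof (rule antisym)
  show "labelled_words ?X \<subseteq> {[x] | x. x \<in> A}"
  proof
    fix u assume "u \<in> labelled_words ?X"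
    then obtain zs where zs: "u = map fst zs" "zs \<noteq> []" "set zs \<subseteq> ?X"
      "successively (\<lambda>y z. outgoing (snd y) = incoming (snd z)) zs"
      unfolding labelled_words_def by blast
    then obtain z zs' where z: "zs = z # zs'" by (cases zs) auto
    then have "zs' = []" using zs by (cases zs') (auto simp: top_label_def)
    then show "u \<in> {[x] | x. x \<in> A}" using zs z by auto
  qed
  show "{[x] | x. x \<in> A} \<subseteq> labelled_words ?X"
  proof
    fix u assume "u \<in> {[x] | x. x \<in> A}"
    then obtain x where "u = [x]" "x \<in> A" by blast
    then show "u \<in> labelled_words ?X"
      unfolding labelled_words_def by (auto intro!: exI[of _ "[(x, top_label)]"] simp: top_label_def)
  qed
qed

lemma labelled_words_plus:
  "labelled_words {(x, plus_label g) | x. x \<in> A} = {u. u \<noteq> [] \<and> set u \<subseteq> A}" (is "labelled_words ?X = _")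
proof (rule antisym)
  show "labelled_words ?X \<subseteq> {u. u \<noteq> [] \<and> set u \<subseteq> A}"
    unfolding labelled_words_def by fastforce
  show "{u. u \<noteq> [] \<and> set u \<subseteq> A} \<subseteq> labelled_words ?X"
  proof
    fix u assume "u \<in> {u. u \<noteq> [] \<and> set u \<subseteq> A}"
    then show "u \<in> labelled_words ?X"
      unfolding labelled_words_def
      by (intro CollectI exI[of _ "map (\<lambda>x. (x, plus_label g)) u"])
        (auto simp: hd_map last_map plus_label_def successively_conv_nth comp_def)
  qed
qed

text \<open>Items of the first factor are not accepting, those of the second are not starting, and
  the numbers admit only the step from the first to the second; this leaves words of length
  two.\<close>

lemma labelled_words_conc:
  "labelled_words ({(x, fst_label g) | x. x \<in> A} \<union> {(y, snd_label g) | y. y \<in> B}) =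
    {[x, y] | x y. x \<in> A \<and> y \<in> B}" (is "labelled_words ?X = ?R")
proof (rule antisym)
  show "labelled_words ?X \<subseteq> ?R"
  proof
    fix u assume "u \<in> labelled_words ?X"
    then obtain zs where zs: "u = map fst zs" "zs \<noteq> []" "set zs \<subseteq> ?X" "starting (snd (hd zs)) = 1"
      "successively (\<lambda>y z. outgoing (snd y) = incoming (snd z)) zs" "accepting (snd (last zs)) = 1"
      unfolding labelled_words_def by blast
    then obtain z zs1 where z: "zs = z # zs1" by (cases zs) auto
    then have 1: "snd z = fst_label g" "fst z \<in> A" using zs(3,4) by (auto simp: snd_label_def)
    then obtain z' zs2 where z': "zs1 = z' # zs2" using zs(6) z by (cases zs1) (auto simp: fst_label_def)
    then have "z' \<in> ?X" and eq: "incoming (snd z') = outgoing (fst_label g)" using zs(3,5) z 1 by auto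
    then have "snd z' = fst_label g \<or> snd z' = snd_label g \<and> fst z' \<in> B" by auto
    moreover have "snd z' \<noteq> fst_label g" using eq by (auto simp: fst_label_def)
    ultimately have 2: "snd z' = snd_label g" "fst z' \<in> B" by auto
    then have "zs2 = []" using zs(3,5) z z'
      by (cases zs2) (auto simp: fst_label_def snd_label_def)
    then show "u \<in> ?R" using zs(1) z z' 1 2 by auto
  qed
  show "?R \<subseteq> labelled_words ?X"
  proof
    fix u assume "u \<in> ?R"
    then obtain x y where "u = [x, y]" "x \<in> A" "y \<in> B" by blast
    then show "u \<in> labelled_words ?X"
      unfolding labelled_words_def
      by (auto intro!: exI[of _ "[(x, fst_label g), (y, snd_label g)]"] simp: fst_label_def snd_label_def)
  qed
qed

text \<open>For a token below 4 the subtraction gives the index of some letter as well; its label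
  \<open>no_label\<close> keeps this spurious item out of all words.\<close>

definition items :: "'a list \<Rightarrow> label list \<Rightarrow> 'a rpq \<Rightarrow> ('a \<times> label) set" where
  "items \<Sigma>s ls q = set (zip (map (\<lambda>t. \<Sigma>s ! (t - 4)) (encode_rpq \<Sigma>s q)) ls)"

lemma nth_pos: "x \<in> set xs \<Longrightarrow> xs ! pos xs x = x" "x \<in> set xs \<Longrightarrow> pos xs x < length xs"
proof -
  assume x: "x \<in> set xs"
  show *: "pos xs x < length xs"
    unfolding pos_def using x by (induction xs) auto
  show "xs ! pos xs x = x"
    using nth_length_takeWhile[of "\<lambda>y. y \<noteq> x" xs] * by (simp add: pos_def)
qed

lemma items_letters:
  assumes "letter_alt (set \<Sigma>s) \<alpha>"
  shows "z \<in> items \<Sigma>s (letter_labels m \<alpha>) \<alpha> \<Longrightarrow> snd z = no_label \<or> (snd z = m \<and> fst z \<in> set_rpq \<alpha>)"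
    and "x \<in> set_rpq \<alpha> \<Longrightarrow> (x, m) \<in> items \<Sigma>s (letter_labels m \<alpha>) \<alpha>"
    and "lang \<alpha> = {[x] | x. x \<in> set_rpq \<alpha>}"
  using assms by (induction \<alpha>) (auto simp: items_def length_letter_labels nth_pos)

lemma label_bounds_letters:
  "l \<in> set (letter_labels m \<alpha>) \<Longrightarrow> l = m \<or> l = no_label"
  by (induction \<alpha>) auto

text \<open>The numbers of a subquery lie in its interval of token positions, shifted by 2, which
  separates the operands of an alternation. The conjunct on \<open>accepting\<close> is the source
  of \<open>lab_acc\<close>.\<close>

lemma label_bounds:
  assumes "l \<in> set (labels b q)"
  shows "incoming l = 1 \<or> incoming l \<in> {b + 2..<b + rpq_length q + 2} \<and> accepting l = 1"
    and "outgoing l = 0 \<or> outgoing l \<in> {b + 2..<b + rpq_length q + 2}"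
proof -
  have "(incoming l = 1 \<or> incoming l \<in> {b + 2..<b + rpq_length q + 2} \<and> accepting l = 1) \<and>
    (outgoing l = 0 \<or> outgoing l \<in> {b + 2..<b + rpq_length q + 2})"
    using assms
  proof (induction q arbitrary: b)
    case (Conc \<alpha> \<beta>)
    let ?g = "b + rpq_length \<alpha> + rpq_length \<beta>"
    have "l = fst_label ?g \<or> l = snd_label ?g \<or> l = no_label"
      using Conc.prems by (auto dest: label_bounds_letters)
    then show ?case by (elim disjE) (simp_all add: label_defs)
  next
    case (Alt \<alpha> \<beta>)
    from Alt.prems consider "l \<in> set (labels b \<alpha>)" | "l \<in> set (labels (b + rpq_length \<alpha>) \<beta>)" | "l = no_label"
      by auto
    then show ?case
    proof cases
      case 1
      then show ?thesis using Alt.IH(1)[OF 1] by auto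
    next
      case 2
      then show ?thesis using Alt.IH(2)[OF 2] by auto
    next
      case 3
      then show ?thesis by (simp add: no_label_def)
    qed
  next
    case (Plus \<alpha>)
    have "l = plus_label (b + rpq_length \<alpha>) \<or> l = no_label"
      using Plus.prems by (auto dest: label_bounds_letters)
    then show ?case by (elim disjE) (simp_all add: label_defs)
  qed (simp_all add: label_defs)
  then show "incoming l = 1 \<or> incoming l \<in> {b + 2..<b + rpq_length q + 2} \<and> accepting l = 1"
    and "outgoing l = 0 \<or> outgoing l \<in> {b + 2..<b + rpq_length q + 2}" by blast+
qed

lemma items_labels: "z \<in> items \<Sigma>s ls q \<Longrightarrow> snd z \<in> set ls"
  unfolding items_def by (cases z) (auto dest: set_zip_rightD)

lemma lang_eq_labelled_words:
  assumes "simple_query (set \<Sigma>s) q"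
  shows "lang q = labelled_words (items \<Sigma>s (labels b q) q) \<union> (if has_eps q then {[]} else {})"
  using assms
proof (induction q arbitrary: b)
  case Eps
  have "labelled_words (items \<Sigma>s (labels b Eps) (Eps :: 'a rpq)) = labelled_words {}"
    by (rule labelled_words_clean) (auto simp: items_def no_label_def)
  also have "\<dots> = {}" by (simp add: labelled_words_def)
  finally show ?case by simp
next
  case (Atom x)
  have "items \<Sigma>s (labels b (Atom x)) (Atom x) = {(y, top_label) | y. y \<in> {x}}"
    using Atom by (auto simp: items_def nth_pos)
  then show ?case by (simp only: labelled_words_top) simp
next
  case (Conc \<alpha> \<beta>)
  define g where "g = b + rpq_length \<alpha> + rpq_length \<beta>"
  have l: "letter_alt (set \<Sigma>s) \<alpha>" "letter_alt (set \<Sigma>s) \<beta>" using Conc.prems by auto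
  let ?X = "items \<Sigma>s (labels b (Conc \<alpha> \<beta>)) (Conc \<alpha> \<beta>)"
  let ?A = "items \<Sigma>s (letter_labels (fst_label g) \<alpha>) \<alpha>"
  let ?B = "items \<Sigma>s (letter_labels (snd_label g) \<beta>) \<beta>"
  have X: "?X = insert (\<Sigma>s ! (1 - 4), no_label) (?A \<union> ?B)"
    by (simp add: items_def g_def length_letter_labels[OF l(1)] length_letter_labels[OF l(2)])
  have "labelled_words ?X =
      labelled_words ({(x, fst_label g) | x. x \<in> set_rpq \<alpha>} \<union> {(y, snd_label g) | y. y \<in> set_rpq \<beta>})"
  proof (rule labelled_words_clean)
    show "outgoing (snd z) \<noteq> 1" if "z \<in> ?X" for z
      using label_bounds(2)[OF items_labels[OF that]] by auto
    show "{(x, fst_label g) | x. x \<in> set_rpq \<alpha>} \<union> {(y, snd_label g) | y. y \<in> set_rpq \<beta>} \<subseteq> ?X"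
      unfolding X using items_letters(2)[OF l(1)] items_letters(2)[OF l(2)] by blast
    fix z assume "z \<in> ?X" "snd z \<noteq> no_label"
    then have "z \<in> ?A \<or> z \<in> ?B" unfolding X by auto
    then show "z \<in> {(x, fst_label g) | x. x \<in> set_rpq \<alpha>} \<union> {(y, snd_label g) | y. y \<in> set_rpq \<beta>}"
      using items_letters(1)[OF l(1)] items_letters(1)[OF l(2)] \<open>snd z \<noteq> no_label\<close>
      by (cases z) fastforce
  qed
  moreover have "lang (Conc \<alpha> \<beta>) = {[x, y] | x y. x \<in> set_rpq \<alpha> \<and> y \<in> set_rpq \<beta>}"
    by (auto simp: items_letters(3)[OF l(1)] items_letters(3)[OF l(2)])
      (metis append_Cons append_Nil)
  ultimately show ?case by (simp add: labelled_words_conc)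
next
  case (Alt \<alpha> \<beta>)
  let ?X = "items \<Sigma>s (labels b (Alt \<alpha> \<beta>)) (Alt \<alpha> \<beta>)"
  let ?A = "items \<Sigma>s (labels b \<alpha>) \<alpha>" and ?B = "items \<Sigma>s (labels (b + rpq_length \<alpha>) \<beta>) \<beta>"
  have "?X = insert (\<Sigma>s ! (2 - 4), no_label) (?A \<union> ?B)"
    using Alt.prems by (simp add: items_def length_labels[of "set \<Sigma>s"])
  moreover have "outgoing (snd z) \<noteq> 1" if "z \<in> ?X" for z
    using label_bounds(2)[OF items_labels[OF that]] by auto
  ultimately have "labelled_words ?X = labelled_words (?A \<union> ?B)"
    by (intro labelled_words_clean) auto
  also have "\<dots> = labelled_words ?A \<union> labelled_words ?B"
  proof (rule labelled_words_Un)
    fix y z assume "y \<in> ?A" "z \<in> ?B"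
    from label_bounds[OF items_labels[OF this(1)]] label_bounds[OF items_labels[OF this(2)]]
    show "outgoing (snd y) \<noteq> incoming (snd z) \<and> outgoing (snd z) \<noteq> incoming (snd y)" by auto
  qed
  finally show ?case
    using Alt.prems by (auto simp: Alt.IH(1)[of b] Alt.IH(2)[of "b + rpq_length \<alpha>"])
next
  case (Plus \<alpha>)
  define g where "g = b + rpq_length \<alpha>"
  have l: "letter_alt (set \<Sigma>s) \<alpha>" using Plus.prems by auto
  let ?X = "items \<Sigma>s (labels b (Plus \<alpha>)) (Plus \<alpha>)"
  let ?A = "items \<Sigma>s (letter_labels (plus_label g) \<alpha>) \<alpha>"
  have X: "?X = insert (\<Sigma>s ! (3 - 4), no_label) ?A"
    by (simp add: items_def g_def length_letter_labels[OF l(1)])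
  have "labelled_words ?X = labelled_words {(x, plus_label g) | x. x \<in> set_rpq \<alpha>}"
  proof (rule labelled_words_clean)
    show "outgoing (snd z) \<noteq> 1" if "z \<in> ?X" for z
      using label_bounds(2)[OF items_labels[OF that]] by auto
    show "{(x, plus_label g) | x. x \<in> set_rpq \<alpha>} \<subseteq> ?X"
      unfolding X using items_letters(2)[OF l] by blast
    fix z assume "z \<in> ?X" "snd z \<noteq> no_label"
    then have "z \<in> ?A" unfolding X by auto
    then show "z \<in> {(x, plus_label g) | x. x \<in> set_rpq \<alpha>}"
      using items_letters(1)[OF l] \<open>snd z \<noteq> no_label\<close> by (cases z) fastforce
  qed
  moreover have "lang (Plus \<alpha>) = {u. u \<noteq> [] \<and> set u \<subseteq> set_rpq \<alpha>}"
  proof (intro set_eqI iffI)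
    fix u assume "u \<in> lang (Plus \<alpha>)"
    then obtain ws where "u = concat ws" "ws \<noteq> []" "set ws \<subseteq> {[x] | x. x \<in> set_rpq \<alpha>}"
      by (auto simp: items_letters(3)[OF l])
    then show "u \<in> {u. u \<noteq> [] \<and> set u \<subseteq> set_rpq \<alpha>}" by (cases ws) auto
  next
    fix u assume "u \<in> {u. u \<noteq> [] \<and> set u \<subseteq> set_rpq \<alpha>}"
    then have "u \<noteq> []" "\<And>x. x \<in> set u \<Longrightarrow> x \<in> set_rpq \<alpha>" by auto
    moreover have "concat (map (\<lambda>x. [x]) u) = u" by (induction u) auto
    ultimately show "u \<in> lang (Plus \<alpha>)"
      by (auto simp: items_letters(3)[OF l] intro!: exI[of _ "map (\<lambda>x. [x]) u"])
  qed
  ultimately show ?case by (simp add: labelled_words_plus)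
qed

section \<open>The enumeration program\<close>

abbreviation (input) xNodes :: nat where "xNodes \<equiv> 0"
abbreviation (input) xLength :: nat where "xLength \<equiv> 1"
abbreviation (input) xOffsets :: nat where "xOffsets \<equiv> 2"
abbreviation (input) xTargets :: nat where "xTargets \<equiv> 3"
abbreviation (input) xEps :: nat where "xEps \<equiv> 4"
abbreviation (input) xPeriod :: nat where "xPeriod \<equiv> 5"
abbreviation (input) xGood :: nat where "xGood \<equiv> 6"
abbreviation (input) xRound :: nat where "xRound \<equiv> 7"
abbreviation (input) xSource :: nat where "xSource \<equiv> 8"
abbreviation (input) xHead :: nat where "xHead \<equiv> 9"
abbreviation (input) xTail :: nat where "xTail \<equiv> 10"
abbreviation (input) xFound :: nat where "xFound \<equiv> 11"
abbreviation (input) xPrinted :: nat where "xPrinted \<equiv> 12"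
abbreviation (input) xClock :: nat where "xClock \<equiv> 13"
abbreviation (input) xNode :: nat where "xNode \<equiv> 14"
abbreviation (input) xState :: nat where "xState \<equiv> 15"
abbreviation (input) xPos :: nat where "xPos \<equiv> 16"
abbreviation (input) xNext :: nat where "xNext \<equiv> 17"
abbreviation (input) xStop :: nat where "xStop \<equiv> 18"
abbreviation (input) xSucc :: nat where "xSucc \<equiv> 19"
abbreviation (input) xFlag :: nat where "xFlag \<equiv> 20"

abbreviation (input) aStart :: nat where "aStart \<equiv> 0"
abbreviation (input) aAccept :: nat where "aAccept \<equiv> 1"
abbreviation (input) aIn :: nat where "aIn \<equiv> 2"
abbreviation (input) aOut :: nat where "aOut \<equiv> 3"
abbreviation (input) aGood :: nat where "aGood \<equiv> 4"
abbreviation (input) aVisited :: nat where "aVisited \<equiv> 5"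
abbreviation (input) aSeen :: nat where "aSeen \<equiv> 6"
abbreviation (input) aQueueNode :: nat where "aQueueNode \<equiv> 7"
abbreviation (input) aQueueState :: nat where "aQueueState \<equiv> 8"
abbreviation (input) aFound :: nat where "aFound \<equiv> 9"

abbreviation (input) plus_exp :: "aexp \<Rightarrow> aexp \<Rightarrow> aexp" (infixl "\<oplus>" 65) where
  "e \<oplus> e' \<equiv> Bin Add e e'"
abbreviation (input) times_exp :: "aexp \<Rightarrow> aexp \<Rightarrow> aexp" (infixl "\<otimes>" 70) where
  "e \<otimes> e' \<equiv> Bin Mul e e'"
abbreviation (input) Assign_syntax (infix "::=" 62) where "x ::= e \<equiv> Assign x e"
abbreviation (input) Seq_syntax (infixr ";;" 60) where "c1 ;; c2 \<equiv> Seq c1 c2"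

text \<open>
  One answer is printed every \<open>xPeriod\<close> ticks, independently of when the answers are found.
\<close>

definition tick :: com where
  "tick =
     xClock ::= V xClock \<oplus> N 1 ;;
     Cond (Less (V xClock) (V xPeriod)) Skip
       (xClock ::= N 0 ;;
        Emit (V xSource) (Arr aFound (V xPrinted)) ;;
        xPrinted ::= V xPrinted \<oplus> N 1)"

text \<open>A node may be reached in several accepting states; \<open>aSeen\<close> makes it an
  answer only once.\<close>

definition mark :: com where
  "mark =
     Cond (Equal (Arr aVisited (V xSucc \<otimes> V xLength \<oplus> V xPos)) (V xRound)) Skip
       (Update aVisited (V xSucc \<otimes> V xLength \<oplus> V xPos) (V xRound) ;;
        Update aQueueNode (V xTail) (V xSucc) ;;
        Update aQueueState (V xTail) (V xPos) ;;
        xTail ::= V xTail \<oplus> N 1 ;;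
        Cond (Equal (Arr aAccept (V xPos)) (N 1))
          (Cond (Equal (Arr aSeen (V xSucc)) (V xRound)) Skip
            (Update aSeen (V xSucc) (V xRound) ;;
             Update aFound (V xFound) (V xSucc) ;;
             xFound ::= V xFound \<oplus> N 1))
          Skip)"

definition list_loop :: com where
  "list_loop =
     While (Less (V xNext) (V xStop))
       (xSucc ::= Inp (V xTargets \<oplus> V xNext) ;;
        xNext ::= V xNext \<oplus> N 1 ;;
        mark ;;
        tick)"

text \<open>Tokens start at address 2, and the list of node \<open>x\<close> and letter
  \<open>i\<close> has number \<open>x * \<sigma> + i\<close> in the offset table, where the next
  entry marks its end. For operator tokens the cut-off subtraction yields letter 0.\<close>

definition list_bounds :: "nat \<Rightarrow> nat \<Rightarrow> nat \<Rightarrow> nat \<Rightarrow> nat \<Rightarrow> com" where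
  "list_bounds \<sigma> x y l r =
     l ::= Inp (V xOffsets \<oplus> (V x \<otimes> N \<sigma> \<oplus> Bin Sub (Inp (N 2 \<oplus> V y)) (N 4))) ;;
     r ::= Inp (V xOffsets \<oplus> (V x \<otimes> N \<sigma> \<oplus> Bin Sub (Inp (N 2 \<oplus> V y)) (N 4)) \<oplus> N 1)"

text \<open>There is a tick for every position, even if no list is scanned, because testing all
  positions takes time as well.\<close>

definition pos_loop :: "nat \<Rightarrow> com" where
  "pos_loop \<sigma> =
     While (Less (V xPos) (V xLength))
       (tick ;;
        Cond (Equal (V xState) (V xLength))
          (xFlag ::= Arr aStart (V xPos))
          (Cond (Equal (Arr aOut (V xState)) (Arr aIn (V xPos))) (xFlag ::= N 1) (xFlag ::= N 0)) ;;
        Cond (Equal (V xFlag) (N 1)) (list_bounds \<sigma> xNode xPos xNext xStop ;; list_loop) Skip ;;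
        xPos ::= V xPos \<oplus> N 1)"

definition queue_loop :: "nat \<Rightarrow> com" where
  "queue_loop \<sigma> =
     While (Less (V xHead) (V xTail))
       (xNode ::= Arr aQueueNode (V xHead) ;;
        xState ::= Arr aQueueState (V xHead) ;;
        xHead ::= V xHead \<oplus> N 1 ;;
        tick ;;
        xPos ::= N 0 ;;
        pos_loop \<sigma>)"

definition flush :: com where
  "flush =
     While (Less (V xPrinted) (V xFound))
       (Emit (V xSource) (Arr aFound (V xPrinted)) ;;
        xPrinted ::= V xPrinted \<oplus> N 1)"

text \<open>The round number is increased before it serves as a stamp, so it differs from the
  initial content 0 of the arrays. The initial entry is not marked as visited: its code
  \<open>u * n + n\<close> would be that of position 0 at the next node.\<close>

definition node_search :: "nat \<Rightarrow> com" where
  "node_search \<sigma> =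
     xSource ::= Arr aGood (V xRound) ;;
     xRound ::= V xRound \<oplus> N 1 ;;
     xHead ::= N 0 ;;
     xTail ::= N 1 ;;
     Update aQueueNode (N 0) (V xSource) ;;
     Update aQueueState (N 0) (V xLength) ;;
     xFound ::= N 0 ;;
     xPrinted ::= N 0 ;;
     xClock ::= N 0 ;;
     Cond (Equal (V xEps) (N 1))
       (Update aFound (N 0) (V xSource) ;;
        xFound ::= N 1 ;;
        Update aSeen (V xSource) (V xRound))
       Skip ;;
     queue_loop \<sigma> ;;
     flush"

definition enumerate :: "nat \<Rightarrow> com" where
  "enumerate \<sigma> = While (Less (V xRound) (V xGood)) (node_search \<sigma>)"

text \<open>\<open>lt\<close> gives the letters of the tokens, \<open>off\<close> and
  \<open>tgt\<close> the successor lists, and \<open>dm\<close> bounds the lengths of these lists.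
  The shape of the queries enters only through \<open>lab_acc\<close>. \<open>B_ge\<close> covers
  the indices and products that the program computes.\<close>

locale search = machine I F B w pre del
  for I :: "nat \<Rightarrow> nat" and F B w pre del +
  fixes nv n \<sigma> :: nat and lt off tgt :: "nat \<Rightarrow> nat" and lab :: "nat \<Rightarrow> label" and eps :: bool and dm :: nat
  assumes n_pos: "1 \<le> n"
    and lt_less: "p < n \<Longrightarrow> lt p < \<sigma>"
    and input_lt: "p < n \<Longrightarrow> I (2 + p) - 4 = lt p"
    and input_off: "i \<le> nv * \<sigma> \<Longrightarrow> I (2 + n + i) = off i"
    and off_mono: "i \<le> j \<Longrightarrow> j \<le> nv * \<sigma> \<Longrightarrow> off i \<le> off j"
    and off_0: "off 0 = 0"
    and input_tgt: "j < off (nv * \<sigma>) \<Longrightarrow> I (3 + n + nv * \<sigma> + j) = tgt j"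
    and tgt_less: "j < off (nv * \<sigma>) \<Longrightarrow> tgt j < nv"
    and tgt_inj: "i < nv * \<sigma> \<Longrightarrow> inj_on tgt {off i..<off (Suc i)}"
    and off_diff: "i < nv * \<sigma> \<Longrightarrow> off (Suc i) - off i \<le> dm"
    and lab_acc: "s < n \<Longrightarrow> p < n \<Longrightarrow> outgoing (lab s) = incoming (lab p) \<Longrightarrow> accepting (lab p) = 1"
    and F_eq: "F = 3 + n + nv * \<sigma> + off (nv * \<sigma>)"
    and B_ge: "F + 10 \<le> B" "nv * n + nv + n + 10 \<le> B" "8 * n * n * (dm + 1) + 10 \<le> B" "\<sigma> + 10 \<le> B"
begin

section \<open>The product of the database and the position automaton\<close>

definition lo where "lo v p = off (v * \<sigma> + lt p)"
definition hi where "hi v p = off (Suc (v * \<sigma> + lt p))"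

definition edge :: "nat \<Rightarrow> nat \<Rightarrow> nat \<Rightarrow> bool" where
  "edge v p x \<longleftrightarrow> (\<exists>j\<in>{lo v p..<hi v p}. tgt j = x)"

definition acc :: "nat \<Rightarrow> bool" where "acc p \<longleftrightarrow> accepting (lab p) = 1"

text \<open>The position \<open>n\<close> serves as the initial state.\<close>

definition follows :: "nat \<Rightarrow> nat \<Rightarrow> bool" where
  "follows s p \<longleftrightarrow> (if s = n then starting (lab p) = 1 else outgoing (lab s) = incoming (lab p))"

inductive reach :: "nat \<Rightarrow> nat \<Rightarrow> nat \<Rightarrow> bool" for u where
  reach_init: "reach u u n"
| reach_step: "reach u v s \<Longrightarrow> p < n \<Longrightarrow> follows s p \<Longrightarrow> edge v p x \<Longrightarrow> reach u x p"

definition result :: "nat \<Rightarrow> nat set" where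
  "result u = {x. \<exists>p<n. reach u x p \<and> acc p} \<union> (if eps then {u} else {})"

definition sources :: "nat list" where
  "sources = filter (\<lambda>u. result u \<noteq> {}) [0..<nv]"

definition amort :: nat where "amort = 4 * n * n * (dm + 1)"

text \<open>Up to \<open>amort * (1 + f)\<close> ticks may pass while \<open>f\<close> answers are
  known. With twice \<open>amort\<close> as period, the end of the \<open>k\<close>-th period
  guarantees at least \<open>2 * k - 1\<close> answers, hence \<open>k\<close> of them.\<close>

definition period :: nat where "period = 2 * amort"

lemma index_less: "v < nv \<Longrightarrow> p < n \<Longrightarrow> v * \<sigma> + lt p < nv * \<sigma>"
proof -
  assume "v < nv" "p < n"
  then have "v * \<sigma> + lt p < Suc v * \<sigma>" using lt_less by simp
  also have "\<dots> \<le> nv * \<sigma>" using \<open>v < nv\<close> by (intro mult_le_mono1) simp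
  finally show ?thesis .
qed

lemma lo_hi:
  assumes "v < nv" "p < n"
  shows "lo v p \<le> hi v p" "hi v p \<le> off (nv * \<sigma>)" "hi v p - lo v p \<le> dm" "inj_on tgt {lo v p..<hi v p}"
  using index_less[OF assms] off_mono[of "v * \<sigma> + lt p" "Suc (v * \<sigma> + lt p)"]
    off_mono[of "Suc (v * \<sigma> + lt p)" "nv * \<sigma>"] off_diff tgt_inj
  by (simp_all add: lo_def hi_def)

lemma edge_less: "edge v p x \<Longrightarrow> v < nv \<Longrightarrow> p < n \<Longrightarrow> x < nv"
  using lo_hi(2)[of v p] tgt_less by (force simp: edge_def)

lemma reach_cases: "reach u x p \<Longrightarrow> u < nv \<Longrightarrow> x < nv \<and> (p < n \<or> p = n \<and> x = u)"
  by (induction rule: reach.induct) (auto intro: edge_less)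

text \<open>By \<open>lab_acc\<close> a state entered from a proper position is accepting. A
  non-accepting one is therefore entered from the initial state, which is present only at the
  source.\<close>

lemma reach_not_acc:
  assumes "reach u x p" "u < nv" "p < n" "\<not> acc p"
  shows "edge u p x"
  using assms(1)
proof cases
  case (reach_step v s)
  have "s = n"
    using reach_step assms lab_acc[of s p] reach_cases[of u v s] by (auto simp: follows_def acc_def)
  then show ?thesis using reach_step reach_cases[of u v s] assms(2) by auto
qed (use assms in auto)

lemma code_inj:
  assumes "p < n" "p' < n"
  shows "x * n + p = x' * n + p' \<longleftrightarrow> x = x' \<and> p = p'"
proof
  assume *: "x * n + p = x' * n + p'"
  then have "(x * n + p) div n = (x' * n + p') div n" "(x * n + p) mod n = (x' * n + p') mod n" by simp_all
  then show "x = x' \<and> p = p'" using assms by simp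
qed simp

text \<open>The part of the environment that is available before the period and the list of sources
  have been computed.\<close>

definition env_base :: "env \<Rightarrow> arrays \<Rightarrow> bool" where
  "env_base v a \<longleftrightarrow> v xNodes = nv \<and> v xLength = n \<and> v xOffsets = 2 + n \<and> v xTargets = 3 + n + nv * \<sigma> \<and>
     v xEps = (if eps then 1 else 0) \<and>
     (\<forall>p<n. a aStart p = starting (lab p) \<and> a aAccept p = accepting (lab p) \<and>
        a aIn p = incoming (lab p) \<and> a aOut p = outgoing (lab p))"

lemma env_base_upd [simp]:
  "x \<notin> {xNodes, xLength, xOffsets, xTargets, xEps} \<Longrightarrow> env_base (v(x := y)) a = env_base v a"
  "b \<notin> {aStart, aAccept, aIn, aOut} \<Longrightarrow> env_base v (a(b := f)) = env_base v a"
  by (auto simp: env_base_def)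

definition env_ok :: "env \<Rightarrow> arrays \<Rightarrow> bool" where
  "env_ok v a \<longleftrightarrow> env_base v a \<and> v xPeriod = period \<and>
     v xGood = length sources \<and> (\<forall>i<length sources. a aGood i = sources ! i)"

lemma env_ok_upd [simp]:
  "x \<notin> {xNodes, xLength, xOffsets, xTargets, xEps, xPeriod, xGood} \<Longrightarrow> env_ok (v(x := y)) a = env_ok v a"
  "b \<notin> {aStart, aAccept, aIn, aOut, aGood} \<Longrightarrow> env_ok v (a(b := f)) = env_ok v a"
  by (auto simp: env_ok_def env_base_def)

text \<open>The inequalities between variables keep the first assignment from changing the operands
  of the second.\<close>

lemma wp_list_bounds:
  assumes "env_base v a" "v y = x" "x < nv" "v z = p" "p < n" "y \<noteq> l" "z \<noteq> l" "l \<noteq> xOffsets"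
    and cont: "\<And>g'. g' \<le> g + 50 \<Longrightarrow> Q (v(l := lo x p, r := hi x p)) a g' h"
  shows "wp (list_bounds \<sigma> y z l r) Q v a g h"
proof -
  let ?i = "x * \<sigma> + lt p"
  have i: "?i < nv * \<sigma>" by (rule index_less[OF assms(3,5)])
  have v: "v xOffsets = 2 + n" using assms(1) by (simp add: env_base_def)
  have lp: "I (2 + p) - 4 = lt p" by (rule input_lt[OF assms(5)])
  have o: "I (2 + n + ?i) = lo x p" "I (2 + n + ?i + 1) = hi x p"
    using input_off[of ?i] input_off[of "Suc ?i"] i by (simp_all add: lo_def hi_def)
  have b: "2 + n + ?i + 1 < F" "2 + p < F" "F \<le> B" "\<sigma> \<le> B" "x * \<sigma> \<le> B"
    using i F_eq B_ge assms(5) by auto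
  have "wp (list_bounds \<sigma> y z l r) Q v a g h \<longleftrightarrow> Q (v(l := lo x p, r := hi x p)) a (g + 38) h"
    unfolding list_bounds_def using assms(2,4,6-8) v lp o b by (simp add: add.commute[of 38])
  then show ?thesis using cont[of "g + 38"] by simp
qed

end

text \<open>\<open>gi\<close> is the stamp of this round and \<open>h0\<close> the list of earlier
  events. \<open>CC\<close> bounds the machine steps per tick; \<open>G0\<close> is the allowance
  for the time between the last earlier event and the first tick of this round.\<close>

locale source_search = search +
  fixes u gi :: nat and h0 :: "event list" and G0 CC :: nat
  assumes u_less: "u < nv"
    and CC: "CC = 1000"
    and G0: "50 \<le> G0" "G0 + CC * period + 300 \<le> del"
begin

section \<open>Search from one source: invariants and amortised cost\<close>

definition queue_inv :: "(nat \<times> nat) list \<Rightarrow> nat list \<Rightarrow> bool" where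
  "queue_inv qs fs \<longleftrightarrow> distinct qs \<and> distinct fs \<and> (u, n) \<in> set qs \<and> (\<forall>(x, p)\<in>set qs. reach u x p) \<and>
     set fs = {x. \<exists>p<n. (x, p) \<in> set qs \<and> acc p} \<union> (if eps then {u} else {})"

text \<open>\<open>qs\<close> contains all entries ever queued, also the processed ones.
  \<open>t\<close> is the number of ticks; its quotient and remainder by the period are the number
  of printed answers and the clock. All stamps are at most \<open>gi\<close>, so the next round
  finds no valid marks.\<close>

definition state_inv :: "env \<Rightarrow> arrays \<Rightarrow> event list \<Rightarrow> (nat \<times> nat) list \<Rightarrow> nat list \<Rightarrow> nat \<Rightarrow> bool" where
  "state_inv v a h qs fs t \<longleftrightarrow> env_ok v a \<and> queue_inv qs fs \<and>
     v xSource = u \<and> v xRound = gi \<and> v xTail = length qs \<and> v xFound = length fs \<and>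
     period * v xPrinted + v xClock = t \<and> v xClock < period \<and> v xPrinted \<le> length fs \<and>
     h = h0 @ map (Out u) (take (v xPrinted) fs) \<and>
     (\<forall>i<length qs. a aQueueNode i = fst (qs ! i) \<and> a aQueueState i = snd (qs ! i)) \<and>
     (\<forall>i<length fs. a aFound i = fs ! i) \<and>
     (\<forall>x<nv. \<forall>p<n. a aVisited (x * n + p) = gi \<longleftrightarrow> (x, p) \<in> set qs) \<and>
     (\<forall>x<nv. a aSeen x = gi \<longleftrightarrow> x \<in> set fs) \<and>
     (\<forall>i. a aVisited i \<le> gi) \<and> (\<forall>i. a aSeen i \<le> gi)"

lemma state_inv_upd [simp]:
  "x \<notin> {xNodes, xLength, xOffsets, xTargets, xEps, xPeriod, xGood, xSource, xRound, xTail, xFound, xPrinted, xClock} \<Longrightarrow>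
    state_inv (v(x := y)) a h qs fs t = state_inv v a h qs fs t"
  by (auto simp: state_inv_def)

text \<open>Before the first output of this source the time runs from an event of an earlier phase,
  hence \<open>G0\<close>.\<close>

definition gap_bound :: "env \<Rightarrow> nat" where
  "gap_bound v = (if v xPrinted = 0 then G0 else 50) + CC * v xClock"

lemma gap_bound_upd [simp]: "x \<notin> {xPrinted, xClock} \<Longrightarrow> gap_bound (v(x := y)) = gap_bound v"
  by (simp add: gap_bound_def)

lemma queue_inv_facts:
  assumes "queue_inv qs fs"
  shows "set qs \<subseteq> insert (u, n) ({..<nv} \<times> {..<n})" "length qs \<le> nv * n + 1" "set fs \<subseteq> {..<nv}"
    "length fs \<le> nv"
proof -
  show *: "set qs \<subseteq> insert (u, n) ({..<nv} \<times> {..<n})"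
    using assms reach_cases u_less by (fastforce simp: queue_inv_def)
  have "length qs = card (set qs)" using assms by (simp add: queue_inv_def distinct_card)
  also have "\<dots> \<le> card (insert (u, n) ({..<nv} \<times> {..<n}))" by (rule card_mono[OF _ *]) simp
  also have "\<dots> \<le> Suc (card ({..<nv} \<times> {..<n}))" by (rule card_insert_le_m1) auto
  finally show "length qs \<le> nv * n + 1" by (simp add: card_cartesian_product)
  show f: "set fs \<subseteq> {..<nv}" using assms * u_less by (auto simp: queue_inv_def split: if_splits)
  have "length fs = card (set fs)" using assms distinct_card[of fs] by (simp add: queue_inv_def)
  also have "\<dots> \<le> nv" using card_mono[OF _ f] by simp
  finally show "length fs \<le> nv" .
qed

text \<open>
  A state of the queue costs at most \<open>dm\<close> per position if it is accepting, but then it accounts for a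
  found node. There are few of the others, since they are reached in one step from the source, and
  all the successors of such a state are answers.
\<close>

definition list_cost :: "nat \<Rightarrow> nat \<Rightarrow> nat" where
  "list_cost s f = (if s = n \<or> acc s then dm else f)"

definition entry_cost :: "nat \<Rightarrow> nat \<Rightarrow> nat" where
  "entry_cost s f = 1 + n + n * list_cost s f"

definition queue_cost :: "(nat \<times> nat) list \<Rightarrow> nat \<Rightarrow> nat \<Rightarrow> nat" where
  "queue_cost qs k f = (\<Sum>i<k. entry_cost (snd (qs ! i)) f)"

text \<open>The initial and the accepting entries form \<open>Q\<close>, the others
  \<open>R\<close>. \<open>Q\<close> has at most \<open>1 + n * f\<close> entries with lists of cost
  \<open>dm\<close>, and \<open>R\<close> has at most \<open>n * dm\<close> entries with lists of
  cost \<open>f\<close>; the two products are of the same order.\<close>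

lemma queue_cost_le:
  assumes "queue_inv qs fs" "k \<le> length qs"
  shows "queue_cost qs k (length fs) \<le> amort * (1 + length fs)"
proof -
  let ?f = "length fs"
  let ?c = "\<lambda>z. entry_cost (snd z) ?f"
  define Q where "Q = {z \<in> set qs. snd z = n \<or> acc (snd z)}"
  define R where "R = {z \<in> set qs. snd z \<noteq> n \<and> \<not> acc (snd z)}"
  have d: "distinct qs" "distinct fs"
    and r: "\<And>x p. (x, p) \<in> set qs \<Longrightarrow> reach u x p"
    and fs: "set fs = {x. \<exists>p<n. (x, p) \<in> set qs \<and> acc p} \<union> (if eps then {u} else {})"
    using assms(1) by (auto simp: queue_inv_def)
  note qs = queue_inv_facts(1)[OF assms(1)]
  have "Q \<subseteq> insert (u, n) (set fs \<times> {..<n})"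
    unfolding Q_def fs using qs by auto
  then have "card Q \<le> card (insert (u, n) (set fs \<times> {..<n}))" by (rule card_mono[rotated]) simp
  also have "\<dots> \<le> Suc (card (set fs \<times> {..<n}))" by (rule card_insert_le_m1) auto
  finally have cQ: "card Q \<le> 1 + n * ?f" using d(2) by (simp add: card_cartesian_product distinct_card mult.commute)
  let ?S = "SIGMA p:{..<n}. {lo u p..<hi u p}"
  \<comment> \<open>A non-accepting entry is determined by its position and one arc leaving the
    source.\<close>
  have "R \<subseteq> (\<lambda>(p, j). (tgt j, p)) ` ?S"
  proof
    fix z assume "z \<in> R"
    then obtain x p where z: "z = (x, p)" "(x, p) \<in> set qs" "p \<noteq> n" "\<not> acc p" by (cases z) (auto simp: R_def)
    then have "p < n" using qs by auto
    then have "edge u p x" using reach_not_acc[OF r[OF z(2)] u_less] z(4) by simp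
    then show "z \<in> (\<lambda>(p, j). (tgt j, p)) ` ?S" using z(1) \<open>p < n\<close> by (auto simp: edge_def)
  qed
  then have "card R \<le> card ((\<lambda>(p, j). (tgt j, p)) ` ?S)" by (rule card_mono[rotated]) simp
  also have "\<dots> \<le> card ?S" by (rule card_image_le) simp
  also have "\<dots> = (\<Sum>p<n. hi u p - lo u p)" by simp
  also have "\<dots> \<le> (\<Sum>p<n. dm)" by (rule sum_mono) (use lo_hi(3)[OF u_less] in simp)
  finally have cR: "card R \<le> n * dm" by simp
  have "queue_cost qs k ?f \<le> (\<Sum>i<length qs. ?c (qs ! i))"
    unfolding queue_cost_def by (rule sum_mono2) (use assms(2) in auto)
  also have "\<dots> = (\<Sum>z\<in>set qs. ?c z)"
    using sum.reindex_bij_betw[OF bij_betw_nth[OF d(1) refl refl], of ?c] by simp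
  also have "\<dots> = (\<Sum>z\<in>Q. ?c z) + (\<Sum>z\<in>R. ?c z)"
    by (subst sum.union_disjoint[symmetric]) (auto simp: Q_def R_def intro!: sum.cong)
  also have "(\<Sum>z\<in>Q. ?c z) = card Q * (1 + n + n * dm)"
    by (simp add: Q_def entry_cost_def list_cost_def)
  also have "(\<Sum>z\<in>R. ?c z) = card R * (1 + n + n * ?f)"
    by (simp add: R_def entry_cost_def list_cost_def)
  \<comment> \<open>Both summands become \<open>2 * n * n * (1 + dm) * (1 + f)\<close>, where
    \<open>f\<close> is the number of found nodes; this is the origin of the 4 in
    \<open>amort\<close>.\<close>
  also have "card Q * (1 + n + n * dm) + card R * (1 + n + n * ?f) \<le>
      (n * (1 + ?f)) * (2 * n * (1 + dm)) + (n * (1 + dm)) * (2 * n * (1 + ?f))"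
  proof (intro add_mono mult_mono)
    show "card Q \<le> n * (1 + ?f)" using cQ n_pos by simp
    show "card R \<le> n * (1 + dm)" using cR by simp
    show "1 + n + n * dm \<le> 2 * n * (1 + dm)" "1 + n + n * ?f \<le> 2 * n * (1 + ?f)"
      using n_pos by (simp_all add: algebra_simps)
  qed simp_all
  also have "\<dots> = amort * (1 + ?f)" by (simp add: amort_def algebra_simps)
  finally show ?thesis .
qed

lemma period_le: "period + 10 \<le> B" "1 \<le> period"
proof -
  show "1 \<le> period" unfolding period_def amort_def using n_pos by (cases n) simp_all
  show "period + 10 \<le> B" using B_ge(3) by (simp add: period_def amort_def)
qed

text \<open>The premise on \<open>t\<close> guarantees an unprinted answer at the end of a period.
  The slack \<open>sl\<close> is what has been spent since the previous tick; advancing the clock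
  raises \<open>gap_bound\<close> by \<open>CC\<close>, which pays for the slack and for the tick
  itself. The continuation hides whether anything was printed.\<close>

lemma wp_tick:
  assumes inv: "state_inv v a h qs fs t" and t: "t + 1 \<le> amort * (1 + length fs)"
    and g: "g \<le> gap_bound v + sl" "sl + 50 \<le> CC"
    and cont: "\<And>c k g' h'. state_inv (v(xClock := c, xPrinted := k)) a h' qs fs (t + 1) \<Longrightarrow>
      g' \<le> gap_bound (v(xClock := c, xPrinted := k)) \<Longrightarrow> Q (v(xClock := c, xPrinted := k)) a g' h'"
  shows "wp tick Q v a g h"
proof -
  let ?c = "v xClock" and ?k = "v xPrinted"
  have f: "v xPeriod = period" "v xSource = u" "period * ?k + ?c = t" "?c < period" "?k \<le> length fs"
    "h = h0 @ map (Out u) (take ?k fs)" "\<And>i. i < length fs \<Longrightarrow> a aFound i = fs ! i"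
    using inv by (auto simp: state_inv_def env_ok_def env_base_def)
  have fB: "length fs + 10 \<le> B"
    using queue_inv_facts(4)[of qs fs] inv B_ge(2) by (auto simp: state_inv_def)
  show ?thesis
  proof (cases "?c + 1 < period")
    case True
    have "state_inv (v(xClock := ?c + 1, xPrinted := ?k)) a h qs fs (t + 1)"
      using inv True unfolding state_inv_def by (simp add: env_ok_def env_base_def)
    moreover have "g + 15 \<le> gap_bound (v(xClock := ?c + 1, xPrinted := ?k))"
      using g by (simp add: gap_bound_def)
    ultimately have "Q (v(xClock := ?c + 1, xPrinted := ?k)) a g' h" if "g' \<le> g + 15" for g'
      using that by (intro cont) auto
    moreover have "v(xClock := ?c + 1, xPrinted := ?k) = v(xClock := ?c + 1)" by auto
    ultimately show ?thesis
      using True period_le f(1,4) by (simp add: tick_def)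
  next
    case False
    then have c: "?c + 1 = period" using f(4) by simp
    \<comment> \<open>A period ends here: \<open>2 * amort * (?k + 1)\<close> ticks within the
      budget \<open>amort * (1 + length fs)\<close> force \<open>?k < length fs\<close>.\<close>
    have "period * (?k + 1) = t + 1" using c f(3) by (simp add: algebra_simps)
    also have "\<dots> \<le> amort * (1 + length fs)" by (rule t)
    finally have "amort * (2 * (?k + 1)) \<le> amort * (1 + length fs)" by (simp add: period_def algebra_simps)
    moreover have "0 < amort" using n_pos by (simp add: amort_def)
    ultimately have "2 * (?k + 1) \<le> 1 + length fs" unfolding mult_le_cancel1 by blast
    then have k: "?k < length fs" by simp
    have h: "h @ [Out u (fs ! ?k)] = h0 @ map (Out u) (take (Suc ?k) fs)"
      using f(6) k by (simp add: take_Suc_conv_app_nth)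
    have "state_inv (v(xClock := 0, xPrinted := ?k + 1)) a (h @ [Out u (fs ! ?k)]) qs fs (t + 1)"
      using inv k c period_le(2) h f(3) unfolding state_inv_def by (auto simp: env_ok_def env_base_def algebra_simps)
    \<comment> \<open>8 is one step for the output, six for increasing \<open>xPrinted\<close>, and
      one for the jump at the end of the branch.\<close>
    then have "Q (v(xClock := 0, xPrinted := ?k + 1)) a 8 (h @ [Out u (fs ! ?k)])"
      by (intro cont) (auto simp: gap_bound_def)
    moreover have "gap_bound v + CC \<le> del"
    proof -
      have "CC * ?c + CC = CC * period" using c by (metis add_mult_distrib2 mult.right_neutral)
      then show ?thesis using G0 by (simp add: gap_bound_def)
    qed
    ultimately show ?thesis
      using False period_le f(1,2,4,5,7) g k fB by (simp add: tick_def)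
  qed
qed

text \<open>The queue grows at its end only, so indices of processed entries stay valid. A new state
  adds an answer if it is accepting and its node has not been found in another state.\<close>

lemma wp_mark:
  assumes inv: "state_inv v a h qs fs t" and x: "v xSucc = x" "reach u x (v xPos)" "v xPos < n"
    and cont: "\<And>v' a' g' zs fs'. state_inv v' a' h (qs @ zs) fs' t \<Longrightarrow> (x, v xPos) \<in> set (qs @ zs) \<Longrightarrow>
      length fs \<le> length fs' \<Longrightarrow> g' \<le> g + 150 \<Longrightarrow> \<forall>y. y \<noteq> xTail \<and> y \<noteq> xFound \<longrightarrow> v' y = v y \<Longrightarrow> Q v' a' g' h"
  shows "wp mark Q v a g h"
proof -
  let ?p = "v xPos"
  have f: "v xLength = n" "v xRound = gi" "v xTail = length qs" "v xFound = length fs"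
    "a aAccept ?p = accepting (lab ?p)"
    "\<And>x p. x < nv \<Longrightarrow> p < n \<Longrightarrow> a aVisited (x * n + p) = gi \<longleftrightarrow> (x, p) \<in> set qs"
    "\<And>x. x < nv \<Longrightarrow> a aSeen x = gi \<longleftrightarrow> x \<in> set fs"
    and q: "queue_inv qs fs"
    using inv x(3) by (auto simp: state_inv_def env_ok_def env_base_def)
  have xnv: "x < nv" using reach_cases[OF x(2) u_less] by simp
  have "Suc x * n \<le> nv * n" using xnv by (intro mult_le_mono1) simp
  then have xB: "x * n + n \<le> nv * n" by simp
  note len = queue_inv_facts(2,4)[OF q]
  have safe: "x * n \<le> B" "x * n + ?p \<le> B" "length qs + 1 \<le> B" "length fs + 1 \<le> B" "1 \<le> B"
    using xB len B_ge(2) x(3) by auto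
  show ?thesis
  proof (cases "(x, ?p) \<in> set qs")
    case True
    then have "a aVisited (x * n + ?p) = gi" using f(6) xnv x(3) by simp
    moreover have "Q v a (g + 17) h"
      using cont[of v a "[]" fs "g + 17"] inv True by simp
    ultimately show ?thesis using safe f x(1) by (simp add: mark_def)
  next
    case False
    then have nvis: "a aVisited (x * n + ?p) \<noteq> gi" using f(6) xnv x(3) by simp
    have fs_in: "x \<in> set fs" if "acc ?p" "(x, ?p) \<in> set (qs @ zs)" "queue_inv (qs @ zs) fs'" "fs' = fs" for zs fs'
      using that x(3) by (auto simp: queue_inv_def)
    let ?a1 = "a(aVisited := (a aVisited)(x * n + ?p := gi),
      aQueueNode := (a aQueueNode)(length qs := x), aQueueState := (a aQueueState)(length qs := ?p))"
    let ?v1 = "v(xTail := Suc (length qs))"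
    have base: "state_inv ?v1 ?a1 h (qs @ [(x, ?p)]) fs t"
      if "acc ?p \<longrightarrow> x \<in> set fs"
      using inv that x xnv False unfolding state_inv_def queue_inv_def
      by (auto simp: env_ok_def env_base_def code_inj nth_append less_Suc_eq split: if_splits)
    show ?thesis
    proof (cases "acc ?p \<and> x \<notin> set fs")
      case False
      then have "state_inv ?v1 ?a1 h (qs @ [(x, ?p)]) fs t" using base by blast
      then have Q: "Q ?v1 ?a1 g' h" if "g' \<le> g + 150" for g'
        using that by (intro cont) auto
      show ?thesis
        using False nvis safe f x Q xnv by (auto simp: mark_def acc_def)
    next
      case True
      let ?a2 = "?a1(aSeen := (a aSeen)(x := gi), aFound := (a aFound)(length fs := x))"
      let ?v2 = "?v1(xFound := Suc (length fs))"
      have "state_inv ?v2 ?a2 h (qs @ [(x, ?p)]) (fs @ [x]) t"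
        using inv True x xnv False unfolding state_inv_def queue_inv_def
        by (auto simp: env_ok_def env_base_def code_inj nth_append less_Suc_eq split: if_splits)
      then have Q: "Q ?v2 ?a2 g' h" if "g' \<le> g + 150" for g'
        using that by (intro cont) auto
      show ?thesis
        using True nvis safe f x Q xnv by (auto simp: mark_def acc_def)
    qed
  qed
qed


lemma queue_cost_Suc: "queue_cost qs (Suc k) f = queue_cost qs k f + entry_cost (snd (qs ! k)) f"
  by (simp add: queue_cost_def)

lemma list_cost_mono: "f \<le> f' \<Longrightarrow> list_cost s f \<le> list_cost s f'"
  by (simp add: list_cost_def)

lemma queue_cost_mono:
  assumes "f \<le> f'" "k \<le> length qs"
  shows "queue_cost qs k f \<le> queue_cost (qs @ zs) k f'"
  unfolding queue_cost_def using assms(2)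
  by (intro sum_mono) (simp add: nth_append entry_cost_def list_cost_mono[OF assms(1)])

text \<open>The tick budget when entry \<open>k\<close> has left the queue and \<open>p\<close> of
  its positions have been handled.\<close>

definition pos_cost :: "(nat \<times> nat) list \<Rightarrow> nat \<Rightarrow> nat \<Rightarrow> nat \<Rightarrow> nat \<Rightarrow> nat" where
  "pos_cost qs k s p f = queue_cost qs k f + 1 + p + p * list_cost s f"

lemma pos_cost_mono:
  assumes "f \<le> f'" "k \<le> length qs"
  shows "pos_cost qs k s p f \<le> pos_cost (qs @ zs) k s p f'"
  unfolding pos_cost_def
  using queue_cost_mono[OF assms, of zs] list_cost_mono[OF assms(1), of s] by (simp add: add_mono)

lemma pos_cost_Suc: "pos_cost qs k s (Suc p) f = pos_cost qs k s p f + 1 + list_cost s f"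
  by (simp add: pos_cost_def)

lemma pos_cost_le:
  assumes "k < length qs" "snd (qs ! k) = s" "p \<le> n"
  shows "pos_cost qs k s p f \<le> queue_cost qs (Suc k) f"
proof -
  have *: "p * list_cost s f \<le> n * list_cost s f" using assms(3) by (rule mult_le_mono1)
  then show ?thesis
    using assms(2) add_mono[OF assms(3) *]
    by (simp add: pos_cost_def queue_cost_Suc entry_cost_def del: mult_le_cancel2)
qed

lemma pos_cost_le_amort:
  assumes "queue_inv qs fs" "k < length qs" "snd (qs ! k) = s" "p \<le> n"
  shows "pos_cost qs k s p (length fs) \<le> amort * (1 + length fs)"
  using pos_cost_le[OF assms(2-4)] queue_cost_le[OF assms(1), of "Suc k"] assms(2)
  by (meson Suc_leI le_trans)

text \<open>If \<open>s\<close> is neither initial nor accepting, then \<open>p\<close> is accepting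
  by \<open>lab_acc\<close>; the targets scanned so far are pairwise distinct and all of them are
  found nodes.\<close>

lemma list_progress:
  assumes "queue_inv qs fs" "reach u x s" "p < n" "follows s p" "lo x p \<le> j" "j \<le> hi x p"
    and "\<forall>i\<in>{lo x p..<j}. (tgt i, p) \<in> set qs"
  shows "j - lo x p \<le> list_cost s (length fs)"
proof (cases "s = n \<or> acc s")
  case True
  then show ?thesis
    using lo_hi(3)[of x p] reach_cases[OF assms(2) u_less] assms(3,6) by (simp add: list_cost_def)
next
  case False
  then have "acc p"
    using reach_cases[OF assms(2) u_less] lab_acc[of s p] assms(3,4) by (auto simp: follows_def acc_def)
  then have sub: "tgt ` {lo x p..<j} \<subseteq> set fs"
    using assms(1,3,7) by (auto simp: queue_inv_def)
  have "inj_on tgt {lo x p..<j}"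
    using reach_cases[OF assms(2) u_less] assms(3,6) by (intro inj_on_subset[OF lo_hi(4)[of x p]]) auto
  then have "j - lo x p = card (tgt ` {lo x p..<j})" by (simp add: card_image)
  also have "\<dots> \<le> card (set fs)" using sub by (simp add: card_mono)
  also have "\<dots> = length fs" using assms(1) distinct_card[of fs] by (simp add: queue_inv_def)
  finally show ?thesis using False by (simp add: list_cost_def)
qed

text \<open>The \<open>+ 1\<close> in the premise on \<open>t\<close> is the tick for position
  \<open>p\<close>, made before its list is scanned.\<close>

lemma wp_list_loop:
  assumes inv: "state_inv v a h qs fs t"
    and x: "v xPos = p" "v xNext = lo x p" "v xStop = hi x p" "p < n" "reach u x s" "follows s p"
    and k: "k < length qs" "qs ! k = (x, s)"
    and t: "t \<le> pos_cost qs k s p (length fs) + 1"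
    and g: "g \<le> gap_bound v + 100"
    and cont: "\<And>v' a' g' h' zs fs' t'. state_inv v' a' h' (qs @ zs) fs' t' \<Longrightarrow> length fs \<le> length fs' \<Longrightarrow>
      \<forall>y. edge x p y \<longrightarrow> (y, p) \<in> set (qs @ zs) \<Longrightarrow>
      t' \<le> pos_cost (qs @ zs) k s (Suc p) (length fs') \<Longrightarrow> g' \<le> gap_bound v' + 110 \<Longrightarrow>
      \<forall>y. y \<notin> {xTail, xFound, xPrinted, xClock, xNext, xSucc} \<longrightarrow> v' y = v y \<Longrightarrow> Q v' a' g' h'"
  shows "wp list_loop Q v a g h"
proof -
  have xnv: "x < nv" using reach_cases[OF x(5) u_less] by simp
  note lh = lo_hi[OF xnv x(4)]
  let ?J = "\<lambda>m v' a' g' h'. \<exists>zs fs'. state_inv v' a' h' (qs @ zs) fs' (t + (v' xNext - lo x p)) \<and>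
    length fs \<le> length fs' \<and> lo x p \<le> v' xNext \<and> v' xNext \<le> hi x p \<and> m = hi x p - v' xNext \<and>
    (\<forall>j\<in>{lo x p..<v' xNext}. (tgt j, p) \<in> set (qs @ zs)) \<and> g' \<le> gap_bound v' + 100 \<and>
    (\<forall>y. y \<notin> {xTail, xFound, xPrinted, xClock, xNext, xSucc} \<longrightarrow> v' y = v y)"
  show ?thesis
    unfolding list_loop_def
  proof (rule wp_while[where J = ?J and m = "hi x p - lo x p"])
    show "?J (hi x p - lo x p) v a g h"
      using inv x g lh by (intro exI[of _ "[]"] exI[of _ fs]) simp
  next
    fix m v1 a1 g1 h1
    assume "?J m v1 a1 g1 h1"
    then obtain zs fs1 where J: "state_inv v1 a1 h1 (qs @ zs) fs1 (t + (v1 xNext - lo x p))"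
      "length fs \<le> length fs1" "lo x p \<le> v1 xNext" "v1 xNext \<le> hi x p" "m = hi x p - v1 xNext"
      "\<forall>j\<in>{lo x p..<v1 xNext}. (tgt j, p) \<in> set (qs @ zs)" "g1 \<le> gap_bound v1 + 100"
      and frame: "\<forall>y. y \<notin> {xTail, xFound, xPrinted, xClock, xNext, xSucc} \<longrightarrow> v1 y = v y"
      by blast
    let ?j = "v1 xNext"
    have v1: "v1 xStop = hi x p" "v1 xPos = p" using frame x by auto
    have q1: "queue_inv (qs @ zs) fs1" and e1: "env_ok v1 a1" using J(1) by (auto simp: state_inv_def)
    have bound: "t + (j - lo x p) \<le> pos_cost (qs @ zs') k s (Suc p) (length fs')"
      if "queue_inv (qs @ zs') fs'" "length fs \<le> length fs'" "lo x p \<le> j" "j \<le> hi x p"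
        "\<forall>i\<in>{lo x p..<j}. (tgt i, p) \<in> set (qs @ zs')" for j zs' fs'
      using list_progress[OF that(1) x(5,4,6) that(3-5)] t k(1)
        pos_cost_mono[OF that(2), of k qs s p zs'] by (simp add: pos_cost_Suc)
    show "bsafe v1 a1 (Less (V xNext) (V xStop)) \<and>
      (if bval v1 a1 (Less (V xNext) (V xStop))
       then wp (xSucc ::= Inp (V xTargets \<oplus> V xNext) ;; xNext ::= V xNext \<oplus> N 1 ;; mark ;; tick)
         (\<lambda>v a g h. \<exists>m'<m. ?J m' v a (g + 1) h) v1 a1 (g1 + bcost (Less (V xNext) (V xStop))) h1
       else Q v1 a1 (g1 + (bcost (Less (V xNext) (V xStop)) + 1)) h1)"
    proof (cases "?j < hi x p")
      case False
      then have j: "?j = hi x p" using J(4) by simp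
      have "Q v1 a1 (g1 + 6) h1"
      proof (rule cont[OF J(1,2)])
        show "\<forall>y. edge x p y \<longrightarrow> (y, p) \<in> set (qs @ zs)"
          using J(6) j by (auto simp: edge_def)
        show "t + (?j - lo x p) \<le> pos_cost (qs @ zs) k s (Suc p) (length fs1)"
          by (rule bound[OF q1 J(2,3,4,6)])
      qed (use J(7) frame in auto)
      then show ?thesis using False v1 by simp
    next
      case True
      let ?y = "tgt ?j"
      have jt: "?j < off (nv * \<sigma>)" using True lh(2) by simp
      have I: "I (3 + n + nv * \<sigma> + ?j) = ?y" by (rule input_tgt[OF jt])
      have tg: "v1 xTargets = 3 + n + nv * \<sigma>" using e1 by (simp add: env_ok_def env_base_def)
      let ?v2 = "v1(xSucc := ?y, xNext := Suc ?j)"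
      have inv2: "state_inv ?v2 a1 h1 (qs @ zs) fs1 (t + (?j - lo x p))" using J(1) by simp
      have "edge x p ?y" unfolding edge_def using True J(3) by (intro bexI[of _ ?j]) auto
      then have r: "reach u ?y p" by (rule reach_step[OF x(5,4,6)])
      have "wp mark (wp tick (\<lambda>v a g h. \<exists>m'<m. ?J m' v a (g + 1) h)) ?v2 a1 g2 h1"
        if g2: "g2 \<le> g1 + 19" for g2
      proof (rule wp_mark[OF inv2])
        fix v3 a3 g3 ys fs3
        assume inv3: "state_inv v3 a3 h1 ((qs @ zs) @ ys) fs3 (t + (?j - lo x p))"
          and in3: "(?y, ?v2 xPos) \<in> set ((qs @ zs) @ ys)" and len3: "length fs1 \<le> length fs3"
          and g3: "g3 \<le> g2 + 150" and fr3: "\<forall>y. y \<noteq> xTail \<and> y \<noteq> xFound \<longrightarrow> v3 y = ?v2 y"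
        have v3: "v3 xNext = Suc ?j" "v3 xPrinted = v1 xPrinted" "v3 xClock = v1 xClock"
          using fr3 by simp_all
        then have gb: "gap_bound v3 = gap_bound v1" by (simp add: gap_bound_def)
        have q3: "queue_inv (qs @ zs @ ys) fs3" using inv3 by (simp add: state_inv_def)
        \<comment> \<open>\<open>mark\<close> precedes \<open>tick\<close>: the current target is
          queued, and counted if it is an answer, before the budget for its tick is needed.\<close>
        have all3: "\<forall>i\<in>{lo x p..<Suc ?j}. (tgt i, p) \<in> set (qs @ zs @ ys)"
          using J(6) in3 v1(2) by (auto simp: less_Suc_eq)
        have bnd: "t + (Suc ?j - lo x p) \<le> pos_cost (qs @ zs @ ys) k s (Suc p) (length fs3)"
          by (rule bound[OF q3 _ _ _ all3]) (use J(2,3) len3 True in auto)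
        show "wp tick (\<lambda>v a g h. \<exists>m'<m. ?J m' v a (g + 1) h) v3 a3 g3 h1"
        \<comment> \<open>269 is 100 from the invariant, 19 for the test and two assignments, and
          150 for \<open>mark\<close>.\<close>
        proof (rule wp_tick[OF inv3, where sl = 269])
          have "pos_cost (qs @ zs @ ys) k s (Suc p) (length fs3) \<le> amort * (1 + length fs3)"
            by (rule pos_cost_le_amort[OF q3]) (use k x(4) in \<open>auto simp: nth_append\<close>)
          then show "t + (?j - lo x p) + 1 \<le> amort * (1 + length fs3)"
            using bnd J(3) by (simp add: Suc_diff_le)
          show "g3 \<le> gap_bound v3 + 269" using g2 g3 J(7) gb by simp
          show "269 + 50 \<le> CC" by (simp add: CC)
          fix c k' g4 h4
          let ?v4 = "v3(xClock := c, xPrinted := k')"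
          assume inv4: "state_inv ?v4 a3 h4 ((qs @ zs) @ ys) fs3 (t + (?j - lo x p) + 1)"
            and g4: "g4 \<le> gap_bound ?v4"
          have "?J (hi x p - Suc ?j) ?v4 a3 (g4 + 1) h4"
            using inv4 g4 J(2,3) len3 True v3(1) all3 frame fr3
            by (intro exI[of _ "zs @ ys"] exI[of _ fs3]) (auto simp: Suc_diff_le)
          then show "\<exists>m'<m. ?J m' ?v4 a3 (g4 + 1) h4"
            using True J(5) by (intro exI[of _ "hi x p - Suc ?j"] conjI) simp_all
        qed
      qed (use r x(4) v1 in simp_all)
      moreover have "3 + n + nv * \<sigma> + ?j < F" using jt by (simp add: F_eq)
      ultimately show ?thesis using True v1 I tg B_ge(1) by simp
    qed
  qed
qed


text \<open>Here the \<open>+ 1\<close> in the premise on \<open>t\<close> is the tick made when the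
  entry left the queue.\<close>

lemma wp_pos_loop:
  assumes inv: "state_inv v a h qs fs t"
    and x: "v xPos = 0" "v xNode = x" "v xState = s" "reach u x s"
    and k: "k < length qs" "qs ! k = (x, s)"
    and t: "t \<le> queue_cost qs k (length fs) + 1"
    and g: "g \<le> gap_bound v + 150"
    and cont: "\<And>v' a' g' h' zs fs' t'. state_inv v' a' h' (qs @ zs) fs' t' \<Longrightarrow>
      \<forall>p<n. follows s p \<longrightarrow> (\<forall>y. edge x p y \<longrightarrow> (y, p) \<in> set (qs @ zs)) \<Longrightarrow>
      t' \<le> queue_cost (qs @ zs) (Suc k) (length fs') \<Longrightarrow> g' \<le> gap_bound v' + 160 \<Longrightarrow>
      v' xHead = v xHead \<Longrightarrow> Q v' a' g' h'"
  shows "wp (pos_loop \<sigma>) Q v a g h"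
proof -
  have xnv: "x < nv" and s: "s < n \<or> s = n" using reach_cases[OF x(4) u_less] by auto
  let ?J = "\<lambda>m v' a' g' h'. \<exists>zs fs' t'. state_inv v' a' h' (qs @ zs) fs' t' \<and> length fs \<le> length fs' \<and>
    v' xPos \<le> n \<and> m = n - v' xPos \<and> t' \<le> pos_cost (qs @ zs) k s (v' xPos) (length fs') \<and>
    (\<forall>p<v' xPos. follows s p \<longrightarrow> (\<forall>y. edge x p y \<longrightarrow> (y, p) \<in> set (qs @ zs))) \<and>
    g' \<le> gap_bound v' + 150 \<and> v' xNode = x \<and> v' xState = s \<and> v' xHead = v xHead"
  show ?thesis
    unfolding pos_loop_def
  proof (rule wp_while[where J = ?J and m = n])
    show "?J n v a g h"
      using inv x g t by (intro exI[of _ "[]"] exI[of _ fs] exI[of _ t]) (simp add: pos_cost_def)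
  next
    fix m v1 a1 g1 h1
    assume "?J m v1 a1 g1 h1"
    then obtain zs fs1 t1 where J: "state_inv v1 a1 h1 (qs @ zs) fs1 t1" "length fs \<le> length fs1"
      "v1 xPos \<le> n" "m = n - v1 xPos" "t1 \<le> pos_cost (qs @ zs) k s (v1 xPos) (length fs1)"
      "\<forall>p<v1 xPos. follows s p \<longrightarrow> (\<forall>y. edge x p y \<longrightarrow> (y, p) \<in> set (qs @ zs))"
      "g1 \<le> gap_bound v1 + 150" "v1 xNode = x" "v1 xState = s" "v1 xHead = v xHead"
      by blast
    define p where "p = v1 xPos"
    have q1: "queue_inv (qs @ zs) fs1" and e1: "env_ok v1 a1" using J(1) by (auto simp: state_inv_def)
    have len: "v1 xLength = n" using e1 by (simp add: env_ok_def env_base_def)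
    have k1: "k < length (qs @ zs)" "(qs @ zs) ! k = (x, s)" using k by (auto simp: nth_append)
    let ?b = "Less (V xPos) (V xLength)"
    let ?c2 = "Cond (Equal (V xState) (V xLength))
          (xFlag ::= Arr aStart (V xPos))
          (Cond (Equal (Arr aOut (V xState)) (Arr aIn (V xPos))) (xFlag ::= N 1) (xFlag ::= N 0))"
    let ?c3 = "Cond (Equal (V xFlag) (N 1)) (list_bounds \<sigma> xNode xPos xNext xStop ;; list_loop) Skip"
    let ?Q = "\<lambda>v a g h. \<exists>m'<m. ?J m' v a (g + 1) h"
    show "bsafe v1 a1 ?b \<and>
      (if bval v1 a1 ?b then wp (tick ;; ?c2 ;; ?c3 ;; xPos ::= V xPos \<oplus> N 1) ?Q v1 a1 (g1 + bcost ?b) h1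
       else Q v1 a1 (g1 + (bcost ?b + 1)) h1)"
    proof (cases "p < n")
      case False
      then have p: "v1 xPos = n" using J(3) p_def by simp
      have "Q v1 a1 (g1 + 6) h1"
      proof (rule cont[OF J(1)])
        show "t1 \<le> queue_cost (qs @ zs) (Suc k) (length fs1)"
          using J(5) pos_cost_le[OF k1(1), of s n] k1(2) p by (simp add: le_trans)
      qed (use J p in auto)
      then show ?thesis using p len by simp
    next
      case True
      have pB: "p + 10 \<le> B" using True B_ge(2) by simp
      have "wp tick (wp (?c2 ;; ?c3 ;; xPos ::= V xPos \<oplus> N 1) ?Q) v1 a1 (g1 + 5) h1"
      proof (rule wp_tick[OF J(1), where sl = 155])
        have "pos_cost (qs @ zs) k s (Suc p) (length fs1) \<le> amort * (1 + length fs1)"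
          by (rule pos_cost_le_amort[OF q1 k1(1)]) (use k1(2) True in auto)
        then show "t1 + 1 \<le> amort * (1 + length fs1)"
          using J(5) by (simp add: pos_cost_Suc p_def)
        show "g1 + 5 \<le> gap_bound v1 + 155" using J(7) by simp
        show "155 + 50 \<le> CC" by (simp add: CC)
        fix c k' g2 h2
        let ?v2 = "v1(xClock := c, xPrinted := k')"
        assume inv2: "state_inv ?v2 a1 h2 (qs @ zs) fs1 (t1 + 1)" and g2: "g2 \<le> gap_bound ?v2"
        have v2: "?v2 xState = s" "?v2 xLength = n" "?v2 xPos = p" "?v2 xNode = x" "?v2 xHead = v xHead"
          using J len p_def by simp_all
        have lab: "a1 aStart p = starting (lab p)" "a1 aIn p = incoming (lab p)"
          "s < n \<Longrightarrow> a1 aOut s = outgoing (lab s)"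
          using e1 True by (auto simp: env_ok_def env_base_def)
        define R where "R = wp (?c3 ;; xPos ::= V xPos \<oplus> N 1) ?Q"
        have step: "R (?v2(xFlag := y)) a1 g3 h2"
          if y: "y = 1 \<longleftrightarrow> follows s p" and g3: "g3 \<le> g2 + 30" for y g3
        proof (cases "follows s p")
          case False
          have "?J (n - Suc p) (?v2(xFlag := y, xPos := Suc p)) a1 g4 h2" if "g4 \<le> g3 + 20" for g4
            using inv2 J(2,5,6,8-) v2 False True that g3 g2
            by (intro exI[of _ zs] exI[of _ fs1] exI[of _ "t1 + 1"])
              (auto simp: less_Suc_eq p_def pos_cost_Suc)
          from this[of "g3 + 12"] have "?Q (?v2(xFlag := y, xPos := Suc p)) a1 (g3 + 11) h2"
            using True J(4) p_def by (intro exI[of _ "n - Suc p"] conjI) simp_all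
          then show ?thesis
            using False y True p_def pB B_ge by (simp add: R_def)
        next
          case fol: True
          let ?v3 = "?v2(xFlag := y)"
          have inv3: "state_inv ?v3 a1 h2 (qs @ zs) fs1 (t1 + 1)" using inv2 by simp
          then have e3: "env_base ?v3 a1" by (simp add: state_inv_def env_ok_def)
          have "wp (list_bounds \<sigma> xNode xPos xNext xStop) (wp list_loop (wp (xPos ::= V xPos \<oplus> N 1) ?Q)) ?v3 a1 g4 h2"
            if g4: "g4 \<le> g3 + 10" for g4
          proof (rule wp_list_bounds[OF e3 _ xnv _ True])
            fix g5 assume g5: "g5 \<le> g4 + 50"
            let ?v4 = "?v3(xNext := lo x p, xStop := hi x p)"
            have inv4: "state_inv ?v4 a1 h2 (qs @ zs) fs1 (t1 + 1)" using inv3 by simp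
            show "wp list_loop (wp (xPos ::= V xPos \<oplus> N 1) ?Q) ?v4 a1 g5 h2"
            proof (rule wp_list_loop[OF inv4 _ _ _ True x(4) fol k1])
              show "t1 + 1 \<le> pos_cost (qs @ zs) k s p (length fs1) + 1" using J(5) p_def by simp
              show "g5 \<le> gap_bound ?v4 + 100" using g2 g3 g4 g5 by simp
              fix v5 a5 g6 h5 ys fs5 t5
              assume inv5: "state_inv v5 a5 h5 ((qs @ zs) @ ys) fs5 t5" and len5: "length fs1 \<le> length fs5"
                and edges: "\<forall>y. edge x p y \<longrightarrow> (y, p) \<in> set ((qs @ zs) @ ys)"
                and t5: "t5 \<le> pos_cost ((qs @ zs) @ ys) k s (Suc p) (length fs5)"
                and g6: "g6 \<le> gap_bound v5 + 110"
                and fr: "\<forall>y. y \<notin> {xTail, xFound, xPrinted, xClock, xNext, xSucc} \<longrightarrow> v5 y = ?v4 y"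
              have v5: "v5 xPos = p" "v5 xNode = x" "v5 xState = s" "v5 xHead = v xHead"
                using fr v2 by simp_all
              have "?J (n - Suc p) (v5(xPos := Suc p)) a5 g7 h5" if "g7 \<le> g6 + 20" for g7
                using inv5 len5 J(2,6) edges t5 g6 v5 True that
                by (intro exI[of _ "zs @ ys"] exI[of _ fs5] exI[of _ t5]) (auto simp: less_Suc_eq p_def)
              from this[of "g6 + 7"] have "?Q (v5(xPos := Suc p)) a5 (g6 + 6) h5"
                using True J(4) p_def by (intro exI[of _ "n - Suc p"] conjI) simp_all
              then show "wp (xPos ::= V xPos \<oplus> N 1) ?Q v5 a5 g6 h5"
                using v5 True p_def pB by simp
            qed (use v2 in simp_all)
          qed (use v2 in simp_all)
          then show ?thesis using fol y B_ge by (simp add: R_def)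
        qed
        have "wp ?c2 R ?v2 a1 g2 h2"
        proof (cases "s = n")
          case True
          then have "starting (lab p) = 1 \<longleftrightarrow> follows s p" by (simp add: follows_def)
          from step[OF this, of "g2 + 15"] show ?thesis using True v2 lab B_ge by (simp add: add.commute)
        next
          case False
          then have "follows s p \<longleftrightarrow> outgoing (lab s) = incoming (lab p)" "s < n"
            using s by (auto simp: follows_def)
          then show ?thesis using step[of 1 "g2 + 26"] step[of 0 "g2 + 27"] False v2 lab B_ge by (simp add: add.commute)
        qed
        then show "wp (?c2 ;; ?c3 ;; xPos ::= V xPos \<oplus> N 1) ?Q ?v2 a1 g2 h2"
          by (simp only: wp_seq R_def)
      qed
      then show ?thesis using True len p_def by (simp add: add.commute[of 5])
    qed
  qed
qed


text \<open>Each state is queued once, which bounds the number of rounds. At the end every entry has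
  been processed, and a set that contains the initial state and is closed under steps contains
  everything reachable.\<close>

lemma wp_queue_loop:
  assumes inv: "state_inv v a h [(u, n)] fs 0"
    and x: "v xHead = 0"
    and g: "g \<le> gap_bound v + 200"
    and cont: "\<And>v' a' g' h' qs fs' t'. state_inv v' a' h' qs fs' t' \<Longrightarrow> set fs' = result u \<Longrightarrow>
      g' \<le> gap_bound v' + 210 \<Longrightarrow> Q v' a' g' h'"
  shows "wp (queue_loop \<sigma>) Q v a g h"
proof -
  let ?closed = "\<lambda>qs k. \<forall>i<k. \<forall>p<n. follows (snd (qs ! i)) p \<longrightarrow>
    (\<forall>y. edge (fst (qs ! i)) p y \<longrightarrow> (y, p) \<in> set qs)"
  let ?J = "\<lambda>m v' a' g' h'. \<exists>qs fs' t'. state_inv v' a' h' qs fs' t' \<and>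
    v' xHead \<le> length qs \<and> m = nv * n + 1 - v' xHead \<and> t' \<le> queue_cost qs (v' xHead) (length fs') \<and>
    ?closed qs (v' xHead) \<and> g' \<le> gap_bound v' + 200"
  show ?thesis
    unfolding queue_loop_def
  proof (rule wp_while[where J = ?J and m = "nv * n + 1"])
    show "?J (nv * n + 1) v a g h"
      using inv x g by (intro exI[of _ "[(u, n)]"] exI[of _ fs] exI[of _ 0]) simp
  next
    fix m v1 a1 g1 h1
    assume "?J m v1 a1 g1 h1"
    then obtain qs fs1 t1 where J: "state_inv v1 a1 h1 qs fs1 t1" "v1 xHead \<le> length qs"
      "m = nv * n + 1 - v1 xHead" "t1 \<le> queue_cost qs (v1 xHead) (length fs1)"
      "?closed qs (v1 xHead)" "g1 \<le> gap_bound v1 + 200"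
      by blast
    define k where "k = v1 xHead"
    have q1: "queue_inv qs fs1" and tail: "v1 xTail = length qs" using J(1) by (auto simp: state_inv_def)
    have r: "(y, p) \<in> set qs \<Longrightarrow> reach u y p" for y p using q1 by (auto simp: queue_inv_def)
    note len = queue_inv_facts(2)[OF q1]
    let ?b = "Less (V xHead) (V xTail)"
    let ?body = "xNode ::= Arr aQueueNode (V xHead) ;; xState ::= Arr aQueueState (V xHead) ;;
        xHead ::= V xHead \<oplus> N 1 ;; tick ;; xPos ::= N 0 ;; pos_loop \<sigma>"
    let ?Q = "\<lambda>v a g h. \<exists>m'<m. ?J m' v a (g + 1) h"
    show "bsafe v1 a1 ?b \<and> (if bval v1 a1 ?b then wp ?body ?Q v1 a1 (g1 + bcost ?b) h1
       else Q v1 a1 (g1 + (bcost ?b + 1)) h1)"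
    proof (cases "k < length qs")
      case False
      then have k: "v1 xHead = length qs" using J(2) k_def by simp
      have "Q v1 a1 (g1 + 6) h1"
      proof (rule cont[OF J(1)])
        have "(y, p) \<in> set qs" if "reach u y p" for y p
          using that
        proof (induction rule: reach.induct)
          case reach_init
          then show ?case using q1 by (simp add: queue_inv_def)
        next
          case (reach_step v s p x)
          then obtain i where "i < length qs" "qs ! i = (v, s)" by (auto simp: in_set_conv_nth)
          then show ?case using J(5)[unfolded k, rule_format, of i p x] reach_step by simp
        qed
        then show "set fs1 = result u" using q1 r by (auto simp: queue_inv_def result_def)
      qed (use J in auto)
      then show ?thesis using k tail by simp
    next
      case True
      obtain x s where xs: "qs ! k = (x, s)" by (cases "qs ! k")
      have ru: "reach u x s" using r xs True by (metis nth_mem)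
      have arr: "a1 aQueueNode k = x" "a1 aQueueState k = s"
        using J(1) True xs by (auto simp: state_inv_def)
      let ?v2 = "v1(xNode := x, xState := s, xHead := Suc k)"
      have inv2: "state_inv ?v2 a1 h1 qs fs1 t1" using J(1) by simp
      have "wp tick (wp (xPos ::= N 0 ;; pos_loop \<sigma>) ?Q) ?v2 a1 g2 h1" if g2: "g2 \<le> g1 + 40" for g2
      proof (rule wp_tick[OF inv2, where sl = 240])
        have "pos_cost qs k s 0 (length fs1) \<le> amort * (1 + length fs1)"
          by (rule pos_cost_le_amort[OF q1 True]) (use xs in auto)
        then show "t1 + 1 \<le> amort * (1 + length fs1)" using J(4) by (simp add: pos_cost_def k_def)
        show "g2 \<le> gap_bound ?v2 + 240" using g2 J(6) by simp
        show "240 + 50 \<le> CC" by (simp add: CC)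
        fix c k' g3 h3
        let ?v3 = "?v2(xClock := c, xPrinted := k')"
        assume inv3: "state_inv ?v3 a1 h3 qs fs1 (t1 + 1)" and g3: "g3 \<le> gap_bound ?v3"
        let ?v4 = "?v3(xPos := 0)"
        have inv4: "state_inv ?v4 a1 h3 qs fs1 (t1 + 1)" using inv3 by simp
        have "wp (pos_loop \<sigma>) ?Q ?v4 a1 g4 h3" if g4: "g4 \<le> g3 + 10" for g4
        proof (rule wp_pos_loop[OF inv4 _ _ _ ru True xs])
          show "t1 + 1 \<le> queue_cost qs k (length fs1) + 1" using J(4) k_def by simp
          show "g4 \<le> gap_bound ?v4 + 150" using g3 g4 by simp
          fix v5 a5 g5 h5 zs fs5 t5
          assume 5: "state_inv v5 a5 h5 (qs @ zs) fs5 t5"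
            and edges: "\<forall>p<n. follows s p \<longrightarrow> (\<forall>y. edge x p y \<longrightarrow> (y, p) \<in> set (qs @ zs))"
            and t5: "t5 \<le> queue_cost (qs @ zs) (Suc k) (length fs5)"
            and g5: "g5 \<le> gap_bound v5 + 160" and hd: "v5 xHead = ?v4 xHead"
          have "v5 xHead = Suc k" using hd by simp
          moreover have "?closed (qs @ zs) (Suc k)"
          proof (intro allI impI)
            fix i p y
            assume i: "i < Suc k" "p < n" "follows (snd ((qs @ zs) ! i)) p" "edge (fst ((qs @ zs) ! i)) p y"
            show "(y, p) \<in> set (qs @ zs)"
            proof (cases "i = k")
              case eq: True
              then show ?thesis using edges i xs True by (auto simp: nth_append)
            next
              case False
              then have "i < k" using i(1) by simp
              then show ?thesis using J(5)[folded k_def, rule_format, of i p y] i True by (auto simp: nth_append)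
            qed
          qed
          ultimately have "?J (nv * n + 1 - Suc k) v5 a5 (g5 + 1) h5"
            using 5 t5 g5 True by (intro exI[of _ "qs @ zs"] exI[of _ fs5] exI[of _ t5]) auto
          moreover have "nv * n + 1 - Suc k < m" using J(3) k_def True len by simp
          ultimately show "?Q v5 a5 g5 h5" by blast
        qed simp_all
        then show "wp (xPos ::= N 0 ;; pos_loop \<sigma>) ?Q ?v3 a1 g3 h3" by simp
      qed
      moreover have "k + 1 \<le> B" using True len B_ge(2) by simp
      ultimately show ?thesis using True tail arr k_def by simp
    qed
  qed
qed

text \<open>That there is an answer matters for the final time: after an output for this source the
  allowance \<open>G0\<close> is gone, so waiting times do not accumulate from source to
  source.\<close>

lemma wp_flush:
  assumes inv: "state_inv v a h qs fs t" and fs: "set fs = result u" "result u \<noteq> {}"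
    and g: "g \<le> gap_bound v + 210"
    and cont: "\<And>k g'. g' \<le> CC * period + 300 \<Longrightarrow> Q (v(xPrinted := k)) a g' (h0 @ map (Out u) fs)"
  shows "wp flush Q v a g h"
proof -
  have f: "v xSource = u" "v xFound = length fs" "v xClock < period" "v xPrinted \<le> length fs"
    "h = h0 @ map (Out u) (take (v xPrinted) fs)" "\<And>i. i < length fs \<Longrightarrow> a aFound i = fs ! i"
    "queue_inv qs fs"
    using inv by (auto simp: state_inv_def)
  have pos: "length fs > 0" using fs by auto
  let ?G = "\<lambda>k. (if k = 0 then G0 else 50) + CC * period + 210"
  let ?J = "\<lambda>m v' a' g' h'. \<exists>k\<le>length fs. v' = v(xPrinted := k) \<and> a' = a \<and>
    h' = h0 @ map (Out u) (take k fs) \<and> g' \<le> ?G k \<and> m = length fs - k"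
  have g': "g \<le> ?G (v xPrinted)"
  proof -
    define x y where "x = CC * v xClock" and "y = CC * period"
    have "x \<le> y" using f(3) by (simp add: x_def y_def)
    then show ?thesis using g unfolding gap_bound_def x_def[symmetric] y_def[symmetric] by simp
  qed
  have fB: "length fs + 10 \<le> B"
    using queue_inv_facts(4)[OF f(7)] B_ge(2) by simp
  show ?thesis
    unfolding flush_def
  proof (rule wp_while[where J = ?J and m = "length fs - v xPrinted"])
    show "?J (length fs - v xPrinted) v a g h"
      using f g' by (intro exI[of _ "v xPrinted"]) simp
  next
    fix m v1 a1 g1 h1
    assume "?J m v1 a1 g1 h1"
    then obtain k where J: "k \<le> length fs" "v1 = v(xPrinted := k)" "a1 = a"
      "h1 = h0 @ map (Out u) (take k fs)" "g1 \<le> ?G k" "m = length fs - k"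
      by blast
    let ?b = "Less (V xPrinted) (V xFound)"
    show "bsafe v1 a1 ?b \<and> (if bval v1 a1 ?b
      then wp (Emit (V xSource) (Arr aFound (V xPrinted)) ;; xPrinted ::= V xPrinted \<oplus> N 1)
        (\<lambda>v a g h. \<exists>m'<m. ?J m' v a (g + 1) h) v1 a1 (g1 + bcost ?b) h1
       else Q v1 a1 (g1 + (bcost ?b + 1)) h1)"
    proof (cases "k < length fs")
      case False
      then have k: "k = length fs" using J(1) by simp
      have "Q (v(xPrinted := k)) a (g1 + 6) (h0 @ map (Out u) fs)"
        by (rule cont) (use J(5) k pos in simp)
      then show ?thesis using J f k by simp
    next
      case True
      have h: "h1 @ [Out u (fs ! k)] = h0 @ map (Out u) (take (Suc k) fs)"
        using J(4) True by (simp add: take_Suc_conv_app_nth)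
      have "?J (length fs - Suc k) (v(xPrinted := Suc k)) a 8 (h1 @ [Out u (fs ! k)])"
        using True h by (intro exI[of _ "Suc k"]) simp
      then have "\<exists>m'<m. ?J m' (v(xPrinted := Suc k)) a 8 (h1 @ [Out u (fs ! k)])"
        using True J(6) by (intro exI[of _ "length fs - Suc k"]) simp
      moreover have "g1 + 100 \<le> del + 20" using J(5) G0 by (simp split: if_splits)
      ultimately show ?thesis using True J(1-3) f fB by simp
    qed
  qed
qed

end

section \<open>Enumeration over all sources\<close>

context search
begin

definition "CC = (1000 :: nat)"

text \<open>The time left over from the previous source and the initialisation of this one fit into
  the allowance \<open>G0\<close>, about one period; the other period in \<open>del\<close> is for
  the ticks up to the next output.\<close>

lemma wp_node_search:
  assumes env: "env_ok v a" and gi: "v xRound = i" "i < length sources"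
    and stamps: "\<And>j. a aVisited j \<le> i" "\<And>j. a aSeen j \<le> i"
    and del: "2 * CC * period + 1000 \<le> del"
    and g: "g \<le> CC * period + 320"
    and cont: "\<And>v' a' g' fs. env_ok v' a' \<Longrightarrow> v' xRound = Suc i \<Longrightarrow> \<forall>j. a' aVisited j \<le> Suc i \<Longrightarrow>
      \<forall>j. a' aSeen j \<le> Suc i \<Longrightarrow> g' \<le> CC * period + 300 \<Longrightarrow> distinct fs \<Longrightarrow>
      set fs = result (sources ! i) \<Longrightarrow> Q v' a' g' (h @ map (Out (sources ! i)) fs)"
  shows "wp (node_search \<sigma>) Q v a g h"
proof -
  define u where "u = sources ! i"
  have "u \<in> set sources" using gi(2) by (simp add: u_def)
  then have u: "u < nv" "result u \<noteq> {}" by (auto simp: sources_def)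
  have "length sources \<le> nv" unfolding sources_def using length_filter_le[of _ "[0..<nv]"] by simp
  then have iB: "i + 10 \<le> B" using gi(2) B_ge(2) by simp
  define G0 where "G0 = CC * period + 500"
  \<comment> \<open>The stamp \<open>Suc i\<close> exceeds all stamps in the arrays, so nothing
    counts as visited or seen yet.\<close>
  interpret S: source_search I F B w pre del nv n \<sigma> lt off tgt lab eps dm u "Suc i" h G0 CC
    by unfold_locales (use u del in \<open>auto simp: CC_def G0_def\<close>)
  have v: "v xLength = n" "a aGood i = u" "v xEps = (if eps then 1 else 0)"
    using env gi(2) by (auto simp: env_ok_def env_base_def u_def)
  define fs where "fs = (if eps then [u] else [])"
  let ?v = "v(xSource := u, xRound := Suc i, xHead := 0, xTail := Suc 0, xFound := length fs,
    xPrinted := 0, xClock := 0)"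
  define a1 where "a1 = a(aQueueNode := (a aQueueNode)(0 := u), aQueueState := (a aQueueState)(0 := n))"
  define a2 where "a2 = (if eps then a1(aFound := (a1 aFound)(0 := u), aSeen := (a1 aSeen)(u := Suc i)) else a1)"
  have ne: "a aVisited j \<noteq> Suc i" "a aSeen j \<noteq> Suc i" for j
    using stamps[of j] by simp_all
  have env1: "env_ok v a1" "env_ok v (a1(aFound := (a1 aFound)(0 := u), aSeen := (a1 aSeen)(u := Suc i)))"
    using env by (simp_all add: a1_def)
  then have "env_ok v a2" unfolding a2_def by metis
  then have env': "env_ok ?v a2" by simp
  have q: "S.queue_inv [(u, n)] fs"
    by (auto simp: S.queue_inv_def fs_def intro: reach_init)
  have "\<And>j. a2 aVisited j \<le> Suc i" "\<And>j. a2 aSeen j \<le> Suc i"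
    using stamps by (auto simp: a2_def a1_def le_SucI)
  then have inv: "S.state_inv ?v a2 h [(u, n)] fs 0"
    unfolding S.state_inv_def using env' q S.period_le(2) ne by (auto simp: a2_def a1_def fs_def)
  have main: "wp (queue_loop \<sigma>) (wp flush Q) ?v a2 g' h" if g': "g' \<le> g + 100" for g'
  proof (rule S.wp_queue_loop[OF inv])
    have G: "S.gap_bound ?v = G0" by (simp add: S.gap_bound_def)
    have "g' \<le> G0 + 200" using g' g by (simp add: G0_def)
    then show "g' \<le> S.gap_bound ?v + 200" unfolding G .
    fix v3 a3 g3 h3 qs fs3 t3
    assume inv3: "S.state_inv v3 a3 h3 qs fs3 t3" and fs3: "set fs3 = result u"
      and g3: "g3 \<le> S.gap_bound v3 + 210"
    show "wp flush Q v3 a3 g3 h3"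
    proof (rule S.wp_flush[OF inv3 fs3 u(2) g3])
      fix k g4 assume g4: "g4 \<le> CC * period + 300"
      have "env_ok v3 a3" "v3 xRound = Suc i" "\<forall>j. a3 aVisited j \<le> Suc i" "\<forall>j. a3 aSeen j \<le> Suc i"
        "distinct fs3"
        using inv3 unfolding S.state_inv_def S.queue_inv_def by blast+
      then show "Q (v3(xPrinted := k)) a3 g4 (h @ map (Out u) fs3)"
        using fs3 g4 unfolding u_def by (intro cont) simp_all
    qed
  qed simp
  show ?thesis
  proof (cases eps)
    case True
    have v2: "?v = v(xSource := u, xRound := Suc i, xHead := 0, xTail := Suc 0,
      xPrinted := 0, xClock := 0, xFound := Suc 0)"
      using True by (auto simp: fs_def)
    have a2: "a2 = a(aQueueNode := (a aQueueNode)(0 := u), aQueueState := (a aQueueState)(0 := n),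
      aFound := (a aFound)(0 := u), aSeen := (a aSeen)(u := Suc i))"
      using True by (simp add: a2_def a1_def)
    from main[unfolded v2 a2] show ?thesis
      using True iB v gi(1) by (simp add: node_search_def)
  next
    case False
    have a2: "a2 = a1" and fs: "length fs = 0" using False by (simp_all add: a2_def fs_def)
    from main[unfolded a2 a1_def fs] show ?thesis
      using False iB v gi(1) by (simp add: node_search_def)
  qed
qed

text \<open>Distinctness across sources and the order of the output both come from
  \<open>sources\<close> being strictly increasing.\<close>

lemma wp_enumerate:
  assumes env: "env_ok v a" and r: "v xRound = 0" and stamps: "\<And>j. a aVisited j = 0" "\<And>j. a aSeen j = 0"
    and del: "2 * CC * period + 1000 \<le> del"
    and g: "g \<le> CC * period + 300"
    and cont: "\<And>v' a' g' ps. distinct ps \<Longrightarrow> set ps = {(x, y). x < nv \<and> y \<in> result x} \<Longrightarrow>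
      sorted (map fst ps) \<Longrightarrow> g' \<le> del \<Longrightarrow> Q v' a' g' (h @ map (\<lambda>(x, y). Out x y) ps)"
  shows "wp (enumerate \<sigma>) Q v a g h"
proof -
  let ?J = "\<lambda>m v' a' g' h'. \<exists>ps. env_ok v' a' \<and> v' xRound \<le> length sources \<and>
    m = length sources - v' xRound \<and> (\<forall>j. a' aVisited j \<le> v' xRound) \<and> (\<forall>j. a' aSeen j \<le> v' xRound) \<and>
    g' \<le> CC * period + 310 \<and> h' = h @ map (\<lambda>(x, y). Out x y) ps \<and> distinct ps \<and> sorted (map fst ps) \<and>
    set ps = {(x, y). x \<in> set (take (v' xRound) sources) \<and> y \<in> result x}"
  have sd: "sorted_wrt (<) sources"
    by (simp add: sources_def sorted_wrt_filter)
  show ?thesis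
    unfolding enumerate_def
  proof (rule wp_while[where J = ?J and m = "length sources"])
    show "?J (length sources) v a g h"
      using env r stamps g by (intro exI[of _ "[]"]) simp
  next
    fix m v1 a1 g1 h1
    assume "?J m v1 a1 g1 h1"
    then obtain ps where J: "env_ok v1 a1" "v1 xRound \<le> length sources" "m = length sources - v1 xRound"
      "\<forall>j. a1 aVisited j \<le> v1 xRound" "\<forall>j. a1 aSeen j \<le> v1 xRound" "g1 \<le> CC * period + 310"
      and h1: "h1 = h @ map (\<lambda>(x, y). Out x y) ps" and ps: "distinct ps" "sorted (map fst ps)"
        "set ps = {(x, y). x \<in> set (take (v1 xRound) sources) \<and> y \<in> result x}"
      by blast
    define i where "i = v1 xRound"
    have good: "v1 xGood = length sources" using J(1) by (simp add: env_ok_def env_base_def)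
    let ?b = "Less (V xRound) (V xGood)"
    show "bsafe v1 a1 ?b \<and> (if bval v1 a1 ?b
      then wp (node_search \<sigma>) (\<lambda>v a g h. \<exists>m'<m. ?J m' v a (g + 1) h) v1 a1 (g1 + bcost ?b) h1
       else Q v1 a1 (g1 + (bcost ?b + 1)) h1)"
    proof (cases "i < length sources")
      case False
      then have "set ps = {(x, y). x < nv \<and> y \<in> result x}"
        using ps(3) by (auto simp: i_def sources_def)
      then have "Q v1 a1 (g1 + 6) h1"
        unfolding h1 using ps J(6) del by (intro cont) auto
      then show ?thesis using False good i_def by simp
    next
      case True
      have "wp (node_search \<sigma>) (\<lambda>v a g h. \<exists>m'<m. ?J m' v a (g + 1) h) v1 a1 (g1 + 5) h1"
      proof (rule wp_node_search[OF J(1) i_def[symmetric] True])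
        fix v2 a2 g2 fs
        assume 2: "env_ok v2 a2" "v2 xRound = Suc i" "\<forall>j. a2 aVisited j \<le> Suc i" "\<forall>j. a2 aSeen j \<le> Suc i"
          "g2 \<le> CC * period + 300" and fs: "distinct fs" "set fs = result (sources ! i)"
        let ?u = "sources ! i"
        let ?ps = "ps @ map (Pair ?u) fs"
        have tk: "take (Suc i) sources = take i sources @ [?u]" using True by (simp add: take_Suc_conv_app_nth)
        have less: "x < ?u" if x: "x \<in> set (take i sources)" for x
        proof -
          obtain j where "j < i" "x = sources ! j"
            using x True by (auto simp: in_set_conv_nth)
          then show ?thesis using sorted_wrt_nth_less[OF sd] True by simp
        qed
        have J': "?J (length sources - Suc i) v2 a2 (g2 + 1) (h1 @ map (Out ?u) fs)"
        proof (intro exI[of _ ?ps] conjI)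
          have "distinct (map (Pair ?u) fs)" using fs(1) by (simp add: distinct_map inj_on_def)
          moreover have "set ps \<inter> set (map (Pair ?u) fs) = {}"
          proof -
            have "(?u, y) \<notin> set ps" for y using ps(3) less[of ?u] by (auto simp: i_def)
            then show ?thesis by auto
          qed
          ultimately show "distinct ?ps" using ps(1) by simp
          have "map fst (map (Pair ?u) fs) = replicate (length fs) ?u"
            by (simp add: map_replicate_const comp_def)
          then have "sorted (map fst (map (Pair ?u) fs))" by simp
          moreover have "x \<le> ?u" if "x \<in> set (map fst ps)" for x
            using that ps(3) less[of x] by (auto simp: i_def)
          ultimately show "sorted (map fst ?ps)"
            using ps(2) by (auto simp: sorted_append)
          show "set ?ps = {(x, y). x \<in> set (take (v2 xRound) sources) \<and> y \<in> result x}"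
            using ps(3) fs(2) tk by (auto simp: 2 i_def)
        qed (use 2 True h1 in simp_all)
        have less_m: "length sources - Suc i < m" using True J(3) i_def by simp
        show "\<exists>m'<m. ?J m' v2 a2 (g2 + 1) (h1 @ map (Out ?u) fs)"
          by (rule exI[of _ "length sources - Suc i"], rule conjI[OF less_m J'])
      qed (use J i_def del in auto)
      then show ?thesis using True good i_def by (simp add: add.commute[of 5])
    qed
  qed
qed

end

section \<open>Preprocessing\<close>

abbreviation (input) xIndex :: nat where "xIndex \<equiv> 21"
abbreviation (input) xToken :: nat where "xToken \<equiv> 22"
abbreviation (input) xStart :: nat where "xStart \<equiv> 23"
abbreviation (input) xAccept :: nat where "xAccept \<equiv> 24"
abbreviation (input) xIn :: nat where "xIn \<equiv> 25"
abbreviation (input) xOut :: nat where "xOut \<equiv> 26"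
abbreviation (input) xCount :: nat where "xCount \<equiv> 27"
abbreviation (input) xMax :: nat where "xMax \<equiv> 28"
abbreviation (input) xPos2 :: nat where "xPos2 \<equiv> 29"
abbreviation (input) xLow :: nat where "xLow \<equiv> 30"
abbreviation (input) xHigh :: nat where "xHigh \<equiv> 31"

definition set_label :: "aexp \<Rightarrow> aexp \<Rightarrow> aexp \<Rightarrow> aexp \<Rightarrow> com" where
  "set_label e1 e2 e3 e4 =
     Update aStart (V xIndex) e1 ;; Update aAccept (V xIndex) e2 ;;
     Update aIn (V xIndex) e3 ;; Update aOut (V xIndex) e4"

text \<open>\<open>xOut\<close> is assigned before \<open>xIn\<close>, because on passing from the
  second factor of a pair to the first the new outgoing number is the old incoming one.\<close>

definition set_mode :: "aexp \<Rightarrow> aexp \<Rightarrow> aexp \<Rightarrow> aexp \<Rightarrow> com" where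
  "set_mode e1 e2 e3 e4 = xStart ::= e1 ;; xAccept ::= e2 ;; xOut ::= e4 ;; xIn ::= e3 ;; xCount ::= N 1"

definition parse_token :: com where
  "parse_token =
     Cond (Less (V xToken) (N 4))
       (set_label (N 0) (N 0) (N 1) (N 0) ;;
        Cond (Equal (V xToken) (N 0)) (xEps ::= N 1)
          (Cond (Equal (V xToken) (N 1)) (set_mode (N 0) (N 1) (V xIndex \<oplus> N 2) (N 0))
            (Cond (Equal (V xToken) (N 2)) (xCount ::= V xCount \<oplus> N 1)
              (set_mode (N 1) (N 1) (V xIndex \<oplus> N 2) (V xIndex \<oplus> N 2)))))
       (set_label (V xStart) (V xAccept) (V xIn) (V xOut) ;;
        Cond (Less (V xCount) (N 2))
          (Cond (Equal (V xStart) (N 0)) (set_mode (N 1) (N 0) (N 1) (V xIn))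
            (set_mode (N 1) (N 1) (N 1) (N 0)))
          (xCount ::= Bin Sub (V xCount) (N 1)))"

definition parse_loop :: com where
  "parse_loop =
     While (Less (N 0) (V xIndex))
       (xIndex ::= Bin Sub (V xIndex) (N 1) ;;
        xToken ::= Inp (N 2 \<oplus> V xIndex) ;;
        parse_token)"

text \<open>The period depends on the length of the longest successor list, which the input does not
  state.\<close>

definition max_loop :: com where
  "max_loop =
     While (Less (V xIndex) (V xStop))
       (xToken ::= Bin Sub (Inp (V xOffsets \<oplus> V xIndex \<oplus> N 1)) (Inp (V xOffsets \<oplus> V xIndex)) ;;
        Cond (Less (V xMax) (V xToken)) (xMax ::= V xToken) Skip ;;
        xIndex ::= V xIndex \<oplus> N 1)"

definition second_loop :: "nat \<Rightarrow> com" where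
  "second_loop \<sigma> =
     While (Less (V xPos2) (V xLength))
       (Cond (Equal (Arr aOut (V xPos)) (Arr aIn (V xPos2)))
          (list_bounds \<sigma> xSucc xPos2 xLow xHigh ;;
           Cond (Less (V xLow) (V xHigh)) (xFlag ::= N 1) Skip)
          Skip ;;
        xPos2 ::= V xPos2 \<oplus> N 1)"

definition first_loop :: "nat \<Rightarrow> com" where
  "first_loop \<sigma> =
     While (Less (V xNext) (V xStop))
       (xSucc ::= Inp (V xTargets \<oplus> V xNext) ;;
        xNext ::= V xNext \<oplus> N 1 ;;
        Cond (Equal (Arr aAccept (V xPos)) (N 1)) (xFlag ::= N 1) Skip ;;
        xPos2 ::= N 0 ;;
        second_loop \<sigma>)"

definition check_loop :: "nat \<Rightarrow> com" where
  "check_loop \<sigma> =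
     While (Less (V xPos) (V xLength))
       (Cond (Equal (Arr aStart (V xPos)) (N 1))
          (list_bounds \<sigma> xNode xPos xNext xStop ;; first_loop \<sigma>) Skip ;;
        xPos ::= V xPos \<oplus> N 1)"

text \<open>A starting position is accepting, or all positions that may follow it are. Two nested
  scans from each source hence replace a search, which keeps the time linear in the
  database.\<close>

definition sources_loop :: "nat \<Rightarrow> com" where
  "sources_loop \<sigma> =
     While (Less (V xNode) (V xNodes))
       (xFlag ::= V xEps ;;
        xPos ::= N 0 ;;
        check_loop \<sigma> ;;
        Cond (Equal (V xFlag) (N 1))
          (Update aGood (V xGood) (V xNode) ;; xGood ::= V xGood \<oplus> N 1) Skip ;;
        xNode ::= V xNode \<oplus> N 1)"

definition initialize :: "nat \<Rightarrow> com" where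
  "initialize \<sigma> =
     xNodes ::= Inp (N 0) ;;
     xLength ::= Inp (N 1) ;;
     xOffsets ::= N 2 \<oplus> V xLength ;;
     xTargets ::= N 3 \<oplus> V xLength \<oplus> V xNodes \<otimes> N \<sigma> ;;
     xStart ::= N 1 ;;
     xAccept ::= N 1 ;;
     xIn ::= N 1 ;;
     xIndex ::= V xLength"

definition main_com :: "nat \<Rightarrow> com" where
  "main_com \<sigma> =
     initialize \<sigma> ;;
     parse_loop ;;
     xStop ::= V xNodes \<otimes> N \<sigma> ;;
     max_loop ;;
     sources_loop \<sigma> ;;
     xPeriod ::= N 8 \<otimes> V xLength \<otimes> V xLength \<otimes> (V xMax \<oplus> N 1) ;;
     Done ;;
     enumerate \<sigma>"

section \<open>Correctness of the parsing loop\<close>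

lemma parse_invariants:
  assumes "parse b ts (m, c, e, ls) = (m', c', e', ls')"
  shows "length ls' = length ts + length ls" "c' \<le> length ts + c + 1"
proof -
  have "length ls' = length ts + length ls \<and> c' \<le> length ts + c + 1"
    using assms
  proof (induction ts arbitrary: b m' c' e' ls')
    case (Cons t ts)
    obtain m1 c1 e1 ls1 where p: "parse (Suc b) ts (m, c, e, ls) = (m1, c1, e1, ls1)"
      by (metis prod_cases4)
    from Cons.IH[OF p] Cons.prems p show ?case by (auto split: if_splits)
  qed simp
  then show "length ls' = length ts + length ls" "c' \<le> length ts + c + 1" by blast+
qed

definition mode_env :: "env \<Rightarrow> label \<Rightarrow> nat \<Rightarrow> bool \<Rightarrow> bool" where
  "mode_env v m c e \<longleftrightarrow> v xStart = starting m \<and> v xAccept = accepting m \<and> v xIn = incoming m \<and>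
     v xOut = outgoing m \<and> v xCount = c \<and> v xEps = (if e then 1 else 0)"

text \<open>Parsing runs from right to left, so the labels known at any time belong to the positions
  from \<open>i\<close> on.\<close>

definition label_arrays :: "arrays \<Rightarrow> nat \<Rightarrow> label list \<Rightarrow> bool" where
  "label_arrays a i ls \<longleftrightarrow> (\<forall>j<length ls. a aStart (i + j) = starting (ls ! j) \<and>
     a aAccept (i + j) = accepting (ls ! j) \<and> a aIn (i + j) = incoming (ls ! j) \<and> a aOut (i + j) = outgoing (ls ! j))"

lemma label_arrays_Cons:
  assumes "label_arrays a (Suc i) ls"
  shows "label_arrays (a(aStart := (a aStart)(i := starting l), aAccept := (a aAccept)(i := accepting l),
    aIn := (a aIn)(i := incoming l), aOut := (a aOut)(i := outgoing l))) i (l # ls)"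
  using assms unfolding label_arrays_def by (auto simp: less_Suc_eq_0_disj)

context machine
begin

lemma wp_parse_token:
  assumes t: "v xToken = t" and m: "mode_env v m c e" and i: "v xIndex = i"
    and ls: "label_arrays a (Suc i) ls" and B: "i + 2 \<le> B" "c + 1 \<le> B" "4 \<le> B"
    and p: "parse_step i t (m, c, e, ls) = (m', c', e', ls')"
    and cont: "\<And>v' a' g'. mode_env v' m' c' e' \<Longrightarrow> label_arrays a' i ls' \<Longrightarrow>
      \<forall>y. y \<notin> {xStart, xAccept, xIn, xOut, xCount, xEps} \<longrightarrow> v' y = v y \<Longrightarrow>
      \<forall>b. b \<notin> {aStart, aAccept, aIn, aOut} \<longrightarrow> a' b = a b \<Longrightarrow> g' \<le> g + 100 \<Longrightarrow> Q v' a' g' h"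
  shows "wp parse_token Q v a g h"
proof -
  note c = label_arrays_Cons[OF ls]
  note defs = parse_token_def set_label_def set_mode_def
  show ?thesis
  proof (cases "t < 4")
    case True
    then consider "t = 0" | "t = 1" | "t = 2" | "t = 3" by linarith
    then show ?thesis
      using t m i B p c[of no_label]
      by cases (auto simp: defs no_label_def mode_env_def snd_label_def plus_label_def split: if_splits intro!: cont)
  next
    case False
    then show ?thesis
      using t m i B p c[of m]
      by (auto simp: defs mode_env_def next_mode_def top_label_def split: if_splits intro!: cont)
  qed
qed

lemma wp_parse_loop:
  assumes ts: "\<And>i. i < length ts \<Longrightarrow> I (2 + i) = ts ! i" and i: "v xIndex = length ts"
    and m: "mode_env v top_label 0 False"
    and B: "length ts + 10 \<le> B" "length ts + 2 \<le> F"
    and p: "parse 0 ts (top_label, 0, False, []) = (m', c', e', ls')"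
    and cont: "\<And>v' a' g'. mode_env v' m' c' e' \<Longrightarrow> label_arrays a' 0 ls' \<Longrightarrow> v' xIndex = 0 \<Longrightarrow>
      \<forall>y. y \<notin> {xStart, xAccept, xIn, xOut, xCount, xEps, xIndex, xToken} \<longrightarrow> v' y = v y \<Longrightarrow>
      \<forall>b. b \<notin> {aStart, aAccept, aIn, aOut} \<longrightarrow> a' b = a b \<Longrightarrow> g' \<le> g + length ts * 150 + 10 \<Longrightarrow> Q v' a' g' h"
  shows "wp parse_loop Q v a g h"
proof -
  let ?J = "\<lambda>k v' a' g' h'. \<exists>m c e ls. v' xIndex = k \<and> k \<le> length ts \<and>
    parse k (drop k ts) (top_label, 0, False, []) = (m, c, e, ls) \<and> mode_env v' m c e \<and> label_arrays a' k ls \<and>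
    (\<forall>y. y \<notin> {xStart, xAccept, xIn, xOut, xCount, xEps, xIndex, xToken} \<longrightarrow> v' y = v y) \<and>
    (\<forall>b. b \<notin> {aStart, aAccept, aIn, aOut} \<longrightarrow> a' b = a b) \<and> g' \<le> g + (length ts - k) * 150 \<and> h' = h"
  show ?thesis
    unfolding parse_loop_def
  proof (rule wp_while[where J = ?J and m = "length ts"])
    show "?J (length ts) v a g h" 
      using i m by (intro exI[of _ top_label] exI[of _ 0] exI[of _ False] exI[of _ "[]"]) (simp add: label_arrays_def)
  next
    fix k v1 a1 g1 h1
    assume "?J k v1 a1 g1 h1"
    then obtain m c e ls where J: "v1 xIndex = k" "k \<le> length ts"
      "parse k (drop k ts) (top_label, 0, False, []) = (m, c, e, ls)" "mode_env v1 m c e" "label_arrays a1 k ls"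
      "\<forall>y. y \<notin> {xStart, xAccept, xIn, xOut, xCount, xEps, xIndex, xToken} \<longrightarrow> v1 y = v y"
      "\<forall>b. b \<notin> {aStart, aAccept, aIn, aOut} \<longrightarrow> a1 b = a b"
      "g1 \<le> g + (length ts - k) * 150" "h1 = h"
      by blast
    let ?b = "Less (N 0) (V xIndex)"
    let ?Q = "\<lambda>v a g h. \<exists>k'<k. ?J k' v a (g + 1) h"
    show "bsafe v1 a1 ?b \<and> (if bval v1 a1 ?b
      then wp (xIndex ::= Bin Sub (V xIndex) (N 1) ;; xToken ::= Inp (N 2 \<oplus> V xIndex) ;; parse_token) ?Q
        v1 a1 (g1 + bcost ?b) h1
      else Q v1 a1 (g1 + (bcost ?b + 1)) h1)"
    proof (cases k)
      case 0
      then have "Q v1 a1 g2 h" if "g2 \<le> g1 + 10" for g2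
        using J p that by (intro cont) auto
      then show ?thesis using J(1,9) 0 by simp
    next
      case (Suc i)
      have i: "i < length ts" using J(2) Suc by simp
      let ?v2 = "v1(xIndex := i, xToken := ts ! i)"
      \<comment> \<open>The count grows by at most one per token, so that increasing it respects the
        bound \<open>B\<close>.\<close>
      have "c \<le> length ts + 1" using parse_invariants(2)[OF J(3)] J(2) by simp
      then have c: "c + 1 \<le> B" using B by simp
      obtain m2 c2 e2 ls2 where st: "parse_step i (ts ! i) (m, c, e, ls) = (m2, c2, e2, ls2)"
        by (metis prod_cases4)
      have dr: "drop i ts = ts ! i # drop k ts" using i Suc by (simp add: Cons_nth_drop_Suc)
      have p2: "parse i (drop i ts) (top_label, 0, False, []) = (m2, c2, e2, ls2)"
        using J(3) st Suc by (simp add: dr)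
      have "wp parse_token ?Q ?v2 a1 g2 h1" if g2: "g2 \<le> g1 + 30" for g2
      proof (rule wp_parse_token[OF _ _ _ J(5)[unfolded Suc] _ c _ st])
        fix v3 a3 g3
        assume 3: "mode_env v3 m2 c2 e2" "label_arrays a3 i ls2"
          "\<forall>y. y \<notin> {xStart, xAccept, xIn, xOut, xCount, xEps} \<longrightarrow> v3 y = ?v2 y"
          "\<forall>b. b \<notin> {aStart, aAccept, aIn, aOut} \<longrightarrow> a3 b = a1 b" "g3 \<le> g2 + 100"
        have g: "(length ts - i) * 150 = (length ts - k) * 150 + 150"
          using i Suc by (simp add: Suc_diff_Suc[symmetric])
        have idx: "v3 xIndex = i" using 3(3) by simp
        have fr: "y \<notin> {xStart, xAccept, xIn, xOut, xCount, xEps, xIndex, xToken} \<longrightarrow> v3 y = v y" for y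
          using 3(3) J(6) by simp
        have fa: "b \<notin> {aStart, aAccept, aIn, aOut} \<longrightarrow> a3 b = a b" for b
          using 3(4) J(7) by simp
        have "?J i v3 a3 (g3 + 1) h1"
          using idx i p2 3(1,2) fr fa 3(5) J(8,9) g g2 by auto
        then show "?Q v3 a3 g3 h1" using Suc by blast
      qed (use J(4) B i in \<open>simp_all add: mode_env_def\<close>)
      then show ?thesis using J(1) Suc i B ts by simp
    qed
  qed
qed

end

section \<open>Deciding which sources have an answer\<close>

context search
begin

definition hit :: "nat \<Rightarrow> nat \<Rightarrow> bool" where
  "hit p x \<longleftrightarrow> acc p \<or> (\<exists>q<n. outgoing (lab p) = incoming (lab q) \<and> lo x q < hi x q)"

text \<open>If the right-hand side fails, a second step is impossible, since it would start from a
  hit; all reached states are then initial or one step away and not accepting. Conversely, a hit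
  leads to an accepting state at once or after one more step.\<close>

lemma result_nonempty_iff:
  assumes "u < nv"
  shows "result u \<noteq> {} \<longleftrightarrow>
    eps \<or> (\<exists>p<n. starting (lab p) = 1 \<and> (\<exists>j\<in>{lo u p..<hi u p}. hit p (tgt j)))" (is "_ \<longleftrightarrow> ?R")
proof
  assume "result u \<noteq> {}"
  show ?R
  proof (rule ccontr)
    assume R: "\<not> ?R"
    have "p = n \<or> (starting (lab p) = 1 \<and> edge u p x)" if "reach u x p" for x p
      using that
    proof (induction rule: reach.induct)
      case (reach_step v s p x)
      show ?case
      proof (cases "s = n")
        case True
        then have "v = u" using reach_cases[OF reach_step.hyps(1) assms] by simp
        then show ?thesis using reach_step.hyps True by (simp add: follows_def)
      next
        case False
        then have "s < n" "starting (lab s) = 1" "edge u s v"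
          using reach_step.IH reach_cases[OF reach_step.hyps(1) assms] by auto
        moreover have "hit s v"
          using reach_step.hyps(2-4) False unfolding hit_def follows_def edge_def by auto
        ultimately show ?thesis using R by (auto simp: edge_def)
      qed
    qed simp
    then have "\<not> acc p" if "reach u x p" "p < n" for x p
      using that R by (fastforce simp: edge_def hit_def)
    then show False using \<open>result u \<noteq> {}\<close> R by (auto simp: result_def)
  qed
next
  assume ?R
  then consider eps | p j where "p < n" "starting (lab p) = 1" "j \<in> {lo u p..<hi u p}" "hit p (tgt j)"
    by blast
  then show "result u \<noteq> {}"
  proof cases
    case 1
    then have "u \<in> result u" unfolding result_def by simp
    then show ?thesis by blast
  next
    case 2
    have r: "reach u (tgt j) p"
      by (rule reach_step[OF reach_init 2(1)]) (use 2 in \<open>auto simp: follows_def edge_def\<close>)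
    show ?thesis
    proof (cases "acc p")
      case True
      then show ?thesis using r 2(1) by (auto simp: result_def)
    next
      case False
      then obtain q where q: "q < n" "outgoing (lab p) = incoming (lab q)" "lo (tgt j) q < hi (tgt j) q"
        using 2(4) by (auto simp: hit_def)
      then have "reach u (tgt (lo (tgt j) q)) q"
        using 2(1) by (intro reach_step[OF r]) (auto simp: follows_def edge_def)
      moreover have "acc q" using lab_acc[OF 2(1) q(1,2)] by (simp add: acc_def)
      ultimately show ?thesis using q(1) by (auto simp: result_def)
    qed
  qed
qed

lemma wp_max_loop:
  assumes v: "v xOffsets = 2 + n" "v xStop = nv * \<sigma>" "v xIndex = 0" "v xMax = 0"
    and cont: "\<And>v' g'. v' xMax = Max (insert 0 ((\<lambda>i. off (Suc i) - off i) ` {..<nv * \<sigma>})) \<Longrightarrow>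
      \<forall>y. y \<notin> {xIndex, xToken, xMax} \<longrightarrow> v' y = v y \<Longrightarrow> g' \<le> g + nv * \<sigma> * 60 + 10 \<Longrightarrow> Q v' a g' h"
  shows "wp max_loop Q v a g h"
proof -
  let ?d = "\<lambda>i. off (Suc i) - off i"
  let ?J = "\<lambda>m v' a' g' h'. \<exists>i\<le>nv * \<sigma>. v' xIndex = i \<and> v' xMax = Max (insert 0 (?d ` {..<i})) \<and>
    (\<forall>y. y \<notin> {xIndex, xToken, xMax} \<longrightarrow> v' y = v y) \<and> m = nv * \<sigma> - i \<and>
    g' \<le> g + i * 60 \<and> a' = a \<and> h' = h"
  show ?thesis
    unfolding max_loop_def
  proof (rule wp_while[where J = ?J and m = "nv * \<sigma>"])
    show "?J (nv * \<sigma>) v a g h" using v by (intro exI[of _ 0]) simp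
  next
    fix m v1 a1 g1 h1
    assume "?J m v1 a1 g1 h1"
    then obtain i where J: "i \<le> nv * \<sigma>" "v1 xIndex = i" "v1 xMax = Max (insert 0 (?d ` {..<i}))"
      "\<forall>y. y \<notin> {xIndex, xToken, xMax} \<longrightarrow> v1 y = v y" "m = nv * \<sigma> - i" "g1 \<le> g + i * 60" "a1 = a" "h1 = h"
      by blast
    have v1: "v1 xOffsets = 2 + n" "v1 xStop = nv * \<sigma>" using J(4) v by simp_all
    let ?b = "Less (V xIndex) (V xStop)"
    let ?Q = "\<lambda>v a g h. \<exists>m'<m. ?J m' v a (g + 1) h"
    show "bsafe v1 a1 ?b \<and> (if bval v1 a1 ?b
      then wp (xToken ::= Bin Sub (Inp (V xOffsets \<oplus> V xIndex \<oplus> N 1)) (Inp (V xOffsets \<oplus> V xIndex)) ;;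
        Cond (Less (V xMax) (V xToken)) (xMax ::= V xToken) Skip ;; xIndex ::= V xIndex \<oplus> N 1) ?Q
        v1 a1 (g1 + bcost ?b) h1
      else Q v1 a1 (g1 + (bcost ?b + 1)) h1)"
    proof (cases "i < nv * \<sigma>")
      case False
      then have i: "i = nv * \<sigma>" using J(1) by simp
      have "Q v1 a g2 h" if "g2 \<le> g1 + 10" for g2
        using J that unfolding i by (intro cont) auto
      then show ?thesis using J(2,7,8) v1 i by simp
    next
      case True
      have I: "I (2 + n + i) = off i" "I (2 + n + i + 1) = off (Suc i)"
        using input_off[of i] input_off[of "Suc i"] True by simp_all
      have B: "2 + n + i + 1 < F" "F \<le> B" using True F_eq B_ge by auto
      have mx: "Max (insert 0 (?d ` {..<Suc i})) = max (?d i) (Max (insert 0 (?d ` {..<i})))"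
      proof -
        have "insert 0 (?d ` {..<Suc i}) = insert (?d i) (insert 0 (?d ` {..<i}))"
          by (auto simp: lessThan_Suc)
        then show ?thesis by (simp only:) (rule Max_insert; simp)
      qed
      have less: "nv * \<sigma> - Suc i < m" using True J(5) by simp
      define R where "R = ?Q"
      have step: "R v2 a g2 h" if "g2 \<le> g1 + 50" "v2 xIndex = Suc i" "v2 xMax = max (?d i) (v1 xMax)"
        "\<forall>y. y \<notin> {xIndex, xToken, xMax} \<longrightarrow> v2 y = v1 y" for v2 g2
        unfolding R_def
        by (rule exI[of _ "nv * \<sigma> - Suc i"], rule conjI[OF less], rule exI[of _ "Suc i"])
          (use True J that mx in auto)
      show ?thesis
        unfolding R_def[symmetric] using True J(2,7,8) v1 I B step by (simp add: add.commute)
    qed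
  qed
qed

lemma wp_second_loop:
  assumes env: "env_base v a" and v: "v xPos = p" "p < n" "v xSucc = x" "x < nv" "v xPos2 = 0"
    "v xFlag = (if b then 1 else 0)"
    and cont: "\<And>v' g'. v' xFlag = (if b \<or> (\<exists>q<n. outgoing (lab p) = incoming (lab q) \<and> lo x q < hi x q) then 1 else 0) \<Longrightarrow>
      \<forall>y. y \<notin> {xPos2, xLow, xHigh, xFlag} \<longrightarrow> v' y = v y \<Longrightarrow> g' \<le> g + n * 120 + 10 \<Longrightarrow> Q v' a g' h"
  shows "wp (second_loop \<sigma>) Q v a g h"
proof -
  let ?P = "\<lambda>k. \<exists>q<k. outgoing (lab p) = incoming (lab q) \<and> lo x q < hi x q"
  let ?J = "\<lambda>m v' a' g' h'. \<exists>k\<le>n. v' xPos2 = k \<and> v' xFlag = (if b \<or> ?P k then 1 else 0) \<and>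
    (\<forall>y. y \<notin> {xPos2, xLow, xHigh, xFlag} \<longrightarrow> v' y = v y) \<and> m = n - k \<and> g' \<le> g + k * 120 \<and> a' = a \<and> h' = h"
  show ?thesis
    unfolding second_loop_def
  proof (rule wp_while[where J = ?J and m = n])
    show "?J n v a g h" using v by (intro exI[of _ 0]) simp
  next
    fix m v1 a1 g1 h1
    assume "?J m v1 a1 g1 h1"
    then obtain k where J: "k \<le> n" "v1 xPos2 = k" "v1 xFlag = (if b \<or> ?P k then 1 else 0)"
      "\<forall>y. y \<notin> {xPos2, xLow, xHigh, xFlag} \<longrightarrow> v1 y = v y" "m = n - k" "g1 \<le> g + k * 120" "a1 = a" "h1 = h"
      by blast
    have env1: "env_base v1 a" using env J(4) by (simp add: env_base_def)
    have v1: "v1 xLength = n" "v1 xPos = p" "v1 xSucc = x" using env J(4) v by (simp_all add: env_base_def)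
    let ?b = "Less (V xPos2) (V xLength)"
    let ?Q = "\<lambda>v a g h. \<exists>m'<m. ?J m' v a (g + 1) h"
    let ?c2 = "Cond (Less (V xLow) (V xHigh)) (xFlag ::= N 1) Skip"
    let ?body = "Cond (Equal (Arr aOut (V xPos)) (Arr aIn (V xPos2)))
      (list_bounds \<sigma> xSucc xPos2 xLow xHigh ;; ?c2) Skip ;; xPos2 ::= V xPos2 \<oplus> N 1"
    show "bsafe v1 a1 ?b \<and> (if bval v1 a1 ?b then wp ?body ?Q v1 a1 (g1 + bcost ?b) h1
      else Q v1 a1 (g1 + (bcost ?b + 1)) h1)"
    proof (cases "k < n")
      case False
      then have k: "k = n" using J(1) by simp
      have "Q v1 a g2 h" if "g2 \<le> g1 + 10" for g2
        using J that unfolding k by (intro cont) auto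
      then show ?thesis using J(2,7,8) v1 k by simp
    next
      case True
      have lab: "a aOut p = outgoing (lab p)" "a aIn k = incoming (lab k)"
        using env v(2) True by (auto simp: env_base_def)
      have kB: "k + 1 \<le> B" "1 \<le> B" using True B_ge(2) by auto
      have less: "n - Suc k < m" using True J(5) by simp
      have P: "?P (Suc k) \<longleftrightarrow> ?P k \<or> (outgoing (lab p) = incoming (lab k) \<and> lo x k < hi x k)"
        by (auto simp: less_Suc_eq)
      define R where "R = ?Q"
      have step: "R v2 a g2 h"
        if "g2 \<le> g1 + 110" "v2 xPos2 = Suc k" "v2 xFlag = (if b \<or> ?P (Suc k) then 1 else 0)"
          "\<forall>y. y \<notin> {xPos2, xLow, xHigh, xFlag} \<longrightarrow> v2 y = v1 y" for v2 g2
        unfolding R_def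
        by (rule exI[of _ "n - Suc k"], rule conjI[OF less], rule exI[of _ "Suc k"])
          (use True J that in auto)
      show ?thesis
        unfolding R_def[symmetric]
      proof (cases "outgoing (lab p) = incoming (lab k)")
        case False
        have "R (v1(xPos2 := Suc k)) a g2 h" if "g2 \<le> g1 + 100" for g2
          by (rule step) (use that J(3) P False in auto)
        then show "bsafe v1 a1 ?b \<and> (if bval v1 a1 ?b then wp ?body R v1 a1 (g1 + bcost ?b) h1
            else Q v1 a1 (g1 + (bcost ?b + 1)) h1)"
          using False True J(2,7,8) v1 lab kB by simp
      next
        case eq: True
        have "wp (list_bounds \<sigma> xSucc xPos2 xLow xHigh) (wp ?c2 (wp (xPos2 ::= V xPos2 \<oplus> N 1) R)) v1 a g2 h"
          if g2: "g2 \<le> g1 + 30" for g2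
        proof (rule wp_list_bounds[OF env1 v1(3) v(4) J(2) True])
          fix g3 assume g3: "g3 \<le> g2 + 50"
          let ?v2 = "v1(xLow := lo x k, xHigh := hi x k)"
          show "wp ?c2 (wp (xPos2 ::= V xPos2 \<oplus> N 1) R) ?v2 a g3 h"
          proof (cases "lo x k < hi x k")
            case less: True
            have "R (?v2(xFlag := 1, xPos2 := Suc k)) a g4 h" if "g4 \<le> g3 + 20" for g4
              by (rule step) (use that g2 g3 less eq P in auto)
            then show ?thesis using less J(2) kB by simp
          next
            case nless: False
            have "R (?v2(xPos2 := Suc k)) a g4 h" if "g4 \<le> g3 + 20" for g4
              by (rule step) (use that g2 g3 nless J(3) P in auto)
            then show ?thesis using nless J(2) kB by simp
          qed
        qed simp_all
        then show "bsafe v1 a1 ?b \<and> (if bval v1 a1 ?b then wp ?body R v1 a1 (g1 + bcost ?b) h1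
            else Q v1 a1 (g1 + (bcost ?b + 1)) h1)"
          using eq True J(2,7,8) v1 lab by simp
      qed
    qed
  qed
qed

lemma wp_first_loop:
  assumes env: "env_base v a" and v: "v xPos = p" "p < n" "u < nv" "v xNext = lo u p" "v xStop = hi u p"
    "v xFlag = (if b then 1 else 0)"
    and cont: "\<And>v' g'. v' xFlag = (if b \<or> (\<exists>j\<in>{lo u p..<hi u p}. hit p (tgt j)) then 1 else 0) \<Longrightarrow>
      \<forall>y. y \<notin> {xNext, xSucc, xPos2, xLow, xHigh, xFlag} \<longrightarrow> v' y = v y \<Longrightarrow>
      g' \<le> g + (hi u p - lo u p) * (n * 120 + 100) + 10 \<Longrightarrow> Q v' a g' h"
  shows "wp (first_loop \<sigma>) Q v a g h"
proof -
  let ?N = "n * 120 + 100"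
  let ?P = "\<lambda>k. \<exists>j\<in>{lo u p..<k}. hit p (tgt j)"
  let ?J = "\<lambda>m v' a' g' h'. \<exists>k. lo u p \<le> k \<and> k \<le> hi u p \<and> v' xNext = k \<and>
    v' xFlag = (if b \<or> ?P k then 1 else 0) \<and>
    (\<forall>y. y \<notin> {xNext, xSucc, xPos2, xLow, xHigh, xFlag} \<longrightarrow> v' y = v y) \<and> m = hi u p - k \<and>
    g' \<le> g + (k - lo u p) * ?N \<and> a' = a \<and> h' = h"
  note lh = lo_hi(1,2)[OF v(3,2)]
  show ?thesis
    unfolding first_loop_def
  proof (rule wp_while[where J = ?J and m = "hi u p - lo u p"])
    show "?J (hi u p - lo u p) v a g h" using v lh by (intro exI[of _ "lo u p"]) simp
  next
    fix m v1 a1 g1 h1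
    assume "?J m v1 a1 g1 h1"
    then obtain k where J: "lo u p \<le> k" "k \<le> hi u p" "v1 xNext = k"
      "v1 xFlag = (if b \<or> ?P k then 1 else 0)"
      "\<forall>y. y \<notin> {xNext, xSucc, xPos2, xLow, xHigh, xFlag} \<longrightarrow> v1 y = v y" "m = hi u p - k"
      "g1 \<le> g + (k - lo u p) * ?N" "a1 = a" "h1 = h"
      by blast
    have v1: "v1 xStop = hi u p" "v1 xPos = p" "v1 xTargets = 3 + n + nv * \<sigma>"
      using env J(5) v by (simp_all add: env_base_def)
    have env1: "env_base v1 a" using env J(5) by (simp add: env_base_def)
    let ?b = "Less (V xNext) (V xStop)"
    let ?Q = "\<lambda>v a g h. \<exists>m'<m. ?J m' v a (g + 1) h"
    let ?body = "xSucc ::= Inp (V xTargets \<oplus> V xNext) ;; xNext ::= V xNext \<oplus> N 1 ;;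
        Cond (Equal (Arr aAccept (V xPos)) (N 1)) (xFlag ::= N 1) Skip ;; xPos2 ::= N 0 ;; second_loop \<sigma>"
    show "bsafe v1 a1 ?b \<and> (if bval v1 a1 ?b then wp ?body ?Q v1 a1 (g1 + bcost ?b) h1
      else Q v1 a1 (g1 + (bcost ?b + 1)) h1)"
    proof (cases "k < hi u p")
      case False
      then have k: "k = hi u p" using J(2) by simp
      have "Q v1 a g2 h" if "g2 \<le> g1 + 10" for g2
        using J that unfolding k by (intro cont) auto
      then show ?thesis using J(3,8,9) v1 k by simp
    next
      case True
      let ?x = "tgt k"
      have kt: "k < off (nv * \<sigma>)" using True lh(2) by simp
      have I: "I (3 + n + nv * \<sigma> + k) = ?x" by (rule input_tgt[OF kt])
      have x: "?x < nv" by (rule tgt_less[OF kt])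
      have B: "3 + n + nv * \<sigma> + k < F" "F + 10 \<le> B" using kt B_ge(1) by (simp_all add: F_eq)
      have ac: "a aAccept p = 1 \<longleftrightarrow> acc p" using env v(2) by (simp add: env_base_def acc_def)
      have less: "hi u p - Suc k < m" using True J(6) by simp
      have P: "?P (Suc k) \<longleftrightarrow> ?P k \<or> hit p ?x"
        using J(1) by (auto simp: less_Suc_eq)
      define R where "R = ?Q"
      have R: "wp (second_loop \<sigma>) R v2 a g2 h"
        if v2: "v2 xPos2 = 0" "v2 xSucc = ?x" "v2 xNext = Suc k" "v2 xFlag = (if b \<or> ?P k \<or> acc p then 1 else 0)"
          "\<forall>y. y \<notin> {xNext, xSucc, xPos2, xLow, xHigh, xFlag} \<longrightarrow> v2 y = v1 y"
          and g2: "g2 \<le> g1 + 80" for v2 g2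
      proof (rule wp_second_loop[OF _ _ v(2) _ x])
        show "env_base v2 a" using env1 v2(5) by (simp add: env_base_def)
        show "v2 xPos = p" using v2(5) v1 by simp
        show "v2 xFlag = (if b \<or> ?P k \<or> acc p then 1 else 0)" by (rule v2(4))
        fix v3 g3
        assume 3: "v3 xFlag = (if (b \<or> ?P k \<or> acc p) \<or>
            (\<exists>q<n. outgoing (lab p) = incoming (lab q) \<and> lo ?x q < hi ?x q) then 1 else 0)"
          "\<forall>y. y \<notin> {xPos2, xLow, xHigh, xFlag} \<longrightarrow> v3 y = v2 y" "g3 \<le> g2 + n * 120 + 10"
        have "v3 xFlag = (if b \<or> ?P (Suc k) then 1 else 0)"
          using 3(1) unfolding P hit_def[of p ?x] by (simp only: disj_assoc)
        moreover have "v3 xNext = Suc k" using 3(2) v2(3) by simp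
        moreover have "\<forall>y. y \<notin> {xNext, xSucc, xPos2, xLow, xHigh, xFlag} \<longrightarrow> v3 y = v y"
          using 3(2) v2(5) J(5) by simp
        moreover have "g3 + 1 \<le> g + (Suc k - lo u p) * ?N"
          using 3(3) g2 J(1,7) by (simp add: Suc_diff_le)
        ultimately show "R v3 a g3 h"
          unfolding R_def using True J(1)
          by (intro exI[of _ "hi u p - Suc k"] conjI[OF less] exI[of _ "Suc k"]) simp
      qed (use v2 in simp_all)
      show ?thesis
        unfolding R_def[symmetric]
        using True J(3,4,8,9) v1 I B ac R by (cases "acc p") simp_all
    qed
  qed
qed

text \<open>The difference of offsets is the total length of all lists of \<open>u\<close>. It
  bounds the list of each position, and it telescopes when the times are summed over the
  sources.\<close>

lemma wp_check_loop:
  assumes env: "env_base v a" and v: "v xPos = 0" "v xNode = u" "u < nv" "v xFlag = (if eps then 1 else 0)"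
    and cont: "\<And>v' g'. v' xFlag = (if result u \<noteq> {} then 1 else 0) \<Longrightarrow>
      \<forall>y. y \<notin> {xPos, xNext, xStop, xSucc, xPos2, xLow, xHigh, xFlag} \<longrightarrow> v' y = v y \<Longrightarrow>
      g' \<le> g + n * ((off (Suc u * \<sigma>) - off (u * \<sigma>)) * (n * 120 + 100) + 120) + 10 \<Longrightarrow> Q v' a g' h"
  shows "wp (check_loop \<sigma>) Q v a g h"
proof -
  let ?A = "off (Suc u * \<sigma>) - off (u * \<sigma>)"
  let ?N = "?A * (n * 120 + 100) + 120"
  let ?P = "\<lambda>k. \<exists>p<k. starting (lab p) = 1 \<and> (\<exists>j\<in>{lo u p..<hi u p}. hit p (tgt j))"
  let ?J = "\<lambda>m v' a' g' h'. \<exists>k\<le>n. v' xPos = k \<and> v' xFlag = (if eps \<or> ?P k then 1 else 0) \<and>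
    (\<forall>y. y \<notin> {xPos, xNext, xStop, xSucc, xPos2, xLow, xHigh, xFlag} \<longrightarrow> v' y = v y) \<and> m = n - k \<and>
    g' \<le> g + k * ?N \<and> a' = a \<and> h' = h"
  have A: "hi u p - lo u p \<le> ?A" if "p < n" for p
  proof -
    have "Suc u * \<sigma> \<le> nv * \<sigma>" using v(3) by (intro mult_le_mono1) simp
    moreover have "Suc (u * \<sigma> + lt p) \<le> Suc u * \<sigma>" using lt_less[OF that] by simp
    moreover have "u * \<sigma> + lt p \<le> nv * \<sigma>" using index_less[OF v(3) that] by simp
    ultimately have "hi u p \<le> off (Suc u * \<sigma>)" "off (u * \<sigma>) \<le> lo u p"
      unfolding hi_def lo_def by (auto intro!: off_mono)
    then show ?thesis by simp
  qed
  show ?thesis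
    unfolding check_loop_def
  proof (rule wp_while[where J = ?J and m = n])
    show "?J n v a g h" using v by (intro exI[of _ 0]) simp
  next
    fix m v1 a1 g1 h1
    assume "?J m v1 a1 g1 h1"
    then obtain k where J: "k \<le> n" "v1 xPos = k" "v1 xFlag = (if eps \<or> ?P k then 1 else 0)"
      "\<forall>y. y \<notin> {xPos, xNext, xStop, xSucc, xPos2, xLow, xHigh, xFlag} \<longrightarrow> v1 y = v y" "m = n - k"
      "g1 \<le> g + k * ?N" "a1 = a" "h1 = h"
      by blast
    have v1: "v1 xLength = n" "v1 xNode = u" using env J(4) v by (simp_all add: env_base_def)
    have env1: "env_base v1 a" using env J(4) by (simp add: env_base_def)
    let ?b = "Less (V xPos) (V xLength)"
    let ?Q = "\<lambda>v a g h. \<exists>m'<m. ?J m' v a (g + 1) h"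
    let ?body = "Cond (Equal (Arr aStart (V xPos)) (N 1))
          (list_bounds \<sigma> xNode xPos xNext xStop ;; first_loop \<sigma>) Skip ;; xPos ::= V xPos \<oplus> N 1"
    show "bsafe v1 a1 ?b \<and> (if bval v1 a1 ?b then wp ?body ?Q v1 a1 (g1 + bcost ?b) h1
      else Q v1 a1 (g1 + (bcost ?b + 1)) h1)"
    proof (cases "k < n")
      case False
      then have k: "k = n" using J(1) by simp
      have "v1 xFlag = (if result u \<noteq> {} then 1 else 0)"
        using J(3) unfolding k result_nonempty_iff[OF v(3)] .
      then have "Q v1 a g2 h" if "g2 \<le> g1 + 10" for g2
        using J that k by (intro cont) auto
      then show ?thesis using J(2,7,8) v1 k by simp
    next
      case True
      have kB: "k + 1 \<le> B" "1 \<le> B" using True B_ge(2) by auto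
      have less: "n - Suc k < m" using True J(5) by simp
      have st: "a aStart k = starting (lab k)" using env True by (simp add: env_base_def)
      have P: "?P (Suc k) \<longleftrightarrow> ?P k \<or> (starting (lab k) = 1 \<and> (\<exists>j\<in>{lo u k..<hi u k}. hit k (tgt j)))"
        by (auto simp: less_Suc_eq)
      define R where "R = ?Q"
      have step: "R v2 a g2 h"
        if "g2 \<le> g1 + ?A * (n * 120 + 100) + 110" "v2 xPos = Suc k" "v2 xFlag = (if eps \<or> ?P (Suc k) then 1 else 0)"
          "\<forall>y. y \<notin> {xPos, xNext, xStop, xSucc, xPos2, xLow, xHigh, xFlag} \<longrightarrow> v2 y = v1 y" for v2 g2
      proof -
        have g: "Suc k * ?N = k * ?N + ?N" by simp
        have "g2 + 1 \<le> g + Suc k * ?N" unfolding g using that(1) J(6) by linarith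
        then show ?thesis
          unfolding R_def using True J(4) that(2-4)
          by (intro exI[of _ "n - Suc k"] conjI[OF less] exI[of _ "Suc k"]) simp
      qed
      show ?thesis
        unfolding R_def[symmetric]
      proof (cases "starting (lab k) = 1")
        case False
        have "R (v1(xPos := Suc k)) a g2 h" if "g2 \<le> g1 + 100" for g2
          by (rule step) (use that J(3) P False in auto)
        then show "bsafe v1 a1 ?b \<and> (if bval v1 a1 ?b then wp ?body R v1 a1 (g1 + bcost ?b) h1
            else Q v1 a1 (g1 + (bcost ?b + 1)) h1)"
          using False True J(2,7,8) v1 st kB by simp
      next
        case eq: True
        have "wp (list_bounds \<sigma> xNode xPos xNext xStop) (wp (first_loop \<sigma>) (wp (xPos ::= V xPos \<oplus> N 1) R)) v1 a g2 h"
          if g2: "g2 \<le> g1 + 30" for g2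
        proof (rule wp_list_bounds[OF env1 v1(2) v(3) J(2) True])
          fix g3 assume g3: "g3 \<le> g2 + 50"
          let ?v2 = "v1(xNext := lo u k, xStop := hi u k)"
          show "wp (first_loop \<sigma>) (wp (xPos ::= V xPos \<oplus> N 1) R) ?v2 a g3 h"
          proof (rule wp_first_loop[OF _ _ True v(3)])
            show "?v2 xFlag = (if eps \<or> ?P k then 1 else 0)" using J(3) by simp
            fix v4 g4
            assume 4: "v4 xFlag = (if (eps \<or> ?P k) \<or> (\<exists>j\<in>{lo u k..<hi u k}. hit k (tgt j)) then 1 else 0)"
              "\<forall>y. y \<notin> {xNext, xSucc, xPos2, xLow, xHigh, xFlag} \<longrightarrow> v4 y = ?v2 y"
              "g4 \<le> g3 + (hi u k - lo u k) * (n * 120 + 100) + 10"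
            have fl: "v4 xFlag = (if eps \<or> ?P (Suc k) then 1 else 0)"
              using 4(1) eq unfolding P by (simp only: disj_assoc simp_thms)
            have "(hi u k - lo u k) * (n * 120 + 100) \<le> ?A * (n * 120 + 100)"
              by (rule mult_le_mono1[OF A[OF True]])
            then have g4: "g4 + 20 \<le> g1 + ?A * (n * 120 + 100) + 110" using 4(3) g2 g3 by linarith
            have "R (v4(xPos := Suc k)) a g5 h" if "g5 \<le> g4 + 20" for g5
              by (rule step) (use that g4 fl 4(2) in auto)
            moreover have "v4 xPos = k" using 4(2) J(2) by simp
            ultimately show "wp (xPos ::= V xPos \<oplus> N 1) R v4 a g4 h" using kB by simp
          qed (use env1 J(2) in simp_all)
        qed simp_all
        then show "bsafe v1 a1 ?b \<and> (if bval v1 a1 ?b then wp ?body R v1 a1 (g1 + bcost ?b) h1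
            else Q v1 a1 (g1 + (bcost ?b + 1)) h1)"
          using eq True J(2,7,8) v1 st kB by simp
      qed
    qed
  qed
qed

text \<open>The time is charged to the nodes handled so far and to
  \<open>off (k * \<sigma>)\<close>, the total length of their lists, instead of nodes times
  degree.\<close>

lemma wp_sources_loop:
  assumes env: "env_base v a" and v: "v xNode = 0" "v xGood = 0"
    and cont: "\<And>v' a' g'. env_base v' a' \<Longrightarrow> v' xGood = length sources \<Longrightarrow>
      \<forall>i<length sources. a' aGood i = sources ! i \<Longrightarrow> v' xMax = v xMax \<Longrightarrow> v' xRound = v xRound \<Longrightarrow>
      \<forall>b. b \<noteq> aGood \<longrightarrow> a' b = a b \<Longrightarrow>
      g' \<le> g + nv * (n * 120 + 100) + off (nv * \<sigma>) * (n * (n * 120 + 100)) + 10 \<Longrightarrow> Q v' a' g' h"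
  shows "wp (sources_loop \<sigma>) Q v a g h"
proof -
  let ?S = "\<lambda>k. filter (\<lambda>u. result u \<noteq> {}) [0..<k]"
  let ?J = "\<lambda>m v' a' g' h'. \<exists>k\<le>nv. v' xNode = k \<and> env_base v' a' \<and> v' xGood = length (?S k) \<and>
    (\<forall>i<length (?S k). a' aGood i = ?S k ! i) \<and> v' xMax = v xMax \<and> v' xRound = v xRound \<and>
    (\<forall>b. b \<noteq> aGood \<longrightarrow> a' b = a b) \<and> m = nv - k \<and>
    g' \<le> g + k * (n * 120 + 100) + off (k * \<sigma>) * (n * (n * 120 + 100)) \<and> h' = h"
  show ?thesis
    unfolding sources_loop_def
  proof (rule wp_while[where J = ?J and m = nv])
    show "?J nv v a g h" using v env by (intro exI[of _ 0]) simp
  next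
    fix m v1 a1 g1 h1
    assume "?J m v1 a1 g1 h1"
    then obtain k where J: "k \<le> nv" "v1 xNode = k" "env_base v1 a1" "v1 xGood = length (?S k)"
      "\<forall>i<length (?S k). a1 aGood i = ?S k ! i" "v1 xMax = v xMax" "v1 xRound = v xRound"
      "\<forall>b. b \<noteq> aGood \<longrightarrow> a1 b = a b" "m = nv - k"
      "g1 \<le> g + k * (n * 120 + 100) + off (k * \<sigma>) * (n * (n * 120 + 100))" "h1 = h"
      by blast
    have v1: "v1 xNodes = nv" "v1 xEps = (if eps then 1 else 0)" using J(3) by (simp_all add: env_base_def)
    have len: "length (?S k) \<le> k" using length_filter_le[of _ "[0..<k]"] by simp
    let ?b = "Less (V xNode) (V xNodes)"
    let ?Q = "\<lambda>v a g h. \<exists>m'<m. ?J m' v a (g + 1) h"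
    let ?c2 = "Cond (Equal (V xFlag) (N 1)) (Update aGood (V xGood) (V xNode) ;; xGood ::= V xGood \<oplus> N 1) Skip"
    let ?body = "xFlag ::= V xEps ;; xPos ::= N 0 ;; check_loop \<sigma> ;; ?c2 ;; xNode ::= V xNode \<oplus> N 1"
    show "bsafe v1 a1 ?b \<and> (if bval v1 a1 ?b then wp ?body ?Q v1 a1 (g1 + bcost ?b) h1
      else Q v1 a1 (g1 + (bcost ?b + 1)) h1)"
    proof (cases "k < nv")
      case False
      then have k: "k = nv" using J(1) by simp
      have "Q v1 a1 g2 h" if "g2 \<le> g1 + 10" for g2
        using J that unfolding k by (intro cont) (auto simp: sources_def)
      then show ?thesis using J(2,11) v1 k by simp
    next
      case True
      have kB: "k + 10 \<le> B" using True B_ge(2) by simp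
      have less: "nv - Suc k < m" using True J(9) by simp
      let ?A = "off (Suc k * \<sigma>) - off (k * \<sigma>)"
      have "Suc k * \<sigma> \<le> nv * \<sigma>" using True by (intro mult_le_mono1) simp
      then have "off (k * \<sigma>) \<le> off (Suc k * \<sigma>)" by (intro off_mono) simp_all
      then have A: "off (Suc k * \<sigma>) = off (k * \<sigma>) + ?A" by simp
      define W where "W = n * (n * 120 + 100)"
      have cost: "g1 + (n * (?A * (n * 120 + 100) + 120) + 100) \<le>
          g + Suc k * (n * 120 + 100) + off (Suc k * \<sigma>) * W"
      proof -
        have "n * (?A * (n * 120 + 100) + 120) = ?A * W + n * 120"
          by (simp only: W_def add_mult_distrib2 mult.left_commute)
        moreover have "off (Suc k * \<sigma>) * W = off (k * \<sigma>) * W + ?A * W"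
          by (subst A) (simp only: add_mult_distrib)
        moreover have "Suc k * (n * 120 + 100) = k * (n * 120 + 100) + n * 120 + 100" by simp
        ultimately show ?thesis using J(10) unfolding W_def[symmetric] by linarith
      qed
      define R where "R = ?Q"
      have R: "R v2 a2 g2 h"
        if "v2 xNode = Suc k" "env_base v2 a2" "v2 xGood = length (?S (Suc k))"
          "\<forall>i<length (?S (Suc k)). a2 aGood i = ?S (Suc k) ! i" "v2 xMax = v xMax" "v2 xRound = v xRound"
          "\<forall>b. b \<noteq> aGood \<longrightarrow> a2 b = a b"
          "g2 + 1 \<le> g1 + (n * (?A * (n * 120 + 100) + 120) + 100)" for v2 a2 g2
        unfolding R_def using True that(1-7) order_trans[OF that(8) cost] unfolding W_def
        by (intro exI[of _ "nv - Suc k"] conjI[OF less] exI[of _ "Suc k"]) simp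
      define f0 :: nat where "f0 = (if eps then 1 else 0)"
      let ?v2 = "v1(xFlag := f0, xPos := 0)"
      have "wp (check_loop \<sigma>) (wp (?c2 ;; xNode ::= V xNode \<oplus> N 1) R) ?v2 a1 g2 h" if g2: "g2 \<le> g1 + 20" for g2
      proof (rule wp_check_loop[OF _ _ _ True])
        show "env_base ?v2 a1" using J(3) by simp
        show "?v2 xFlag = (if eps then 1 else 0)" by (simp add: f0_def)
        fix v3 g3
        assume 3: "v3 xFlag = (if result k \<noteq> {} then 1 else 0)"
          "\<forall>y. y \<notin> {xPos, xNext, xStop, xSucc, xPos2, xLow, xHigh, xFlag} \<longrightarrow> v3 y = ?v2 y"
          "g3 \<le> g2 + n * (?A * (n * 120 + 100) + 120) + 10"
        have v3: "v3 xNode = k" "v3 xGood = length (?S k)" "v3 xMax = v xMax" "v3 xRound = v xRound"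
          using 3(2) J(2,4,6,7) by simp_all
        have env3: "env_base v3 a1" using J(3) 3(2) by (simp add: env_base_def)
        show "wp (?c2 ;; xNode ::= V xNode \<oplus> N 1) R v3 a1 g3 h"
        proof (cases "result k = {}")
          case True
          have "R (v3(xNode := Suc k)) a1 g4 h" if "g4 \<le> g3 + 60" for g4
            by (rule R) (use True v3 env3 J(5,8) 3(3) g2 that in auto)
          then show ?thesis using True 3(1) v3 kB by simp
        next
          case False
          have "R (v3(xGood := Suc (length (?S k)), xNode := Suc k)) (a1(aGood := (a1 aGood)(length (?S k) := k))) g4 h"
            if "g4 \<le> g3 + 60" for g4
            by (rule R) (use False v3 env3 J(5,8) 3(3) g2 that in \<open>auto simp: nth_append less_Suc_eq\<close>)
          then show ?thesis using False 3(1) v3 kB len by simp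
        qed
      qed (use J(2) in simp_all)
      then show ?thesis
        unfolding R_def[symmetric] using True J(2,11) v1[folded f0_def] kB by simp
    qed
  qed
qed

end

section \<open>The complete program\<close>

context search
begin

lemma wp_main:
  assumes I0: "I 0 = nv" "I 1 = n"
    and ts: "length ts = n" "\<And>i. i < n \<Longrightarrow> I (2 + i) = ts ! i"
    and p: "parse 0 ts (top_label, 0, False, []) = (m, c, eps, ls)" "\<And>p. p < n \<Longrightarrow> lab p = ls ! p"
    and dm: "dm = Max (insert 0 ((\<lambda>i. off (Suc i) - off i) ` {..<nv * \<sigma>}))"
    and pre: "g + 400 + n * 150 + nv * \<sigma> * 60 + nv * (n * 120 + 100) + off (nv * \<sigma>) * (n * (n * 120 + 100)) \<le> pre"
    and del: "2 * CC * period + 1000 \<le> del"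
  shows "wp (main_com \<sigma>) (\<lambda>v a g h. \<exists>ps. distinct ps \<and> set ps = {(x, y). x < nv \<and> y \<in> result x} \<and>
    sorted (map fst ps) \<and> g \<le> del \<and> h = Preprocessed # map (\<lambda>(x, y). Out x y) ps) (\<lambda>_. 0) (\<lambda>_ _. 0) g []"
    (is "wp _ ?Q _ _ _ _")
proof -
  have B: "2 + n \<le> B" "3 + n + nv * \<sigma> \<le> B" "nv * \<sigma> \<le> B" "\<sigma> \<le> B" "8 \<le> B" "2 < F"
    using B_ge F_eq n_pos by auto
  \<comment> \<open>The factors of the period are multiplied from left to right, and each
    intermediate product has to respect the bound \<open>B\<close>.\<close>
  have pB: "8 * n \<le> B" "8 * n * n \<le> B" "8 * n * n * (dm + 1) \<le> B" "dm + 1 \<le> B"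
  proof -
    have "8 * n * 1 \<le> 8 * n * n" using n_pos by (intro mult_le_mono) auto
    moreover have "8 * n * n * 1 \<le> 8 * n * n * (dm + 1)" by (intro mult_le_mono) auto
    ultimately show "8 * n \<le> B" "8 * n * n \<le> B" and *: "8 * n * n * (dm + 1) \<le> B" using B_ge(3) by linarith+
    have "1 \<le> 8 * n * n" using n_pos by (cases n) simp_all
    then have "1 * (dm + 1) \<le> 8 * n * n * (dm + 1)" by (rule mult_le_mono1)
    then have "dm + 1 \<le> 8 * n * n * (dm + 1)" by simp
    then show "dm + 1 \<le> B" using * by (rule le_trans)
  qed
  let ?rest = "xPeriod ::= N 8 \<otimes> V xLength \<otimes> V xLength \<otimes> (V xMax \<oplus> N 1) ;; Done ;; enumerate \<sigma>"
  let ?v1 = "(\<lambda>_. 0)(xNodes := nv, xLength := n, xOffsets := 2 + n, xTargets := 3 + n + nv * \<sigma>,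
    xStart := 1, xAccept := 1, xIn := 1, xIndex := n)"
  define R where "R = wp (xStop ::= V xNodes \<otimes> N \<sigma> ;; max_loop ;; sources_loop \<sigma> ;; ?rest) ?Q"
  have len: "length ls = n" using parse_invariants(1)[OF p(1)] ts(1) by simp
  have "wp parse_loop R ?v1 (\<lambda>_ _. 0) g1 []" if g1: "g1 \<le> g + 100" for g1
  proof (rule wp_parse_loop[of ts, OF _ _ _ _ _ p(1)])
    fix v2 a2 g2
    assume 2: "mode_env v2 m c eps" "label_arrays a2 0 ls" "v2 xIndex = 0"
      "\<forall>y. y \<notin> {xStart, xAccept, xIn, xOut, xCount, xEps, xIndex, xToken} \<longrightarrow> v2 y = ?v1 y"
      "\<forall>b. b \<notin> {aStart, aAccept, aIn, aOut} \<longrightarrow> a2 b = (\<lambda>_. 0)" "g2 \<le> g1 + length ts * 150 + 10"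
    have v2: "v2 xNodes = nv" "v2 xLength = n" "v2 xOffsets = 2 + n" "v2 xTargets = 3 + n + nv * \<sigma>"
      "v2 xMax = 0" "v2 xNode = 0" "v2 xGood = 0" "v2 xRound = 0" "v2 xEps = (if eps then 1 else 0)"
      using 2(1,4) by (simp_all add: mode_env_def)
    have "a2 aStart q = starting (lab q) \<and> a2 aAccept q = accepting (lab q) \<and>
        a2 aIn q = incoming (lab q) \<and> a2 aOut q = outgoing (lab q)" if "q < n" for q
      using 2(2) that p(2)[OF that] len unfolding label_arrays_def by simp
    then have env2: "env_base v2 a2" using v2 by (simp add: env_base_def)
    let ?v3 = "v2(xStop := nv * \<sigma>)"
    have "wp max_loop (wp (sources_loop \<sigma> ;; ?rest) ?Q) ?v3 a2 g3 []" if g3: "g3 \<le> g2 + 10" for g3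
    proof (rule wp_max_loop)
      fix v4 g4
      assume 4: "v4 xMax = Max (insert 0 ((\<lambda>i. off (Suc i) - off i) ` {..<nv * \<sigma>}))"
        "\<forall>y. y \<notin> {xIndex, xToken, xMax} \<longrightarrow> v4 y = ?v3 y" "g4 \<le> g3 + nv * \<sigma> * 60 + 10"
      have v4: "v4 xNode = 0" "v4 xGood = 0" "v4 xRound = 0" "v4 xMax = dm"
        using 4(1,2) v2 dm by simp_all
      have env4: "env_base v4 a2" using env2 4(2) by (simp add: env_base_def)
      have "wp (sources_loop \<sigma>) (wp ?rest ?Q) v4 a2 g4 []"
      proof (rule wp_sources_loop[OF env4 v4(1,2)])
        fix v5 a5 g5
        assume 5: "env_base v5 a5" "v5 xGood = length sources" "\<forall>i<length sources. a5 aGood i = sources ! i"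
          "v5 xMax = v4 xMax" "v5 xRound = v4 xRound" "\<forall>b. b \<noteq> aGood \<longrightarrow> a5 b = a2 b"
          "g5 \<le> g4 + nv * (n * 120 + 100) + off (nv * \<sigma>) * (n * (n * 120 + 100)) + 10"
        have "env_ok (v5(xPeriod := period)) a5" using 5 by (simp add: env_ok_def)
        then have en: "wp (enumerate \<sigma>) ?Q (v5(xPeriod := period)) a5 1 [Preprocessed]"
        proof (rule wp_enumerate[OF _ _ _ _ del])
          fix v6 a6 g6 ps
          assume "distinct ps" "set ps = {(x, y). x < nv \<and> y \<in> result x}" "sorted (map fst ps)" "g6 \<le> del"
          then show "?Q v6 a6 g6 ([Preprocessed] @ map (\<lambda>(x, y). Out x y) ps)"
            by (intro exI[of _ ps]) simp
        qed (use 2(5) 5(5,6) v4(3) in simp_all)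
        have "v5 xLength = n" using 5(1) by (simp add: env_base_def)
        moreover have "8 * n * n * (dm + 1) = period" by (simp add: period_def amort_def)
        moreover have "g5 + 40 \<le> pre" using pre g1 2(6) g3 4(3) 5(7) ts(1) by linarith
        ultimately show "wp ?rest ?Q v5 a5 g5 []"
          using en pB B 5(4) v4(4) by simp
      qed
      then show "wp (sources_loop \<sigma> ;; ?rest) ?Q v4 a2 g4 []" by (simp only: wp_seq)
    qed (use v2 2(3) in simp_all)
    then show "R v2 a2 g2 []" using v2 B unfolding R_def by simp
  qed (use ts B_ge F_eq in \<open>simp_all add: mode_env_def top_label_def\<close>)
  then have parse_ok: "wp parse_loop R ?v1 (\<lambda>_ _. 0) (g + 38) []" by simp
  show ?thesis
    using parse_ok I0 B unfolding main_com_def initialize_def R_def by (simp add: add.commute)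
qed

end

section \<open>The encoded input\<close>

lemma path_append:
  "path D u w v \<Longrightarrow> path D v w' v' \<Longrightarrow> path D u (w @ w') v'"
proof (induction rule: path.induct)
  case (path_step u a v w v'')
  then show ?case by (simp add: path.path_step[OF path_step.hyps(1)])
qed simp

lemma path_ConsE:
  assumes "path D u (a # w) v"
  obtains u' where "(u, a, u') \<in> snd D" "path D u' w v"
  using assms by (cases rule: path.cases) auto

lemma path_nodes:
  "path D u w v \<Longrightarrow> is_graph_db \<Sigma> D \<Longrightarrow> u \<in> fst D \<and> v \<in> fst D"
  by (induction rule: path.induct) (auto simp: is_graph_db_def)

lemma path_appendE:
  assumes "path D u (w @ w') v'" "is_graph_db \<Sigma> D"
  obtains v where "path D u w v" "path D v w' v'"
proof -
  have "\<exists>v. path D u w v \<and> path D v w' v'"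
    using assms(1)
  proof (induction w arbitrary: u)
    case Nil
    then have "path D u [] u" using path_nodes[OF _ assms(2)] by (blast intro: path_empty)
    with Nil show ?case by auto
  next
    case (Cons a w)
    then obtain u' where u': "(u, a, u') \<in> snd D" "path D u' (w @ w') v'"
      by (auto elim: path_ConsE)
    from Cons.IH[OF u'(2)] show ?case using path_step[OF u'(1)] by blast
  qed
  then show ?thesis using that by blast
qed

text \<open>The table of successor lists is in row-major order, one row per node.\<close>

lemma nth_concat_map:
  "i < length us \<Longrightarrow> j < length xs \<Longrightarrow>
    concat (map (\<lambda>u. map (f u) xs) us) ! (i * length xs + j) = f (us ! i) (xs ! j)"
proof (induction us arbitrary: i)
  case (Cons u us)
  then show ?case by (cases i) (simp_all add: nth_append)
qed simp

lemma length_concat_map: "length (concat (map (\<lambda>u. map (f u) xs) us)) = length us * length xs"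
  by (induction us) auto

lemma length_concat_concat_map:
  "length (concat (concat (map (\<lambda>u. map (f u) xs) us))) =
    sum_list (map (\<lambda>u. sum_list (map (\<lambda>x. length (f u x)) xs)) us)"
  by (induction us) (simp_all add: length_concat comp_def)

lemma pos_inj: "x \<in> set xs \<Longrightarrow> y \<in> set xs \<Longrightarrow> pos xs x = pos xs y \<Longrightarrow> x = y"
  using nth_pos(1) by metis

lemma pos_nth: "distinct xs \<Longrightarrow> i < length xs \<Longrightarrow> pos xs (xs ! i) = i"
  using nth_pos[of "xs ! i" xs] by (simp add: nth_eq_iff_index_eq)

lemma nth_concat_take:
  "i < length ls \<Longrightarrow> k < length (ls ! i) \<Longrightarrow> concat ls ! (length (concat (take i ls)) + k) = ls ! i ! k"
proof (induction ls arbitrary: i)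
  case (Cons l ls)
  then show ?case by (cases i) (simp_all add: nth_append)
qed simp

lemma length_concat_take_Suc:
  "i < length ls \<Longrightarrow> length (concat (take (Suc i) ls)) = length (concat (take i ls)) + length (ls ! i)"
  by (simp add: take_Suc_conv_app_nth)

text \<open>The concrete input. The constants defined below instantiate the parameters of
  \<open>search\<close> that have the same names.\<close>

locale query_input =
  fixes \<Sigma>s :: "'a list" and ns :: "'v list" and succs :: "'v \<Rightarrow> 'a \<Rightarrow> 'v list" and q :: "'a rpq"
    and D :: "('v, 'a) graph_db"
  assumes distinct_letters: "distinct \<Sigma>s" and letters: "\<Sigma>s \<noteq> []"
    and query: "simple_query (set \<Sigma>s) q"
    and db: "is_graph_db (set \<Sigma>s) D" and rep: "represents (set \<Sigma>s) ns succs D"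
begin

definition "adj_lists = concat (map (\<lambda>u. map (succs u) \<Sigma>s) ns)"
definition "off i = length (concat (take i adj_lists))"
definition "tgt j = pos ns (concat adj_lists ! j)"
definition "tokens = encode_rpq \<Sigma>s q"
definition "lt p = tokens ! p - 4"
definition "lab p = labels 0 q ! p"
definition "dm = Max (insert 0 ((\<lambda>i. off (Suc i) - off i) ` {..<length ns * length \<Sigma>s}))"
definition "inp = encode_input \<Sigma>s ns succs q"

lemma length_adj_lists: "length adj_lists = length ns * length \<Sigma>s"
  by (simp add: adj_lists_def length_concat_map)

lemma nodes: "distinct ns" "set ns = fst D"
  and succs: "u \<in> fst D \<Longrightarrow> x \<in> set \<Sigma>s \<Longrightarrow> distinct (succs u x)"
    "u \<in> fst D \<Longrightarrow> x \<in> set \<Sigma>s \<Longrightarrow> set (succs u x) = {v. (u, x, v) \<in> snd D}"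
  using rep by (auto simp: represents_def)

lemma edges: "(u, x, v) \<in> snd D \<Longrightarrow> u \<in> fst D \<and> x \<in> set \<Sigma>s \<and> v \<in> fst D"
  using db by (auto simp: is_graph_db_def)

lemma adj_lists_nth: "i < length ns \<Longrightarrow> j < length \<Sigma>s \<Longrightarrow> adj_lists ! (i * length \<Sigma>s + j) = succs (ns ! i) (\<Sigma>s ! j)"
  unfolding adj_lists_def by (rule nth_concat_map)

lemma in_listsD: "l \<in> set adj_lists \<Longrightarrow> \<exists>u\<in>fst D. \<exists>x\<in>set \<Sigma>s. l = succs u x"
  using nodes by (auto simp: adj_lists_def)

lemma in_lists: "l \<in> set adj_lists \<Longrightarrow> distinct l \<and> set l \<subseteq> set ns"
  using in_listsD succs edges nodes by fastforce

lemma off_Suc: "i < length adj_lists \<Longrightarrow> off (Suc i) = off i + length (adj_lists ! i)"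
  unfolding off_def by (rule length_concat_take_Suc)

lemma off_total: "off (length adj_lists) = length (concat adj_lists)"
  by (simp add: off_def)

lemma off_mono: "i \<le> j \<Longrightarrow> off i \<le> off j"
proof -
  assume "i \<le> j"
  then obtain d where "j = i + d" using le_Suc_ex by blast
  then show ?thesis by (simp add: off_def take_add)
qed

lemma tgt_segment: "i < length adj_lists \<Longrightarrow> k < length (adj_lists ! i) \<Longrightarrow> tgt (off i + k) = pos ns (adj_lists ! i ! k)"
  unfolding tgt_def off_def by (simp add: nth_concat_take)

lemma tgt_less: "j < length (concat adj_lists) \<Longrightarrow> tgt j < length ns"
proof -
  assume "j < length (concat adj_lists)"
  then have "concat adj_lists ! j \<in> set (concat adj_lists)" by (rule nth_mem)
  then have "concat adj_lists ! j \<in> set ns" using in_lists by auto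
  then show ?thesis unfolding tgt_def by (rule nth_pos(2))
qed

lemma tgt_inj: "i < length adj_lists \<Longrightarrow> inj_on tgt {off i..<off (Suc i)}"
proof (rule inj_onI)
  fix j k assume i: "i < length adj_lists" and jk: "j \<in> {off i..<off (Suc i)}" "k \<in> {off i..<off (Suc i)}" "tgt j = tgt k"
  define j' k' where "j' = j - off i" and "k' = k - off i"
  have j: "j = off i + j'" "j' < length (adj_lists ! i)" and k: "k = off i + k'" "k' < length (adj_lists ! i)"
    using jk off_Suc[OF i] by (auto simp: j'_def k'_def)
  have l: "distinct (adj_lists ! i)" "set (adj_lists ! i) \<subseteq> set ns" using in_lists i by auto
  have "adj_lists ! i ! j' = adj_lists ! i ! k'"
  proof (rule pos_inj[of _ ns])
    show "pos ns (adj_lists ! i ! j') = pos ns (adj_lists ! i ! k')"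
      using jk(3) tgt_segment[OF i j(2)] tgt_segment[OF i k(2)] j(1) k(1) by simp
  qed (use l(2) nth_mem[OF j(2)] nth_mem[OF k(2)] in blast)+
  then show "j = k" using l(1) j k by (simp add: nth_eq_iff_index_eq)
qed

lemma off_diff: "i < length adj_lists \<Longrightarrow> off (Suc i) - off i = length (adj_lists ! i)"
  using off_Suc by simp

text \<open>The degree counts successors over all letters, so it bounds the list of a single letter,
  which has no repetitions.\<close>

lemma length_succs_le: "u \<in> fst D \<Longrightarrow> x \<in> set \<Sigma>s \<Longrightarrow> length (succs u x) \<le> max_degree D"
proof -
  assume u: "u \<in> fst D" "x \<in> set \<Sigma>s"
  have fin: "finite (fst D)" using db by (simp add: is_graph_db_def)
  have "length (succs u x) = card {v. (u, x, v) \<in> snd D}"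
    using succs[OF u] distinct_card by metis
  also have "\<dots> \<le> degree D u"
    unfolding degree_def by (rule card_mono[OF finite_subset[OF _ fin]]) (use edges in auto)
  also have "\<dots> \<le> max_degree D" unfolding max_degree_def using u fin by (intro Max_ge) auto
  finally show ?thesis .
qed

lemma dm_le: "dm \<le> max_degree D"
proof -
  have "off (Suc i) - off i \<le> max_degree D" if "i < length ns * length \<Sigma>s" for i
  proof -
    have i: "i < length adj_lists" using that length_adj_lists by simp
    then have "adj_lists ! i \<in> set adj_lists" by (rule nth_mem)
    then show ?thesis using in_listsD length_succs_le off_diff[OF i] by metis
  qed
  then show ?thesis unfolding dm_def by (intro Max.boundedI) auto
qed

lemma length_ns_le: "length ns \<le> db_size D"
  using nodes distinct_card[of ns] by (simp add: db_size_def)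

text \<open>Every entry of a list stands for one arc, determined by the node and the letter of the
  list and by the entry, so the lengths add up to the cardinality of a set of arcs.\<close>

lemma length_concat_lists_le: "length (concat adj_lists) \<le> db_size D"
proof -
  have fin: "finite (fst D)" "finite (snd D)"
    using db finite_subset[of "snd D" "fst D \<times> set \<Sigma>s \<times> fst D"] by (auto simp: is_graph_db_def)
  have len: "length (succs u x) = card {v. (u, x, v) \<in> snd D}" if "u \<in> set ns" "x \<in> set \<Sigma>s" for u x
    using succs[of u x] that nodes distinct_card[of "succs u x"] by simp
  have "length (concat adj_lists) = sum_list (map (\<lambda>u. sum_list (map (\<lambda>x. length (succs u x)) \<Sigma>s)) ns)"
    unfolding adj_lists_def by (rule length_concat_concat_map)
  also have "\<dots> = (\<Sum>u\<in>set ns. \<Sum>x\<in>set \<Sigma>s. length (succs u x))"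
    using nodes(1) distinct_letters by (simp add: sum_list_distinct_conv_sum_set)
  also have "\<dots> = (\<Sum>u\<in>set ns. \<Sum>x\<in>set \<Sigma>s. card {v. (u, x, v) \<in> snd D})"
    using len by simp
  also have "\<dots> = card (SIGMA u:set ns. SIGMA x:set \<Sigma>s. {v. (u, x, v) \<in> snd D})"
  proof -
    have "finite {v. (u, x, v) \<in> snd D}" for u x
      using fin(1) by (rule finite_subset[rotated]) (use edges in auto)
    then show ?thesis by simp
  qed
  also have "\<dots> \<le> card (snd D)" by (rule card_mono[OF fin(2)]) auto
  finally show ?thesis by (simp add: db_size_def)
qed


section \<open>Letters and labels of the positions, layout of the input\<close>

definition letter :: "nat \<Rightarrow> 'a" where "letter p = \<Sigma>s ! lt p"

lemma tokens_less: "t \<in> set tokens \<Longrightarrow> t < 4 + length \<Sigma>s"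
proof -
  have l: "letter_alt (set \<Sigma>s) \<alpha> \<Longrightarrow> t \<in> set (encode_rpq \<Sigma>s \<alpha>) \<Longrightarrow> t < 4 + length \<Sigma>s" for \<alpha>
    by (induction \<alpha>) (auto dest: nth_pos(2))
  have "simple_query (set \<Sigma>s) r \<Longrightarrow> t \<in> set (encode_rpq \<Sigma>s r) \<Longrightarrow> t < 4 + length \<Sigma>s" for r
    by (induction r) (auto dest: nth_pos(2) l)
  then show "t \<in> set tokens \<Longrightarrow> t < 4 + length \<Sigma>s" using query by (simp add: tokens_def)
qed

lemma length_tokens: "length tokens = rpq_length q"
  by (simp add: tokens_def)

text \<open>For an operator token the cut-off subtraction gives 0, a valid index as the alphabet is
  not empty.\<close>

lemma lt_less: "p < rpq_length q \<Longrightarrow> lt p < length \<Sigma>s"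
proof -
  assume "p < rpq_length q"
  then have "tokens ! p \<in> set tokens" by (simp add: length_tokens)
  from tokens_less[OF this] have "tokens ! p < 4 + length \<Sigma>s" .
  moreover have "0 < length \<Sigma>s" using letters by simp
  ultimately show ?thesis unfolding lt_def by linarith
qed

lemma length_labels_query: "length (labels 0 q) = rpq_length q"
  by (rule length_labels[OF query])

text \<open>An outgoing number is 0 or at least 2; an incoming number is 1, or it is at least 2 and
  belongs to an accepting label.\<close>

lemma lab_acc:
  assumes "s < rpq_length q" "p < rpq_length q" "outgoing (lab s) = incoming (lab p)"
  shows "accepting (lab p) = 1"
proof -
  have "lab s \<in> set (labels 0 q)" "lab p \<in> set (labels 0 q)"
    using assms(1,2) by (simp_all add: lab_def length_labels_query)
  from label_bounds(2)[OF this(1)] label_bounds(1)[OF this(2)] assms(3) show ?thesis by auto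
qed

lemma items_query: "items \<Sigma>s (labels 0 q) q = (\<lambda>p. (letter p, lab p)) ` {..<rpq_length q}"
proof -
  have "zip (map (\<lambda>t. \<Sigma>s ! (t - 4)) (encode_rpq \<Sigma>s q)) (labels 0 q) =
      map (\<lambda>p. (letter p, lab p)) [0..<rpq_length q]"
    by (rule nth_equalityI) (auto simp: length_labels_query letter_def lt_def lab_def tokens_def)
  then show ?thesis unfolding items_def by (simp add: atLeast0LessThan)
qed

lemma inp_eq: "inp = [length ns, rpq_length q] @ tokens @ map off [0..<Suc (length ns * length \<Sigma>s)] @
    map (pos ns) (concat adj_lists)"
  unfolding inp_def encode_input_def encode_db_def tokens_def off_def
  by (simp add: Let_def adj_lists_def[symmetric] length_adj_lists)

lemma length_inp: "length inp = 3 + rpq_length q + length ns * length \<Sigma>s + off (length ns * length \<Sigma>s)"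
  by (simp add: inp_eq length_tokens off_total length_adj_lists[symmetric])

lemma inp_tokens: "i < rpq_length q \<Longrightarrow> inp ! (2 + i) = tokens ! i"
  by (simp add: inp_eq nth_append length_tokens)

lemma inp_off: "i \<le> length ns * length \<Sigma>s \<Longrightarrow> inp ! (2 + rpq_length q + i) = off i"
  by (simp add: inp_eq nth_append length_tokens del: upt_Suc)

lemma inp_tgt:
  assumes "j < off (length ns * length \<Sigma>s)"
  shows "inp ! (3 + rpq_length q + length ns * length \<Sigma>s + j) = tgt j"
proof -
  have "j < length (concat adj_lists)" using assms by (simp add: off_total length_adj_lists[symmetric])
  moreover have "inp ! (3 + rpq_length q + length ns * length \<Sigma>s + j) = map (pos ns) (concat adj_lists) ! j"
    unfolding inp_eq append_assoc[symmetric]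
    by (subst nth_append_right) (simp_all add: length_tokens)
  ultimately show ?thesis by (simp add: tgt_def)
qed

text \<open>Tokens may exceed the length of the input, for instance if there are no nodes; hence the
  summand for the alphabet.\<close>

lemma inp_le:
  assumes "x \<in> set inp"
  shows "x \<le> length inp + length \<Sigma>s + 4"
proof -
  have "1 \<le> length \<Sigma>s" using letters by (simp add: Suc_le_eq)
  from mult_le_mono2[OF this, of "length ns"] have "length ns \<le> length ns * length \<Sigma>s"
    by (simp only: mult_1_right)
  then have len: "length ns \<le> length inp" "rpq_length q \<le> length inp" "off (length ns * length \<Sigma>s) \<le> length inp"
    unfolding length_inp by linarith+
  have "set inp = {length ns, rpq_length q} \<union> set tokens \<union> off ` {..length ns * length \<Sigma>s} \<union>
      pos ns ` set (concat adj_lists)"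
    unfolding inp_eq by (simp add: atLeast0LessThan lessThan_Suc_atMost Un_assoc del: upt_Suc set_concat)
  with assms consider "x = length ns" | "x = rpq_length q" | "x \<in> set tokens"
    | i where "i \<le> length ns * length \<Sigma>s" "x = off i" | v where "v \<in> set (concat adj_lists)" "x = pos ns v"
    by blast
  then show ?thesis
  proof cases
    case 3
    then show ?thesis using tokens_less[of x] by simp
  next
    case 4
    then show ?thesis using off_mono[OF 4(1)] len by simp
  next
    case 5
    then have "v \<in> set ns" using in_lists by auto
    then show ?thesis using nth_pos(2)[of v ns] 5 len by simp
  qed (use len in simp_all)
qed


lemma edge_iff:
  assumes "v < length ns" "p < rpq_length q"
  shows "(\<exists>j\<in>{off (v * length \<Sigma>s + lt p)..<off (Suc (v * length \<Sigma>s + lt p))}. tgt j = x) \<longleftrightarrow>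
    x < length ns \<and> (ns ! v, letter p, ns ! x) \<in> snd D"
proof -
  let ?i = "v * length \<Sigma>s + lt p"
  note lt = lt_less[OF assms(2)]
  have "?i < Suc v * length \<Sigma>s" using lt by simp
  also have "\<dots> \<le> length ns * length \<Sigma>s" using assms(1) by (intro mult_le_mono1) simp
  finally have i: "?i < length adj_lists" by (simp add: length_adj_lists)
  have l: "adj_lists ! ?i = succs (ns ! v) (letter p)"
    unfolding letter_def by (rule adj_lists_nth[OF assms(1) lt])
  have v: "ns ! v \<in> fst D" "letter p \<in> set \<Sigma>s" using nth_mem[OF assms(1)] nth_mem[OF lt] nodes(2) by (simp_all add: letter_def)
  have set_l: "set (adj_lists ! ?i) = {w. (ns ! v, letter p, w) \<in> snd D}" unfolding l by (rule succs(2)[OF v])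
  show ?thesis
  proof
    assume "\<exists>j\<in>{off ?i..<off (Suc ?i)}. tgt j = x"
    then obtain j where j: "off ?i \<le> j" "j < off (Suc ?i)" "tgt j = x" by auto
    define k where "k = j - off ?i"
    have k: "j = off ?i + k" "k < length (adj_lists ! ?i)" using j off_Suc[OF i] by (auto simp: k_def)
    let ?w = "adj_lists ! ?i ! k"
    have "?w \<in> set (adj_lists ! ?i)" using k(2) by (rule nth_mem)
    then have w: "(ns ! v, letter p, ?w) \<in> snd D" using set_l by blast
    have "?w \<in> set ns" using edges[OF w] nodes(2) by simp
    moreover have "x = pos ns ?w" using tgt_segment[OF i k(2)] j(3) k(1) by simp
    ultimately show "x < length ns \<and> (ns ! v, letter p, ns ! x) \<in> snd D" using w nth_pos[of ?w ns] by simp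
  next
    assume x: "x < length ns \<and> (ns ! v, letter p, ns ! x) \<in> snd D"
    then have "ns ! x \<in> set (adj_lists ! ?i)" using set_l by simp
    then obtain k where k: "k < length (adj_lists ! ?i)" "adj_lists ! ?i ! k = ns ! x"
      by (auto simp: in_set_conv_nth)
    have "tgt (off ?i + k) = x" using tgt_segment[OF i k(1)] pos_nth[OF nodes(1), of x] x k(2) by simp
    then show "\<exists>j\<in>{off ?i..<off (Suc ?i)}. tgt j = x"
      using k(1) off_Suc[OF i] by (intro bexI[of _ "off ?i + k"]) auto
  qed
qed

section \<open>Answers as runs of positions along paths\<close>

inductive visits :: "nat \<Rightarrow> nat \<Rightarrow> nat \<Rightarrow> bool" for u where
  visits_first: "p < rpq_length q \<Longrightarrow> starting (lab p) = 1 \<Longrightarrow> x < length ns \<Longrightarrow>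
    (ns ! u, letter p, ns ! x) \<in> snd D \<Longrightarrow> visits u x p"
| visits_next: "visits u v s \<Longrightarrow> p < rpq_length q \<Longrightarrow> outgoing (lab s) = incoming (lab p) \<Longrightarrow> x < length ns \<Longrightarrow>
    (ns ! v, letter p, ns ! x) \<in> snd D \<Longrightarrow> visits u x p"

definition run :: "nat list \<Rightarrow> bool" where
  "run ps \<longleftrightarrow> ps \<noteq> [] \<and> set ps \<subseteq> {..<rpq_length q} \<and> starting (lab (hd ps)) = 1 \<and>
     successively (\<lambda>s p. outgoing (lab s) = incoming (lab p)) ps"

lemma path_letter: "path D v [a] w \<longleftrightarrow> (v, a, w) \<in> snd D"
proof
  assume "path D v [a] w"
  then obtain v' where "(v, a, v') \<in> snd D" "path D v' [] w" by (rule path_ConsE)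
  from this(2) this(1) show "(v, a, w) \<in> snd D" by cases simp
next
  assume e: "(v, a, w) \<in> snd D"
  then have "w \<in> fst D" using edges by blast
  from path_step[OF e path_empty[OF this]] show "path D v [a] w" .
qed

lemma visits_imp_run:
  "visits u x p \<Longrightarrow> \<exists>ps. run ps \<and> last ps = p \<and> path D (ns ! u) (map letter ps) (ns ! x)"
proof (induction rule: visits.induct)
  case (visits_first p x)
  then have "run [p]" "path D (ns ! u) (map letter [p]) (ns ! x)"
    by (simp_all add: run_def path_letter)
  then show ?case by (intro exI[of _ "[p]"]) simp
next
  case (visits_next v s p x)
  then obtain ps where ps: "run ps" "last ps = s" "path D (ns ! u) (map letter ps) (ns ! v)" by blast
  then have "run (ps @ [p])" using visits_next by (auto simp: run_def successively_append_iff)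
  moreover have "path D (ns ! u) (map letter (ps @ [p])) (ns ! x)"
    using path_append[OF ps(3), of "[letter p]" "ns ! x"] visits_next by (simp add: path_letter)
  ultimately show ?case by (intro exI[of _ "ps @ [p]"]) simp
qed

text \<open>The induction goes from the right because \<open>visits\<close> extends a run at its
  end.\<close>

lemma run_imp_visits:
  "run ps \<Longrightarrow> path D (ns ! u) (map letter ps) (ns ! x) \<Longrightarrow> x < length ns \<Longrightarrow> visits u x (last ps)"
proof (induction ps arbitrary: x rule: rev_induct)
  case (snoc p ps)
  have p: "p < rpq_length q" using snoc.prems(1) by (simp add: run_def)
  obtain w where w: "path D (ns ! u) (map letter ps) w" "path D w [letter p] (ns ! x)"
    using snoc.prems(2) by (auto elim: path_appendE[OF _ db])
  then have e: "(w, letter p, ns ! x) \<in> snd D" by (simp add: path_letter)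
  show ?case
  proof (cases "ps = []")
    case True
    then have "w = ns ! u" using w(1) by (auto elim: path.cases)
    then show ?thesis
      using True snoc.prems p e by (auto simp: run_def intro: visits_first)
  next
    case False
    have "w \<in> set ns" using edges[OF e] nodes(2) by simp
    then obtain y where y: "y < length ns" "w = ns ! y" by (auto simp: in_set_conv_nth)
    have "run ps" "outgoing (lab (last ps)) = incoming (lab p)"
      using snoc.prems(1) False by (auto simp: run_def successively_append_iff)
    then show ?thesis
      using visits_next[OF snoc.IH p] w(1) y e snoc.prems(3) by simp
  qed
qed (simp add: run_def)

lemma set_subset_imageE:
  assumes "set zs \<subseteq> f ` A"
  obtains ps where "set ps \<subseteq> A" "zs = map f ps"
proof -
  have "\<exists>ps. set ps \<subseteq> A \<and> zs = map f ps"
    using assms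
  proof (induction zs)
    case (Cons z zs)
    then obtain p ps where "p \<in> A" "z = f p" "set ps \<subseteq> A" "zs = map f ps" by auto
    then show ?case by (intro exI[of _ "p # ps"]) simp
  qed simp
  then show ?thesis using that by blast
qed

lemma labelled_words_query:
  "labelled_words (items \<Sigma>s (labels 0 q) q) = {map letter ps | ps. run ps \<and> accepting (lab (last ps)) = 1}"
proof (rule antisym)
  let ?f = "\<lambda>p. (letter p, lab p)"
  show "labelled_words (items \<Sigma>s (labels 0 q) q) \<subseteq> {map letter ps | ps. run ps \<and> accepting (lab (last ps)) = 1}"
  proof
    fix w assume "w \<in> labelled_words (items \<Sigma>s (labels 0 q) q)"
    then obtain zs where zs: "w = map fst zs" "zs \<noteq> []" "set zs \<subseteq> ?f ` {..<rpq_length q}"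
      "starting (snd (hd zs)) = 1" "successively (\<lambda>y z. outgoing (snd y) = incoming (snd z)) zs"
      "accepting (snd (last zs)) = 1"
      unfolding labelled_words_def items_query by blast
    obtain ps where ps: "set ps \<subseteq> {..<rpq_length q}" "zs = map ?f ps" by (rule set_subset_imageE[OF zs(3)])
    have "run ps" "accepting (lab (last ps)) = 1" "w = map letter ps"
      using zs ps by (auto simp: run_def hd_map last_map successively_map comp_def)
    then show "w \<in> {map letter ps | ps. run ps \<and> accepting (lab (last ps)) = 1}" by blast
  qed
  show "{map letter ps | ps. run ps \<and> accepting (lab (last ps)) = 1} \<subseteq> labelled_words (items \<Sigma>s (labels 0 q) q)"
  proof
    fix w assume "w \<in> {map letter ps | ps. run ps \<and> accepting (lab (last ps)) = 1}"
    then obtain ps where ps: "w = map letter ps" "run ps" "accepting (lab (last ps)) = 1" by blast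
    then show "w \<in> labelled_words (items \<Sigma>s (labels 0 q) q)"
      unfolding labelled_words_def items_query
      by (intro CollectI exI[of _ "map ?f ps"]) (auto simp: run_def hd_map last_map successively_map comp_def)
  qed
qed

lemma answers_iff:
  assumes "u < length ns" "x < length ns"
  shows "(ns ! u, ns ! x) \<in> answers q D \<longleftrightarrow>
    (\<exists>p<rpq_length q. visits u x p \<and> accepting (lab p) = 1) \<or> (has_eps q \<and> x = u)" (is "_ \<longleftrightarrow> ?R")
proof -
  have eps: "path D (ns ! u) [] (ns ! x) \<longleftrightarrow> x = u"
  proof
    assume "path D (ns ! u) [] (ns ! x)"
    then have "ns ! u = ns ! x" by cases simp
    then show "x = u" using assms nodes(1) by (simp add: nth_eq_iff_index_eq)
  next
    assume "x = u"
    then show "path D (ns ! u) [] (ns ! x)" using assms nodes by (auto intro: path_empty)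
  qed
  have "(ns ! u, ns ! x) \<in> answers q D \<longleftrightarrow>
      (\<exists>ps. run ps \<and> accepting (lab (last ps)) = 1 \<and> path D (ns ! u) (map letter ps) (ns ! x)) \<or> (has_eps q \<and> x = u)"
    unfolding answers_def lang_eq_labelled_words[OF query, of 0] labelled_words_query
    using eps by auto
  also have "(\<exists>ps. run ps \<and> accepting (lab (last ps)) = 1 \<and> path D (ns ! u) (map letter ps) (ns ! x)) \<longleftrightarrow>
      (\<exists>p<rpq_length q. visits u x p \<and> accepting (lab p) = 1)"
  proof
    assume "\<exists>ps. run ps \<and> accepting (lab (last ps)) = 1 \<and> path D (ns ! u) (map letter ps) (ns ! x)"
    then obtain ps where ps: "run ps" "accepting (lab (last ps)) = 1" "path D (ns ! u) (map letter ps) (ns ! x)"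
      by blast
    have "last ps < rpq_length q" using ps(1) last_in_set[of ps] unfolding run_def by (meson lessThan_iff subsetD)
    then show "\<exists>p<rpq_length q. visits u x p \<and> accepting (lab p) = 1"
      using run_imp_visits[OF ps(1,3) assms(2)] ps(2) by blast
  next
    assume "\<exists>p<rpq_length q. visits u x p \<and> accepting (lab p) = 1"
    then obtain p where p: "visits u x p" "accepting (lab p) = 1" by blast
    then show "\<exists>ps. run ps \<and> accepting (lab (last ps)) = 1 \<and> path D (ns ! u) (map letter ps) (ns ! x)"
      using visits_imp_run[OF p(1)] by auto
  qed
  finally show ?thesis .
qed

lemma answers_nodes: "(v, v') \<in> answers q D \<Longrightarrow> v \<in> set ns \<and> v' \<in> set ns"
  using path_nodes[OF _ db] nodes by (auto simp: answers_def)

end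

section \<open>Word size, bounds on values, and time constants\<close>

lemma word_size_ge: "(length inp + 1) ^ k \<le> 2 ^ word_size k inp"
proof -
  define L where "L = nat \<lceil>log 2 (real (length inp + 1))\<rceil>"
  have "real (length inp + 1) = 2 powr log 2 (real (length inp + 1))" by simp
  also have "\<dots> \<le> 2 powr real L" unfolding L_def by (intro powr_mono) linarith+
  also have "\<dots> = real (2 ^ L)" by (simp add: powr_realpow)
  finally have "length inp + 1 \<le> 2 ^ L" by (simp only: of_nat_le_iff)
  then have "(length inp + 1) ^ k \<le> (2 ^ L) ^ k" by (rule power_mono) simp
  also have "\<dots> = 2 ^ word_size k inp" by (simp add: word_size_def L_def power_mult[symmetric] mult.commute)
  finally show ?thesis .
qed

context query_input
begin

definition "cell i = (if i < length inp then inp ! i else 0)"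
text \<open>Six powers cover the products in \<open>search_bounds\<close>. The remaining ones cover
  the size of the alphabet, which may exceed the length of the input.\<close>

definition "bound = (length inp + 1) ^ (length \<Sigma>s + 6)"

lemma length_inp_ge: "length ns \<le> length inp" "rpq_length q + 3 \<le> length inp" "dm \<le> length inp" "4 \<le> length inp"
proof -
  have "1 \<le> length \<Sigma>s" using letters by (simp add: Suc_le_eq)
  from mult_le_mono2[OF this, of "length ns"] have "length ns \<le> length ns * length \<Sigma>s"
    by (simp only: mult_1_right)
  then show "length ns \<le> length inp" "rpq_length q + 3 \<le> length inp" unfolding length_inp by linarith+
  show "4 \<le> length inp" using rpq_length_pos[of q] unfolding length_inp by linarith
  have "off (Suc i) - off i \<le> off (length ns * length \<Sigma>s)" if "i < length ns * length \<Sigma>s" for i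
    using off_mono[of "Suc i" "length ns * length \<Sigma>s"] that by linarith
  then have "dm \<le> off (length ns * length \<Sigma>s)" unfolding dm_def by (intro Max.boundedI) auto
  then show "dm \<le> length inp" unfolding length_inp by linarith
qed

text \<open>The word size constant is larger by four than the exponent of \<open>bound\<close>. As
  the input has at least four cells, this leaves a factor of at least \<open>5 ^ 4\<close>, enough
  for the sixteen arrays.\<close>

lemma bound_ge: "(length inp + 1) ^ 6 \<le> bound" "length \<Sigma>s + (length inp + 1) ^ 6 \<le> bound"
  and bound_less: "length inp + 16 * bound + 16 < 2 ^ word_size (length \<Sigma>s + 10) inp"
proof -
  define M where "M = length inp + 1"
  have M: "5 \<le> M" using length_inp_ge(4) by (simp add: M_def)
  have s: "length \<Sigma>s + 1 \<le> M ^ length \<Sigma>s"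
  proof -
    have "length \<Sigma>s < 2 ^ length \<Sigma>s" by (rule less_exp)
    also have "\<dots> \<le> M ^ length \<Sigma>s" using M by (intro power_mono) simp_all
    finally show ?thesis by simp
  qed
  have M6: "15625 \<le> M ^ 6" using power_mono[OF M, of 6] by simp
  have b: "bound = M ^ length \<Sigma>s * M ^ 6" by (simp add: bound_def M_def power_add)
  have "1 * M ^ 6 \<le> bound" unfolding b by (rule mult_le_mono1) (use s in simp)
  then show "(length inp + 1) ^ 6 \<le> bound" by (simp add: M_def)
  have "length \<Sigma>s * 1 \<le> length \<Sigma>s * M ^ 6" using M6 by (intro mult_le_mono2) simp
  then have "length \<Sigma>s + M ^ 6 \<le> (length \<Sigma>s + 1) * M ^ 6" by simp
  also have "\<dots> \<le> bound" unfolding b by (rule mult_le_mono1[OF s])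
  finally show "length \<Sigma>s + (length inp + 1) ^ 6 \<le> bound" by (simp add: M_def)
  have "M ^ 1 \<le> M ^ 6" using M by (intro power_increasing) simp_all
  then have "M \<le> bound" using \<open>1 * M ^ 6 \<le> bound\<close> by simp
  then have "length inp + 16 * bound + 16 < 625 * bound" using M by (simp add: M_def)
  also have "\<dots> \<le> M ^ 4 * bound" using power_mono[OF M, of 4] by (intro mult_le_mono1) simp
  also have "\<dots> = M ^ (length \<Sigma>s + 10)" by (simp add: b power_add[symmetric] algebra_simps)
  also have "\<dots> \<le> 2 ^ word_size (length \<Sigma>s + 10) inp" unfolding M_def by (rule word_size_ge)
  finally show "length inp + 16 * bound + 16 < 2 ^ word_size (length \<Sigma>s + 10) inp" .
qed

lemma search_bounds:
  "length inp + 10 \<le> bound" "length ns * rpq_length q + length ns + rpq_length q + 10 \<le> bound"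
  "8 * rpq_length q * rpq_length q * (dm + 1) + 10 \<le> bound" "length \<Sigma>s + 10 \<le> bound"
  "length inp + length \<Sigma>s + 4 \<le> bound"
proof -
  define M where "M = length inp + 1"
  have M: "5 \<le> M" "length ns \<le> M" "rpq_length q \<le> M" "dm + 1 \<le> M"
    using length_inp_ge by (simp_all add: M_def)
  have M6: "M ^ 6 \<le> bound" using bound_ge(1) by (simp add: M_def)
  have m3: "125 * M ^ 3 \<le> M ^ 6"
  proof -
    have "125 * M ^ 3 \<le> M ^ 3 * M ^ 3" using power_mono[OF M(1), of 3] by (intro mult_le_mono1) simp
    then show ?thesis by (simp add: power_add[symmetric])
  qed
  have m2: "M * M \<le> M ^ 3" "M \<le> M * M" "1 \<le> M ^ 3" using M(1) by (simp_all add: power3_eq_cube)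
  show "length inp + 10 \<le> bound" using m3 m2 M6 M(1) by (simp add: M_def)
  have "length ns * rpq_length q \<le> M * M" using M(2,3) by (rule mult_le_mono)
  then show "length ns * rpq_length q + length ns + rpq_length q + 10 \<le> bound"
    using M m2 m3 M6 by linarith
  have "8 * rpq_length q * rpq_length q * (dm + 1) \<le> 8 * M * M * M"
    using M by (intro mult_le_mono) simp_all
  also have "\<dots> = 8 * M ^ 3" by (simp add: power3_eq_cube)
  finally show "8 * rpq_length q * rpq_length q * (dm + 1) + 10 \<le> bound" using m2 m3 M6 by linarith
  have "length \<Sigma>s + M ^ 6 \<le> bound" using bound_ge(2) by (simp add: M_def)
  then show "length \<Sigma>s + 10 \<le> bound" "length inp + length \<Sigma>s + 4 \<le> bound"
    using m2 m3 M(1) by (simp_all add: M_def)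
qed

lemma cell_le: "cell i \<le> bound"
proof (cases "i < length inp")
  case True
  then show ?thesis using inp_le[OF nth_mem[OF True]] search_bounds(5) by (simp add: cell_def)
qed (simp add: cell_def)

text \<open>33000 stems from the delay: \<open>16000 * (dm + 1)\<close> with \<open>dm + 1\<close>
  at most twice the maximum of 1 and the degree, plus 1000. The summand with the alphabet pays for
  \<open>max_loop\<close>, which runs through the whole offset table.\<close>

definition "time_constant = 33000 + 60 * length \<Sigma>s"

text \<open>The last entry of the offset table is the total length of the successor lists; with it
  the input reveals its own length.\<close>

definition size_exp :: aexp where
  "size_exp = N 3 \<oplus> Inp (N 1) \<oplus> Inp (N 0) \<otimes> N (length \<Sigma>s) \<oplus>
     Inp (N 2 \<oplus> Inp (N 1) \<oplus> Inp (N 0) \<otimes> N (length \<Sigma>s))"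

text \<open>The 22 is the time of the prologue. All terms are multiples of quantities bounded by
  \<open>n\<^sup>2 * m\<close>, except for the one of the offset table, which has the additional
  factor \<open>s\<close>.\<close>

lemma preprocessing_time:
  fixes n m v e s :: nat
  assumes "1 \<le> n" "1 \<le> m" "v \<le> m" "e \<le> m"
  shows "22 + 400 + n * 150 + v * s * 60 + v * (n * 120 + 100) + e * (n * (n * 120 + 100)) \<le>
    (33000 + 60 * s) * (n\<^sup>2 * m)"
proof -
  define x where "x = n\<^sup>2 * m"
  have nn: "n \<le> n * n" using assms(1) by simp
  have "n * n * 1 \<le> x" unfolding x_def power2_eq_square using assms(2) by (rule mult_le_mono2)
  then have 1: "1 \<le> x" "n \<le> x" using nn assms(1) by linarith+
  have 2: "v * n \<le> x" "e * n \<le> x" "e * (n * n) \<le> x" "m \<le> x"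
  proof -
    have "v * n \<le> m * (n * n)" "e * n \<le> m * (n * n)" "e * (n * n) \<le> m * (n * n)"
      using mult_le_mono[OF assms(3) nn] mult_le_mono[OF assms(4) nn] mult_le_mono1[OF assms(4)] by simp_all
    then show "v * n \<le> x" "e * n \<le> x" "e * (n * n) \<le> x"
      by (simp_all add: x_def power2_eq_square mult.commute)
    show "m \<le> x" using nn assms(1) mult_le_mono1[of 1 "n * n" m] by (simp add: x_def power2_eq_square)
  qed
  have 3: "v * s \<le> s * x" using assms(3) 2(4) by (simp add: mult.commute mult_le_mono)
  have "22 + 400 + n * 150 + v * s * 60 + v * (n * 120 + 100) + e * (n * (n * 120 + 100)) =
      422 + 150 * n + 60 * (v * s) + 120 * (v * n) + 100 * v + 120 * (e * (n * n)) + 100 * (e * n)"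
    by (simp add: algebra_simps)
  also have "\<dots> \<le> 33000 * x + 60 * (s * x)" using 1 2 3 assms(3) by linarith
  also have "\<dots> = (33000 + 60 * s) * (n\<^sup>2 * m)" by (simp add: x_def algebra_simps)
  finally show ?thesis .
qed

lemma delay_time:
  fixes n m d s :: nat
  assumes "1 \<le> n" "1 \<le> m" "d \<le> m"
  shows "2 * 1000 * (2 * (4 * n * n * (d + 1))) + 1000 \<le> (33000 + 60 * s) * (n\<^sup>2 * m)"
proof -
  define x where "x = n\<^sup>2 * m"
  have "1 * 1 \<le> x" unfolding x_def using assms by (intro mult_le_mono) auto
  moreover have "n * n * (d + 1) \<le> n * n * (2 * m)" using assms by (intro mult_le_mono2) simp
  then have "n * n * (d + 1) \<le> 2 * x" by (simp add: x_def power2_eq_square)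
  moreover have "2 * 1000 * (2 * (4 * n * n * (d + 1))) = 16000 * (n * n * (d + 1))" by simp
  ultimately have "2 * 1000 * (2 * (4 * n * n * (d + 1))) + 1000 \<le> 33000 * x" by linarith
  also have "\<dots> \<le> (33000 + 60 * s) * x" by simp
  finally show ?thesis by (simp add: x_def)
qed

lemma enumerates:
  assumes pre: "time_constant * ((rpq_length q)\<^sup>2 * max 1 (db_size D)) \<le> pre"
    and del: "time_constant * ((rpq_length q)\<^sup>2 * max 1 (max_degree D)) \<le> del"
  shows "\<exists>ps. distinct ps \<and> set ps = answers q D \<and> semi_sorted ns ps \<and>
    ram_enumerates (word_size (length \<Sigma>s + 10) inp) (program size_exp (main_com (length \<Sigma>s))) inp
      (map (\<lambda>(u, v). (pos ns u, pos ns v)) ps) pre del"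
proof -
  let ?n = "rpq_length q" and ?s = "length \<Sigma>s" and ?v = "length ns"
  have n_pos: "1 \<le> ?n" using rpq_length_pos[of q] by simp
  have F: "length inp = 3 + ?n + ?v * ?s + off (?v * ?s)" by (rule length_inp)
  have adj: "length adj_lists = ?v * ?s" by (rule length_adj_lists)
  have total: "off (?v * ?s) = length (concat adj_lists)" by (simp add: off_total adj[symmetric])
  have cells: "cell 0 = ?v" "cell 1 = ?n" "\<And>i. i < ?n \<Longrightarrow> cell (2 + i) = tokens ! i"
    "\<And>i. i \<le> ?v * ?s \<Longrightarrow> cell (2 + ?n + i) = off i"
    "\<And>j. j < off (?v * ?s) \<Longrightarrow> cell (3 + ?n + ?v * ?s + j) = tgt j"
    using inp_tokens inp_off inp_tgt by (simp_all add: cell_def F) (simp_all add: inp_eq)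
  interpret S: search cell "length inp" bound "word_size (?s + 10) inp" pre del ?v ?n ?s lt off tgt lab
    "has_eps q" dm
  proof
    show "dm \<ge> off (Suc i) - off i" if "i < ?v * ?s" for i
      unfolding dm_def using that by (intro Max_ge) auto
  qed (use n_pos F adj total cells cell_le bound_less search_bounds lt_less lab_acc off_mono tgt_less tgt_inj in
      \<open>simp_all add: lt_def off_def\<close>)
  have edge: "S.edge v p x \<longleftrightarrow> x < ?v \<and> (ns ! v, letter p, ns ! x) \<in> snd D" if "v < ?v" "p < ?n" for v p x
    unfolding S.edge_def S.lo_def S.hi_def by (rule edge_iff[OF that])
  have visits: "S.reach u x p \<and> p < ?n \<longleftrightarrow> visits u x p" if u: "u < ?v" for u x p
  proof
    have "S.reach u x p \<Longrightarrow> p < ?n \<Longrightarrow> visits u x p"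
    proof (induction rule: S.reach.induct)
      case (reach_step v s p x)
      have v: "v < ?v" "s = ?n \<longrightarrow> v = u" "s \<noteq> ?n \<longrightarrow> s < ?n"
        using S.reach_cases[OF reach_step.hyps(1) u] by auto
      have e: "x < ?v" "(ns ! v, letter p, ns ! x) \<in> snd D"
        using edge[OF v(1) reach_step.hyps(2)] reach_step.hyps(4) by auto
      show ?case
      proof (cases "s = ?n")
        case True
        then show ?thesis using v reach_step.hyps e by (auto simp: S.follows_def intro: visits_first)
      next
        case False
        then show ?thesis
          using visits_next[OF reach_step.IH _ _ e] v reach_step.hyps by (simp add: S.follows_def)
      qed
    qed simp
    then show "S.reach u x p \<and> p < ?n \<Longrightarrow> visits u x p" by blast
  next
    assume "visits u x p"
    then show "S.reach u x p \<and> p < ?n"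
    proof (induction rule: visits.induct)
      case (visits_first p x)
      then have "S.follows ?n p" "S.edge u p x" using edge[OF u] by (simp_all add: S.follows_def)
      then show ?case using visits_first S.reach_step[OF S.reach_init] by blast
    next
      case (visits_next v s p x)
      then have "v < ?v" using S.reach_cases u by blast
      then have "S.follows s p" "S.edge v p x"
        using edge[of v p x] visits_next by (simp_all add: S.follows_def)
      then show ?case using visits_next S.reach_step by blast
    qed
  qed
  have result: "S.result u = {x. x < ?v \<and> (ns ! u, ns ! x) \<in> answers q D}" if u: "u < ?v" for u
  proof -
    have "x \<in> S.result u \<longleftrightarrow> x < ?v \<and> ((\<exists>p<?n. visits u x p \<and> accepting (lab p) = 1) \<or> (has_eps q \<and> x = u))" for x
      unfolding S.result_def S.acc_def using visits[OF u] S.reach_cases[OF _ u] u by (auto split: if_splits)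
    then show ?thesis using answers_iff[OF u] by blast
  qed
  obtain m c where parse: "parse 0 tokens (top_label, 0, False, []) = (m, c, has_eps q, labels 0 q)"
    using parse_query[OF query, of 0 \<Sigma>s 0 False "[]"] by (auto simp: tokens_def)
  have cost: "acost size_exp + 2 = 22" by (simp add: size_exp_def)
  have time: "acost size_exp + 2 + 400 + ?n * 150 + ?v * ?s * 60 + ?v * (?n * 120 + 100) +
      off (?v * ?s) * (?n * (?n * 120 + 100)) \<le> pre"
    unfolding cost
    by (rule order_trans[OF preprocessing_time pre[unfolded time_constant_def]])
      (use n_pos length_ns_le length_concat_lists_le total in \<open>simp_all add: le_max_iff_disj\<close>)
  have delay: "2 * S.CC * S.period + 1000 \<le> del"
    unfolding S.CC_def S.period_def S.amort_def
    by (rule order_trans[OF delay_time del[unfolded time_constant_def]])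
      (use n_pos dm_le in \<open>simp_all add: le_max_iff_disj\<close>)
  have wp_main: "S.wp (main_com ?s) (\<lambda>v a g h. \<exists>js. distinct js \<and>
      set js = {(x, y). x < ?v \<and> y \<in> S.result x} \<and> sorted (map fst js) \<and> g \<le> del \<and>
      h = Preprocessed # map (\<lambda>(x, y). Out x y) js) (\<lambda>_. 0) (\<lambda>_ _. 0) (acost size_exp + 2) []"
    by (rule S.wp_main[OF cells(1,2) _ _ parse _ dm_def time delay])
      (simp_all add: length_tokens cells(3)[simplified] lab_def)
  \<comment> \<open>\<open>wp\<close> is existential in the final state, so the list of answers can
    be fixed outside of it.\<close>
  then obtain js where js: "distinct js" "set js = {(x, y). x < ?v \<and> y \<in> S.result x}" "sorted (map fst js)"
    and wp: "S.wp (main_com ?s) (\<lambda>v a g h. g \<le> del \<and> h = Preprocessed # map (\<lambda>(x, y). Out x y) js)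
      (\<lambda>_. 0) (\<lambda>_ _. 0) (acost size_exp + 2) []"
    unfolding S.wp_def by blast
  have ram: "ram_enumerates (word_size (?s + 10) inp) (program size_exp (main_com ?s)) inp js pre del"
  proof (rule S.ram_enumerates_program[OF refl _ _ _ _ wp])
    show "cell = (\<lambda>i. if i < length inp then inp ! i else 0)" by (simp add: fun_eq_iff cell_def)
    show "S.array_free size_exp" by (simp add: size_exp_def)
    have inp_nonempty: "inp \<noteq> []" using length_inp_ge(4) by auto
    have "?v * ?s \<le> bound" "2 + ?n + ?v * ?s \<le> bound" "3 + ?n + ?v * ?s \<le> bound"
      "3 + ?n + ?v * ?s + off (?v * ?s) \<le> bound" "?s \<le> bound" "3 \<le> bound"
      and "2 + ?n + ?v * ?s < length inp" "1 < length inp"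
      using search_bounds(1,4) F by linarith+
    then show "S.safe (\<lambda>_. 0) (\<lambda>_ _. 0) size_exp"
      using cells(1,2) cells(4)[of "?v * ?s"] inp_nonempty by (simp add: size_exp_def)
    show "S.aval (\<lambda>_. 0) (\<lambda>_ _. 0) size_exp = length inp"
      unfolding F using cells(1,2) cells(4)[of "?v * ?s"] by (simp add: size_exp_def)
  qed
  have js_less: "x < ?v \<and> y < ?v \<and> (ns ! x, ns ! y) \<in> answers q D" if "(x, y) \<in> set js" for x y
    using that js(2) result by auto
  \<comment> \<open>The machine prints positions of nodes. Mapping them back loses nothing, since
    the node list has no repetitions.\<close>
  define ps where "ps = map (\<lambda>(x, y). (ns ! x, ns ! y)) js"
  have positions: "map (\<lambda>(u, v). (pos ns u, pos ns v)) ps = js"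
    unfolding ps_def map_map by (rule map_idI) (auto dest: js_less simp: pos_nth[OF nodes(1)])
  have "distinct ps"
    using js(1) distinct_map[of "\<lambda>(u, v). (pos ns u, pos ns v)" ps] unfolding positions by simp
  moreover have "set ps = answers q D"
  proof
    show "set ps \<subseteq> answers q D" unfolding ps_def using js_less by auto
    show "answers q D \<subseteq> set ps"
    proof
      fix z assume z: "z \<in> answers q D"
      obtain v w where vw: "z = (v, w)" by (cases z)
      then obtain x y where "x < ?v" "v = ns ! x" "y < ?v" "w = ns ! y"
        using answers_nodes[of v w] z by (auto simp: in_set_conv_nth)
      then have "(x, y) \<in> set js" using z vw js(2) result by auto
      then show "z \<in> set ps" unfolding ps_def using \<open>v = ns ! x\<close> \<open>w = ns ! y\<close> vw by force
    qed
  qed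
  moreover have "map (\<lambda>(u, v). pos ns u) ps = map fst js"
    by (subst positions[symmetric]) (simp add: comp_def case_prod_unfold)
  then have "semi_sorted ns ps" using js(3) by (simp add: semi_sorted_def)
  ultimately show ?thesis using ram positions by auto
qed

end

lemma alternation_nonempty: "alternation qs r \<Longrightarrow> qs \<noteq> []"
  by (induction rule: alternation.induct) auto

text \<open>An alternation has at least one operand, so the class has no query over an empty
  alphabet. This supplies the assumption \<open>letters\<close>.\<close>

lemma alphabet_nonempty:
  assumes "q \<in> \<Or>(S_RPQ \<Sigma> \<union> BT_RPQ \<Sigma>)"
  shows "\<Sigma> \<noteq> {}"
proof
  assume "\<Sigma> = {}"
  then have "letter_alts \<Sigma> = {}" by (auto simp: letter_alts_def dest: alternation_nonempty)
  then have "S_RPQ \<Sigma> \<union> BT_RPQ \<Sigma> = {}" by (simp add: S_RPQ_def BT_RPQ_def)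
  then show False using assms by (auto simp: alternations_def dest: alternation_nonempty)
qed

theorem theorem7p10:
  fixes \<Sigma>s :: "'a list"
  assumes "distinct \<Sigma>s"
  shows "\<exists>P k c. solves_semi_sorted_Enum \<Sigma>s (\<Or>(S_RPQ (set \<Sigma>s) \<union> BT_RPQ (set \<Sigma>s))) P k
           (\<lambda>q (D :: ('v, 'a) graph_db). c * ((rpq_length q)^2 * max 1 (db_size D)))
           (\<lambda>q (D :: ('v, 'a) graph_db). c * ((rpq_length q)^2 * max 1 (max_degree D)))"
proof (intro exI)
  \<comment> \<open>Program, word size constant and time constant are the locale constants applied
    to \<open>\<Sigma>s\<close> alone, since they must be chosen before database and query.\<close>
  show "solves_semi_sorted_Enum \<Sigma>s (\<Or>(S_RPQ (set \<Sigma>s) \<union> BT_RPQ (set \<Sigma>s)))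
    (program (query_input.size_exp \<Sigma>s) (main_com (length \<Sigma>s))) (length \<Sigma>s + 10)
    (\<lambda>q (D :: ('v, 'a) graph_db). query_input.time_constant \<Sigma>s * ((rpq_length q)^2 * max 1 (db_size D)))
    (\<lambda>q (D :: ('v, 'a) graph_db). query_input.time_constant \<Sigma>s * ((rpq_length q)^2 * max 1 (max_degree D)))"
    unfolding solves_semi_sorted_Enum_def
  proof (intro allI ballI impI)
    fix D :: "('v, 'a) graph_db" and ns succs q
    assume q: "q \<in> \<Or>(S_RPQ (set \<Sigma>s) \<union> BT_RPQ (set \<Sigma>s))"
      and D: "is_graph_db (set \<Sigma>s) D" "represents (set \<Sigma>s) ns succs D"
    interpret query_input \<Sigma>s ns succs q D
      using assms alphabet_nonempty[OF q] simple_query_if_alternations[OF q] D by unfold_locales auto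
    show "\<exists>ps. distinct ps \<and> set ps = answers q D \<and> semi_sorted ns ps \<and>
        (let inp = encode_input \<Sigma>s ns succs q
         in ram_enumerates (word_size (length \<Sigma>s + 10) inp) (program size_exp (main_com (length \<Sigma>s))) inp
           (map (\<lambda>(u, v). (pos ns u, pos ns v)) ps)
           (time_constant * ((rpq_length q)^2 * max 1 (db_size D)))
           (time_constant * ((rpq_length q)^2 * max 1 (max_degree D))))"
      using enumerates[OF order_refl order_refl] unfolding inp_def Let_def .
  qed
qed

end
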